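(* Let $q(x^{(1)},x^{(2)},y^{(1)},y^{(2)})$ be a joint distribution on finite sets. Then for every natural number $r$, every pair $(R_{12},R_{21})$ admissible for $q$ with $r$ rounds of communication belongs to $\mathcal{R}_3$, defined as the convex closure of the set of $(R_{12},R_{21})\in\mathbb{R}^2$ for which there exists $p(u,x^{(1)},x^{(2)},y^{(1)},y^{(2)})\in T_3$ with $$R_{12}\ge I(X^{(1)};U\mid X^{(2)}),\quad R_{21}\ge I(X^{(2)};U\mid X^{(1)}),$$ $$R_{12}+R_{21}\ge I(X^{(1)};U\mid X^{(2)})+I(X^{(2)};U\mid X^{(1)})+I(Y^{(1)};Y^{(2)}\mid X^{(1)}X^{(2)}),$$ where $T_3$ is the set of joint distributions $p(u,x^{(1)},x^{(2)},y^{(1)},y^{(2)})$ such that: the marginal of $(X^{(1)},X^{(2)},Y^{(1)},Y^{(2)})$ equals $q$; $I(X^{(1)};X^{(2)}\mid U)\le I(X^{(1)};X^{(2)})$; $Y^{(1)}-UX^{(1)}-X^{(2)}Y^{(2)}$; $Y^{(2)}-UX^{(2)}-X^{(1)}Y^{(1)}$; and $|\mathcal{U}|\le|\mathcal{X}^{(1)}||\mathcal{Y}^{(1)}||\mathcal{X}^{(2)}||\mathcal{Y}^{(2)}|+1$.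
   Context: Two-node coordination problem. Fix finite alphabets and a joint pmf $q(x^{(1)},x^{(2)},y^{(1)},y^{(2)})$. For a natural number $r$, a code of blocklength $n$ with $r$ interactive rounds is as follows: node 1 observes $X^{(1)}_{1:n}$ and node 2 observes $X^{(2)}_{1:n}$, where $(X^{(1)}_i,X^{(2)}_i)_{i=1}^n$ are i.i.d. with the $(X^{(1)},X^{(2)})$-marginal of $q$; node 1 has private randomness $M_1$ and node 2 private randomness $M_2$, with $M_1$, $M_2$, $(X^{(1)}_{1:n},X^{(2)}_{1:n})$ mutually independent; there is no common randomness. Messages $C_1,\dots,C_r$ are sent, with $H(C_i\mid C_{1:i-1}X^{(1)}_{1:n}M_1)=0$ for odd $i$ and $H(C_i\mid C_{1:i-1}X^{(2)}_{1:n}M_2)=0$ for even $i$, and $\frac1n\sum_{i\text{ odd}}H(C_i)\le R_{12}$, $\frac1n\sum_{i\text{ even}}H(C_i)\le R_{21}$. Afterwards node 1 produces $\widehat Y^{(1)}_{1:n}$ as a function of $(X^{(1)}_{1:n},M_1,C_{1:r})$ and node 2 produces $\widehat Y^{(2)}_{1:n}$ as a function of $(X^{(2)}_{1:n},M_2,C_{1:r})$. The pair $(R_{12},R_{21})$ is admissible for $q$ with $r$ rounds if for every $\epsilon>0$ there is $n_0$ such that for all $n\ge n_0$ such a code exists for which the total variation ($\ell_1$) distance between the law of $(X^{(1)}_{1:n},X^{(2)}_{1:n},\widehat Y^{(1)}_{1:n},\widehat Y^{(2)}_{1:n})$ and the law of $n$ i.i.d. copies of $(X^{(1)},X^{(2)},Y^{(1)},Y^{(2)})\sim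 q$ is at most $\epsilon$. The notation $A-B-C$ means $A$ and $C$ are conditionally independent given $B$; juxtaposition denotes joint random variables. *)

theory Defs
  imports "HOL-Probability.Probability"
begin

definition mi :: "'o pmf \<Rightarrow> ('o \<Rightarrow> 'a) \<Rightarrow> ('o \<Rightarrow> 'b) \<Rightarrow> real" where
  "mi p X Y = prob_space.mutual_information (measure_pmf p) 2
      (count_space UNIV) (count_space UNIV) X Y"

definition cmi :: "'o pmf \<Rightarrow> ('o \<Rightarrow> 'a) \<Rightarrow> ('o \<Rightarrow> 'b) \<Rightarrow> ('o \<Rightarrow> 'c) \<Rightarrow> real" where
  "cmi p X Y Z = prob_space.conditional_mutual_information (measure_pmf p) 2
      (count_space UNIV) (count_space UNIV) (count_space UNIV) X Y Z"

definition markov_chain :: "'o pmf \<Rightarrow> ('o \<Rightarrow> 'a) \<Rightarrow> ('o \<Rightarrow> 'b) \<Rightarrow> ('o \<Rightarrow> 'c) \<Rightarrow> bool" where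
  "markov_chain p A B C \<longleftrightarrow>
    (\<forall>a b c. pmf (map_pmf (\<lambda>w. (A w, B w, C w)) p) (a, b, c) * pmf (map_pmf B p) b =
             pmf (map_pmf (\<lambda>w. (A w, B w)) p) (a, b) * pmf (map_pmf (\<lambda>w. (B w, C w)) p) (b, c))"

definition T3 :: "('x1::finite \<times> 'x2::finite \<times> 'y1::finite \<times> 'y2::finite) pmf
                  \<Rightarrow> (nat \<times> 'x1 \<times> 'x2 \<times> 'y1 \<times> 'y2) pmf set" where
  "T3 q = {p.
     map_pmf (\<lambda>(u, x1, x2, y1, y2). (x1, x2, y1, y2)) p = q
   \<and> cmi p (\<lambda>(u, x1, x2, y1, y2). x1) (\<lambda>(u, x1, x2, y1, y2). x2) (\<lambda>(u, x1, x2, y1, y2). u)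
       \<le> mi p (\<lambda>(u, x1, x2, y1, y2). x1) (\<lambda>(u, x1, x2, y1, y2). x2)
   \<and> markov_chain p (\<lambda>(u, x1, x2, y1, y2). y1) (\<lambda>(u, x1, x2, y1, y2). (u, x1))
                    (\<lambda>(u, x1, x2, y1, y2). (x2, y2))
   \<and> markov_chain p (\<lambda>(u, x1, x2, y1, y2). y2) (\<lambda>(u, x1, x2, y1, y2). (u, x2))
                    (\<lambda>(u, x1, x2, y1, y2). (x1, y1))
   \<and> fst ` set_pmf p \<subseteq> {..< CARD('x1) * CARD('y1) * CARD('x2) * CARD('y2) + 1}}"

definition R3 :: "('x1::finite \<times> 'x2::finite \<times> 'y1::finite \<times> 'y2::finite) pmf \<Rightarrow> (real \<times> real) set" where
  "R3 q = convex hull {(R12, R21). \<exists>p \<in> T3 q.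
      let I1 = cmi p (\<lambda>(u, x1, x2, y1, y2). x1) (\<lambda>(u, x1, x2, y1, y2). u) (\<lambda>(u, x1, x2, y1, y2). x2);
          I2 = cmi p (\<lambda>(u, x1, x2, y1, y2). x2) (\<lambda>(u, x1, x2, y1, y2). u) (\<lambda>(u, x1, x2, y1, y2). x1);
          I3 = cmi p (\<lambda>(u, x1, x2, y1, y2). y1) (\<lambda>(u, x1, x2, y1, y2). y2)
                     (\<lambda>(u, x1, x2, y1, y2). (x1, x2))
      in R12 \<ge> I1 \<and> R21 \<ge> I2 \<and> R12 + R21 \<ge> I1 + I2 + I3}"

text \<open>Private randomness M1, M2 are arbitrary probability measures on the reals (Borel).
  Message C_i (i = 1..r, values in nat) is a deterministic function of the previous messages,
  the own source sequence and the own private randomness (node 1 for odd i, node 2 for even i).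
  The j-th output symbol of node k is a function of all messages, the own source
  sequence and the own private randomness.\<close>
record ('x1, 'x2, 'y1, 'y2) coord_code =
  rnd1 :: "real measure"
  rnd2 :: "real measure"
  enc1 :: "nat \<Rightarrow> nat list \<Rightarrow> 'x1 list \<Rightarrow> real \<Rightarrow> nat"
  enc2 :: "nat \<Rightarrow> nat list \<Rightarrow> 'x2 list \<Rightarrow> real \<Rightarrow> nat"
  dec1 :: "nat \<Rightarrow> nat list \<Rightarrow> 'x1 list \<Rightarrow> real \<Rightarrow> 'y1"
  dec2 :: "nat \<Rightarrow> nat list \<Rightarrow> 'x2 list \<Rightarrow> real \<Rightarrow> 'y2"

definition valid_code :: "('x1, 'x2, 'y1, 'y2) coord_code \<Rightarrow> bool" where
  "valid_code C \<longleftrightarrow>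
     prob_space (rnd1 C) \<and> sets (rnd1 C) = sets borel \<and>
     prob_space (rnd2 C) \<and> sets (rnd2 C) = sets borel \<and>
     (\<forall>i h xs. enc1 C i h xs \<in> measurable borel (count_space UNIV)) \<and>
     (\<forall>i h xs. enc2 C i h xs \<in> measurable borel (count_space UNIV)) \<and>
     (\<forall>j h xs. dec1 C j h xs \<in> measurable borel (count_space UNIV)) \<and>
     (\<forall>j h xs. dec2 C j h xs \<in> measurable borel (count_space UNIV))"

primrec hist :: "('x1, 'x2, 'y1, 'y2) coord_code \<Rightarrow> ('x1 \<times> 'x2) list \<Rightarrow> real \<Rightarrow> real
                  \<Rightarrow> nat \<Rightarrow> nat list" where
  "hist C xs m1 m2 0 = []"
| "hist C xs m1 m2 (Suc i) =
     (let h = hist C xs m1 m2 i in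
      h @ [if odd (Suc i) then enc1 C (Suc i) h (map fst xs) m1
           else enc2 C (Suc i) h (map snd xs) m2])"

definition code_space ::
  "('x1 \<times> 'x2 \<times> 'y1 \<times> 'y2) pmf \<Rightarrow> nat \<Rightarrow> ('x1, 'x2, 'y1, 'y2) coord_code
   \<Rightarrow> (('x1 \<times> 'x2) list \<times> real \<times> real) measure" where
  "code_space q n C =
     measure_pmf (replicate_pmf n (map_pmf (\<lambda>(x1, x2, y1, y2). (x1, x2)) q))
       \<Otimes>\<^sub>M (rnd1 C \<Otimes>\<^sub>M rnd2 C)"

definition msg :: "('x1, 'x2, 'y1, 'y2) coord_code \<Rightarrow> nat
                    \<Rightarrow> ('x1 \<times> 'x2) list \<times> real \<times> real \<Rightarrow> nat" where
  "msg C i w = (case w of (xs, m1, m2) \<Rightarrow> hist C xs m1 m2 i ! (i - 1))"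

definition msg_entropy ::
  "('x1 \<times> 'x2 \<times> 'y1 \<times> 'y2) pmf \<Rightarrow> nat \<Rightarrow> ('x1, 'x2, 'y1, 'y2) coord_code \<Rightarrow> nat \<Rightarrow> ennreal" where
  "msg_entropy q n C i =
     (\<Sum>c. let P = measure (code_space q n C) {w \<in> space (code_space q n C). msg C i w = c}
          in ennreal (- P * log 2 P))"

definition code_output ::
  "nat \<Rightarrow> nat \<Rightarrow> ('x1, 'x2, 'y1, 'y2) coord_code \<Rightarrow> ('x1 \<times> 'x2) list \<times> real \<times> real
   \<Rightarrow> ('x1 \<times> 'x2 \<times> 'y1 \<times> 'y2) list" where
  "code_output n r C w = (case w of (xs, m1, m2) \<Rightarrow>
     map (\<lambda>j. (fst (xs ! j), snd (xs ! j),
               dec1 C j (hist C xs m1 m2 r) (map fst xs) m1,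
               dec2 C j (hist C xs m1 m2 r) (map snd xs) m2)) [0..<n])"

definition code_l1_dist ::
  "('x1::finite \<times> 'x2::finite \<times> 'y1::finite \<times> 'y2::finite) pmf \<Rightarrow> nat \<Rightarrow> nat
   \<Rightarrow> ('x1, 'x2, 'y1, 'y2) coord_code \<Rightarrow> real" where
  "code_l1_dist q n r C =
     (\<Sum>t \<in> {t. length t = n}.
        \<bar>measure (code_space q n C) {w \<in> space (code_space q n C). code_output n r C w = t}
         - pmf (replicate_pmf n q) t\<bar>)"

definition admissible ::
  "('x1::finite \<times> 'x2::finite \<times> 'y1::finite \<times> 'y2::finite) pmf \<Rightarrow> nat \<Rightarrow> real \<Rightarrow> real \<Rightarrow> bool" where
  "admissible q r R12 R21 \<longleftrightarrow>
     (\<forall>\<epsilon>>0. \<exists>n0. \<forall>n\<ge>n0. \<exists>C :: ('x1, 'x2, 'y1, 'y2) coord_code.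
        valid_code C \<and>
        enn2ereal (\<Sum>i \<in> {i \<in> {1..r}. odd i}. msg_entropy q n C i) \<le> ereal (real n * R12) \<and>
        enn2ereal (\<Sum>i \<in> {i \<in> {1..r}. even i}. msg_entropy q n C i) \<le> ereal (real n * R21) \<and>
        code_l1_dist q n r C \<le> \<epsilon>)"

end

theory Submission
  imports Defs "HOL-Real_Asymp.Real_Asymp"
begin

text \<open>Given the transcript \<open>C\<close>, the law of the code factorises into a part seen by node 1 and a part
  seen by node 2. Put \<open>U\<^sub>i = (C, X\<^sup>(\<^sup>1\<^sup>)\<^sub>1\<^sub>:\<^sub>i\<^sub>-\<^sub>1, X\<^sup>(\<^sup>2\<^sup>)\<^sub>i\<^sub>+\<^sub>1\<^sub>:\<^sub>n)\<close>; the factorisation makes both Markov chains of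
  \<open>T3\<close> exact for every letter. Interaction does not increase \<open>I(X\<^sup>(\<^sup>1\<^sup>); X\<^sup>(\<^sup>2\<^sup>))\<close>, so \<open>H(C)\<close> dominates
  \<open>I(X\<^sup>(\<^sup>1\<^sup>); C | X\<^sup>(\<^sup>2\<^sup>)) + I(X\<^sup>(\<^sup>2\<^sup>); C | X\<^sup>(\<^sup>1\<^sup>)) + H(C | X\<^sup>(\<^sup>1\<^sup>) X\<^sup>(\<^sup>2\<^sup>))\<close>, and the last term dominates the
  conditional mutual information of the outputs because they are independent given the inputs and
  \<open>C\<close>; continuity of entropy compares it with \<open>n\<close> times the one of \<open>q\<close>.

  A nonnegative linear functional of the rates is linear in the weights of the values of \<open>(i, U\<^sub>i)\<close>,
  so minimising it is a linear program with one constraint per value of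
  \<open>(X\<^sup>(\<^sup>1\<^sup>), X\<^sup>(\<^sup>2\<^sup>), Y\<^sup>(\<^sup>1\<^sup>), Y\<^sup>(\<^sup>2\<^sup>))\<close> and one more for \<open>I(X\<^sup>(\<^sup>1\<^sup>); X\<^sup>(\<^sup>2\<^sup>) | U)\<close>. A basic solution obeys the
  cardinality bound. Compactness removes the approximation error, and a separating
  hyperplane turns the bounds for all functionals into membership in the convex hull.

  Distributions conditioned on a value of \<open>U\<close> are kept unnormalised: conditional entropies and the
  Markov conditions are homogeneous, so every quantity is a plain sum over slices.\<close>

section \<open>Unnormalised entropies on finite sets\<close>

text \<open>\<open>R3\<close> is a convex hull without closure, and its bound on U leaves room for
  one constraint besides the law of the quadruple. So the two rates cannot both be kept when U
  shrinks; one weighted sum is optimised at a time. The third inequality fits this scheme because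
  I(Y1;Y2|X1 X2) is fixed by \<open>q\<close>: it merely adds the polyhedron x, y \<ge> 0, x + y
  \<ge> c to the rate points.

  U_i mixes a past of X1 with a future of X2 because, given C, the two nodes are coupled only
  through the source. Knowing x1 before a position and x2 from it on turns every source factor into
  a function of one side. Adjoining X1_i or X2_i to U_i puts that position at i + 1 or at i, one for
  each Markov chain.

  The source has its exact law in every code, so I(X1;X2|U) and the two single rates suffer no
  continuity error; only the output term does. Messages range over all naturals and are cut off at a
  large N before finite sums are used; the errors vanish as N grows.\<close>

definition marg :: "'w set \<Rightarrow> ('w \<Rightarrow> real) \<Rightarrow> ('w \<Rightarrow> 'a) \<Rightarrow> 'a \<Rightarrow> real" where
  "marg \<Omega> \<mu> X a = (\<Sum>w\<in>{w\<in>\<Omega>. X w = a}. \<mu> w)"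

text \<open>For a measure of mass s > 0 this is s times the entropy of the normalised law plus
  \<open>eta s\<close>. The offset is the same for every variable, so differences of two such
  entropies behave like conditional entropies.\<close>

definition ent :: "'w set \<Rightarrow> ('w \<Rightarrow> real) \<Rightarrow> ('w \<Rightarrow> 'a) \<Rightarrow> real" where
  "ent \<Omega> \<mu> X = - (\<Sum>w\<in>\<Omega>. \<mu> w * log 2 (marg \<Omega> \<mu> X (X w)))"

definition eta :: "real \<Rightarrow> real" where
  "eta t = - t * log 2 t"

abbreviation joint :: "('w \<Rightarrow> 'a) \<Rightarrow> ('w \<Rightarrow> 'b) \<Rightarrow> 'w \<Rightarrow> 'a \<times> 'b" (infixr "\<otimes>" 75) where
  "X \<otimes> Y \<equiv> \<lambda>w. (X w, Y w)"

text \<open>Conditional independence of \<open>X\<close> and \<open>Y\<close> given \<open>Z\<close>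
  in the form in which a code delivers it: two kernels suffice, neither has to be normalised, and
  values of \<open>Z\<close> of mass zero need no case distinction.\<close>

definition factors ::
  "'w set \<Rightarrow> ('w \<Rightarrow> real) \<Rightarrow> ('w \<Rightarrow> 'a) \<Rightarrow> ('w \<Rightarrow> 'b) \<Rightarrow> ('w \<Rightarrow> 'c) \<Rightarrow> bool" where
  "factors \<Omega> \<mu> X Y Z \<longleftrightarrow>
     (\<exists>F G. \<forall>x y z. marg \<Omega> \<mu> (X \<otimes> Y \<otimes> Z) (x, y, z) = F x z * G y z)"

lemma marg_cong:
  assumes "\<And>w. w \<in> \<Omega> \<Longrightarrow> X w = a \<longleftrightarrow> Y w = b"
  shows "marg \<Omega> \<mu> X a = marg \<Omega> \<mu> Y b"
  unfolding marg_def by (rule sum.cong) (use assms in auto)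

lemma marg_eq_0: "a \<notin> X ` \<Omega> \<Longrightarrow> marg \<Omega> \<mu> X a = 0"
  unfolding marg_def by (rule sum.neutral) auto

lemma marg_scale: "marg \<Omega> (\<lambda>w. c * \<mu> w) X a = c * marg \<Omega> \<mu> X a"
  by (simp add: marg_def sum_distrib_left)

lemma log_ge_one_minus_inverse:
  fixes t :: real assumes "0 < t" shows "(1 - 1 / t) / ln 2 \<le> log 2 t"
proof -
  have "ln (1 / t) \<le> 1 / t - 1" by (rule ln_le_minus_one) (use assms in simp)
  then have "1 - 1 / t \<le> ln t" using assms by (simp add: ln_div)
  then show ?thesis by (simp add: log_def divide_right_mono)
qed

locale finite_mass =
  fixes \<Omega> :: "'w set" and \<mu> :: "'w \<Rightarrow> real"
  assumes fin: "finite \<Omega>" and nonneg: "\<And>w. w \<in> \<Omega> \<Longrightarrow> 0 \<le> \<mu> w"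
begin

abbreviation m :: "('w \<Rightarrow> 'a) \<Rightarrow> 'a \<Rightarrow> real" where "m \<equiv> marg \<Omega> \<mu>"
abbreviation H :: "('w \<Rightarrow> 'a) \<Rightarrow> real" where "H \<equiv> ent \<Omega> \<mu>"

lemma marg_nonneg: "0 \<le> m X a"
  unfolding marg_def by (rule sum_nonneg) (use nonneg in auto)

lemma le_marg: "w \<in> \<Omega> \<Longrightarrow> \<mu> w \<le> m X (X w)"
  unfolding marg_def by (rule member_le_sum) (use fin nonneg in auto)

lemma marg_pos: "w \<in> \<Omega> \<Longrightarrow> 0 < \<mu> w \<Longrightarrow> 0 < m X (X w)"
  using le_marg[of w X] by linarith

lemma sum_by_value: "(\<Sum>w\<in>\<Omega>. \<mu> w * \<phi> (X w)) = (\<Sum>a\<in>X ` \<Omega>. m X a * \<phi> a)"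
proof -
  have "(\<Sum>w\<in>\<Omega>. \<mu> w * \<phi> (X w)) = (\<Sum>a\<in>X ` \<Omega>. \<Sum>w\<in>{w\<in>\<Omega>. X w = a}. \<mu> w * \<phi> (X w))"
    by (rule sum.image_gen) (rule fin)
  also have "\<dots> = (\<Sum>a\<in>X ` \<Omega>. m X a * \<phi> a)"
    by (rule sum.cong) (auto simp: marg_def sum_distrib_right intro!: sum.cong)
  finally show ?thesis .
qed

lemma sum_marg: "(\<Sum>a\<in>X ` \<Omega>. m X a) = sum \<mu> \<Omega>"
  using sum_by_value[of "\<lambda>_. 1" X] by simp

lemma marg_comp: "m (\<lambda>w. f (X w)) b = (\<Sum>a\<in>{a\<in>X ` \<Omega>. f a = b}. m X a)"
proof -
  have "m (\<lambda>w. f (X w)) b = (\<Sum>w\<in>\<Omega>. \<mu> w * (if f (X w) = b then 1 else 0))"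
    unfolding marg_def by (rule sum.mono_neutral_cong_left) (use fin in auto)
  also have "\<dots> = (\<Sum>a\<in>X ` \<Omega>. m X a * (if f a = b then 1 else 0))"
    by (rule sum_by_value)
  also have "\<dots> = (\<Sum>a\<in>{a\<in>X ` \<Omega>. f a = b}. m X a)"
    by (rule sum.mono_neutral_cong_right) (use fin in auto)
  finally show ?thesis .
qed

lemma ent_eq_sum_eta: "H X = (\<Sum>a\<in>X ` \<Omega>. eta (m X a))"
proof -
  have "H X = - (\<Sum>a\<in>X ` \<Omega>. m X a * log 2 (m X a))"
    unfolding ent_def by (subst sum_by_value) (rule refl)
  then show ?thesis by (simp add: eta_def sum_negf)
qed

lemma ent_cong:
  assumes "\<And>w w'. w \<in> \<Omega> \<Longrightarrow> w' \<in> \<Omega> \<Longrightarrow> X w = X w' \<longleftrightarrow> Y w = Y w'"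
  shows "H X = H Y"
proof -
  have "m X (X w) = m Y (Y w)" if "w \<in> \<Omega>" for w
    by (rule marg_cong) (use assms that in auto)
  then show ?thesis by (simp add: ent_def)
qed

lemma marg_sum_left:
  "(\<Sum>x\<in>X ` \<Omega>. m (X \<otimes> Y) (x, y)) = m Y y"
proof -
  have "m Y y = (\<Sum>w\<in>{w\<in>\<Omega>. Y w = y}. \<mu> w)" by (simp add: marg_def)
  also have "\<dots> = (\<Sum>x\<in>X ` \<Omega>. \<Sum>w\<in>{w\<in>{w\<in>\<Omega>. Y w = y}. X w = x}. \<mu> w)"
    by (rule sum.group[symmetric]) (use fin in auto)
  also have "\<dots> = (\<Sum>x\<in>X ` \<Omega>. m (X \<otimes> Y) (x, y))"
    unfolding marg_def by (intro sum.cong refl) auto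
  finally show ?thesis by simp
qed

lemma marg_pair_le: "m (X \<otimes> Y) (x, y) \<le> m Y y"
  unfolding marg_def by (rule sum_mono2) (use fin nonneg in auto)

lemma ent_mono: "H Y \<le> H (X \<otimes> Y)"
proof -
  have "\<mu> w * log 2 (m (X \<otimes> Y) (X w, Y w)) \<le> \<mu> w * log 2 (m Y (Y w))" if w: "w \<in> \<Omega>" for w
  proof (cases "\<mu> w = 0")
    case False
    then have "0 < \<mu> w" using nonneg[OF w] by simp
    then have "0 < m (X \<otimes> Y) (X w, Y w)"
      using marg_pos[OF w, of "\<lambda>w. (X w, Y w)"] by simp
    then show ?thesis
      using marg_pair_le[of X Y "X w" "Y w"] \<open>0 < \<mu> w\<close> by (intro mult_left_mono) auto
  qed simp
  then show ?thesis by (simp add: ent_def sum_mono)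
qed

text \<open>This is I(X;Y|Z) \<ge> 0 for any total mass. The logarithm of t is bounded below by
  means of 1 - 1/t; the reciprocal ratio \<open>g\<close> compares p(x,z) p(y,z) / p(z) with the
  joint law and has integral at most the total mass.\<close>

lemma ent_submodular:
  "H (X \<otimes> Y \<otimes> Z) + H Z \<le> H (X \<otimes> Z) + H (Y \<otimes> Z)"
proof -
  let ?XYZ = "\<lambda>w. (X w, Y w, Z w)" and ?XZ = "\<lambda>w. (X w, Z w)" and ?YZ = "\<lambda>w. (Y w, Z w)"
  define g where "g = (\<lambda>(x, y, z). m ?XZ (x, z) * m ?YZ (y, z) / (m ?XYZ (x, y, z) * m Z z))"
  have pt: "\<mu> w * ((1 - g (?XYZ w)) / ln 2) \<le> \<mu> w * (log 2 (m ?XYZ (?XYZ w)) + log 2 (m Z (Z w))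
      - log 2 (m ?XZ (?XZ w)) - log 2 (m ?YZ (?YZ w)))" if w: "w \<in> \<Omega>" for w
  proof (cases "\<mu> w = 0")
    case False
    then have p: "0 < \<mu> w" using nonneg[OF w] by simp
    have a: "0 < m ?XYZ (?XYZ w)" and b: "0 < m Z (Z w)" and c: "0 < m ?XZ (?XZ w)"
      and d: "0 < m ?YZ (?YZ w)"
      using marg_pos[OF w p, of ?XYZ] marg_pos[OF w p, of Z] marg_pos[OF w p, of ?XZ]
        marg_pos[OF w p, of ?YZ] by simp_all
    have "(1 - 1 / (m ?XYZ (?XYZ w) * m Z (Z w) / (m ?XZ (?XZ w) * m ?YZ (?YZ w)))) / ln 2
       \<le> log 2 (m ?XYZ (?XYZ w) * m Z (Z w) / (m ?XZ (?XZ w) * m ?YZ (?YZ w)))"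
      by (rule log_ge_one_minus_inverse) (use a b c d in simp)
    also have "\<dots> = log 2 (m ?XYZ (?XYZ w)) + log 2 (m Z (Z w))
      - log 2 (m ?XZ (?XZ w)) - log 2 (m ?YZ (?YZ w))"
      using a b c d by (simp add: log_mult log_divide)
    finally show ?thesis using p by (intro mult_left_mono) (simp_all add: g_def)
  qed simp
  have "(\<Sum>w\<in>\<Omega>. \<mu> w * g (?XYZ w)) = (\<Sum>a\<in>?XYZ ` \<Omega>. m ?XYZ a * g a)"
    by (rule sum_by_value)
  \<comment> \<open>Only an inequality: where the joint marginal vanishes, division by zero makes
    \<open>g\<close> zero.\<close>
  also have "\<dots> \<le> (\<Sum>(x, y, z)\<in>?XYZ ` \<Omega>. m ?XZ (x, z) * m ?YZ (y, z) / m Z z)"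
    by (rule sum_mono) (auto simp: g_def marg_nonneg split: prod.splits)
  also have "\<dots> \<le> (\<Sum>(x, y, z)\<in>X ` \<Omega> \<times> Y ` \<Omega> \<times> Z ` \<Omega>. m ?XZ (x, z) * m ?YZ (y, z) / m Z z)"
    by (rule sum_mono2) (use fin in \<open>auto simp: marg_nonneg\<close>)
  also have "\<dots> = (\<Sum>x\<in>X ` \<Omega>. \<Sum>y\<in>Y ` \<Omega>. \<Sum>z\<in>Z ` \<Omega>. m ?XZ (x, z) * m ?YZ (y, z) / m Z z)"
    by (simp add: sum.cartesian_product)
  also have "\<dots> = (\<Sum>x\<in>X ` \<Omega>. \<Sum>z\<in>Z ` \<Omega>. \<Sum>y\<in>Y ` \<Omega>. m ?XZ (x, z) * m ?YZ (y, z) / m Z z)"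
    by (intro sum.cong refl sum.swap)
  also have "\<dots> = (\<Sum>z\<in>Z ` \<Omega>. \<Sum>x\<in>X ` \<Omega>. \<Sum>y\<in>Y ` \<Omega>. m ?XZ (x, z) * m ?YZ (y, z) / m Z z)"
    by (rule sum.swap)
  also have "\<dots> = (\<Sum>z\<in>Z ` \<Omega>. m Z z)"
  proof (rule sum.cong[OF refl])
    fix z
    have "(\<Sum>x\<in>X ` \<Omega>. \<Sum>y\<in>Y ` \<Omega>. m ?XZ (x, z) * m ?YZ (y, z) / m Z z)
        = (\<Sum>x\<in>X ` \<Omega>. m ?XZ (x, z)) * (\<Sum>y\<in>Y ` \<Omega>. m ?YZ (y, z)) / m Z z"
      by (simp add: sum_product sum_divide_distrib)
    then show "(\<Sum>x\<in>X ` \<Omega>. \<Sum>y\<in>Y ` \<Omega>. m ?XZ (x, z) * m ?YZ (y, z) / m Z z) = m Z z"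
      by (simp add: marg_sum_left)
  qed
  also have "\<dots> = sum \<mu> \<Omega>" by (rule sum_marg)
  finally have le: "(\<Sum>w\<in>\<Omega>. \<mu> w * g (?XYZ w)) \<le> sum \<mu> \<Omega>" .
  have "0 \<le> (sum \<mu> \<Omega> - (\<Sum>w\<in>\<Omega>. \<mu> w * g (?XYZ w))) / ln 2" using le by simp
  also have "\<dots> = (\<Sum>w\<in>\<Omega>. \<mu> w * ((1 - g (?XYZ w)) / ln 2))"
    by (simp add: sum_subtractf[symmetric] sum_divide_distrib right_diff_distrib diff_divide_distrib)
  also have "\<dots> \<le> (\<Sum>w\<in>\<Omega>. \<mu> w * (log 2 (m ?XYZ (?XYZ w)) + log 2 (m Z (Z w))
      - log 2 (m ?XZ (?XZ w)) - log 2 (m ?YZ (?YZ w))))"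
    by (rule sum_mono) (rule pt)
  also have "\<dots> = H ?XZ + H ?YZ - H ?XYZ - H Z"
    by (simp add: ent_def ring_distribs sum.distrib sum_subtractf)
  finally show ?thesis by simp
qed

text \<open>Each side may be coarsened on its own: the fibre over a pair of values is a product set,
  so the sum of F times G over it splits. \<open>Z\<close> stays as it is, since merging its values
  would mix different kernels.\<close>

lemma factors_comp:
  assumes "factors \<Omega> \<mu> X Y Z"
  shows "factors \<Omega> \<mu> (\<lambda>w. f (X w)) (\<lambda>w. g (Y w)) Z"
proof -
  obtain F G where FG: "\<And>x y z. m (X \<otimes> Y \<otimes> Z) (x, y, z) = F x z * G y z"
    using assms by (auto simp: factors_def)
  have "m (\<lambda>w. (f (X w), g (Y w), Z w)) (x', y', z)
      = (\<Sum>x\<in>{x\<in>X ` \<Omega>. f x = x'}. F x z) * (\<Sum>y\<in>{y\<in>Y ` \<Omega>. g y = y'}. G y z)" for x' y' z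
  proof -
    have "m (\<lambda>w. (f (X w), g (Y w), Z w)) (x', y', z)
      = m (\<lambda>w. (\<lambda>(x, y, z). (f x, g y, z)) (X w, Y w, Z w)) (x', y', z)" by simp
    also have "\<dots> = (\<Sum>a\<in>{a\<in>(X \<otimes> Y \<otimes> Z) ` \<Omega>. (\<lambda>(x, y, z). (f x, g y, z)) a = (x', y', z)}.
        m (X \<otimes> Y \<otimes> Z) a)"
      by (rule marg_comp)
    also have "\<dots> = (\<Sum>a\<in>{x\<in>X ` \<Omega>. f x = x'} \<times> {y\<in>Y ` \<Omega>. g y = y'} \<times> {z}.
        m (X \<otimes> Y \<otimes> Z) a)"
    proof (rule sum.mono_neutral_left)
      show "\<forall>i\<in>{x\<in>X ` \<Omega>. f x = x'} \<times> {y\<in>Y ` \<Omega>. g y = y'} \<times> {z} -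
        {a\<in>(X \<otimes> Y \<otimes> Z) ` \<Omega>. (\<lambda>(x, y, z). (f x, g y, z)) a = (x', y', z)}.
        m (X \<otimes> Y \<otimes> Z) i = 0"
        by (intro ballI marg_eq_0) auto
    qed (use fin in auto)
    also have "\<dots> = (\<Sum>x\<in>{x\<in>X ` \<Omega>. f x = x'}. \<Sum>y\<in>{y\<in>Y ` \<Omega>. g y = y'}. F x z * G y z)"
      by (simp add: sum.cartesian_product' FG)
    finally show ?thesis by (simp add: sum_product)
  qed
  then show ?thesis unfolding factors_def
    by (intro exI[of _ "\<lambda>x' z. \<Sum>x\<in>{x\<in>X ` \<Omega>. f x = x'}. F x z"]
        exI[of _ "\<lambda>y' z. \<Sum>y\<in>{y\<in>Y ` \<Omega>. g y = y'}. G y z"]) simp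
qed

lemma factors_imp_markov:
  assumes "factors \<Omega> \<mu> X Y Z"
  shows "m (X \<otimes> Y \<otimes> Z) (x, y, z) * m Z z
       = m (X \<otimes> Z) (x, z) * m (Y \<otimes> Z) (y, z)"
proof -
  obtain F G where FG: "\<And>x y z. m (X \<otimes> Y \<otimes> Z) (x, y, z) = F x z * G y z"
    using assms by (auto simp: factors_def)
  have yz: "m (Y \<otimes> Z) (y, z) = (\<Sum>x\<in>X ` \<Omega>. F x z) * G y z" for y
    using marg_sum_left[of X "\<lambda>w. (Y w, Z w)" "(y, z)"] by (simp add: FG sum_distrib_right)
  have swap: "m (X \<otimes> Y \<otimes> Z) (x, y, z) = m (Y \<otimes> X \<otimes> Z) (y, x, z)" for x y
    by (rule marg_cong) auto
  have xz: "m (X \<otimes> Z) (x, z) = F x z * (\<Sum>y\<in>Y ` \<Omega>. G y z)" for x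
    using marg_sum_left[of Y "\<lambda>w. (X w, Z w)" "(x, z)"]
    by (simp add: swap[symmetric] FG sum_distrib_left)
  have "m Z z = (\<Sum>x\<in>X ` \<Omega>. F x z) * (\<Sum>y\<in>Y ` \<Omega>. G y z)"
    using marg_sum_left[of Y Z z] by (simp add: yz sum_distrib_left)
  then show ?thesis by (simp add: FG yz xz)
qed

text \<open>The equality case of \<open>ent_submodular\<close>: the Markov identity balances the
  four logarithms at every point of positive mass.\<close>

lemma factors_ent:
  assumes "factors \<Omega> \<mu> X Y Z"
  shows "H (X \<otimes> Y \<otimes> Z) + H Z = H (X \<otimes> Z) + H (Y \<otimes> Z)"
proof -
  let ?XYZ = "\<lambda>w. (X w, Y w, Z w)" and ?XZ = "\<lambda>w. (X w, Z w)" and ?YZ = "\<lambda>w. (Y w, Z w)"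
  have "\<mu> w * log 2 (m ?XYZ (?XYZ w)) + \<mu> w * log 2 (m Z (Z w))
      = \<mu> w * log 2 (m ?XZ (?XZ w)) + \<mu> w * log 2 (m ?YZ (?YZ w))" if w: "w \<in> \<Omega>" for w
  proof (cases "\<mu> w = 0")
    case False
    then have p: "0 < \<mu> w" using nonneg[OF w] by simp
    have a: "0 < m ?XYZ (?XYZ w)" and b: "0 < m Z (Z w)" and c: "0 < m ?XZ (?XZ w)"
      and d: "0 < m ?YZ (?YZ w)"
      using marg_pos[OF w p, of ?XYZ] marg_pos[OF w p, of Z] marg_pos[OF w p, of ?XZ]
        marg_pos[OF w p, of ?YZ] by simp_all
    have "log 2 (m ?XYZ (?XYZ w) * m Z (Z w)) = log 2 (m ?XZ (?XZ w) * m ?YZ (?YZ w))"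
      by (simp only: factors_imp_markov[OF assms])
    then have "log 2 (m ?XYZ (?XYZ w)) + log 2 (m Z (Z w))
      = log 2 (m ?XZ (?XZ w)) + log 2 (m ?YZ (?YZ w))"
      using a b c d by (simp add: log_mult)
    then show ?thesis by (simp only: distrib_left[symmetric])
  qed simp
  then have "(\<Sum>w\<in>\<Omega>. \<mu> w * log 2 (m ?XYZ (?XYZ w)) + \<mu> w * log 2 (m Z (Z w)))
      = (\<Sum>w\<in>\<Omega>. \<mu> w * log 2 (m ?XZ (?XZ w)) + \<mu> w * log 2 (m ?YZ (?YZ w)))"
    by (rule sum.cong[OF refl])
  then show ?thesis by (simp add: ent_def sum.distrib)
qed

text \<open>Submodularity over a constant third variable. The entropy of a constant is
  \<open>eta\<close> of the total mass, which is why mass one is assumed.\<close>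

lemma ent_subadditive:
  assumes "sum \<mu> \<Omega> = 1"
  shows "H (X \<otimes> Y) \<le> H X + H Y"
proof -
  have "H (\<lambda>w. ()) = 0" using assms by (simp add: ent_def marg_def)
  moreover have "H (\<lambda>w. (X w, Y w, ())) = H (X \<otimes> Y)" "H (\<lambda>w. (X w, ())) = H X"
    "H (\<lambda>w. (Y w, ())) = H Y"
    by (rule ent_cong; simp)+
  ultimately show ?thesis using ent_submodular[of X Y "\<lambda>_. ()"] by simp
qed

lemma marg_slice:
  fixes Z :: "'w \<Rightarrow> 'z::finite"
  shows "marg UNIV (\<lambda>z. m (U \<otimes> Z) (u, z)) f a = m (\<lambda>w. (U w, f (Z w))) (u, a)"
proof -
  let ?UZ = "\<lambda>w. (U w, Z w)"
  have "m (\<lambda>w. (U w, f (Z w))) (u, a) = m (\<lambda>w. (\<lambda>(u, z). (u, f z)) (?UZ w)) (u, a)" by simp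
  also have "\<dots> = (\<Sum>b\<in>{b\<in>?UZ ` \<Omega>. (\<lambda>(u, z). (u, f z)) b = (u, a)}. m ?UZ b)"
    by (rule marg_comp)
  also have "\<dots> = (\<Sum>b\<in>{u} \<times> {z. f z = a}. m ?UZ b)"
    by (rule sum.mono_neutral_left) (use fin in \<open>auto intro!: marg_eq_0\<close>)
  also have "\<dots> = (\<Sum>z\<in>{z. f z = a}. m ?UZ (u, z))"
    by (simp add: sum.cartesian_product')
  finally show ?thesis by (simp add: marg_def)
qed

text \<open>Splitting over the values of \<open>U\<close> leaves unnormalised entropies of the slices; no
  conditional distribution has to be formed.\<close>

lemma ent_disintegrate:
  fixes Z :: "'w \<Rightarrow> 'z::finite"
  assumes "finite V" "U ` \<Omega> \<subseteq> V"
  shows "H (\<lambda>w. (U w, f (Z w))) = (\<Sum>u\<in>V. ent UNIV (\<lambda>z. m (U \<otimes> Z) (u, z)) f)"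
proof -
  let ?UZ = "\<lambda>w. (U w, Z w)"
  have "- H (\<lambda>w. (U w, f (Z w))) =
    (\<Sum>w\<in>\<Omega>. \<mu> w * (\<lambda>(u, z). log 2 (m (\<lambda>w. (U w, f (Z w))) (u, f z))) (?UZ w))"
    by (simp add: ent_def)
  also have "\<dots> = (\<Sum>b\<in>?UZ ` \<Omega>. m ?UZ b * (\<lambda>(u, z). log 2 (m (\<lambda>w. (U w, f (Z w))) (u, f z))) b)"
    by (rule sum_by_value)
  also have "\<dots> = (\<Sum>b\<in>V \<times> UNIV. m ?UZ b * (\<lambda>(u, z). log 2 (m (\<lambda>w. (U w, f (Z w))) (u, f z))) b)"
    by (rule sum.mono_neutral_left) (use assms in \<open>auto simp: marg_eq_0\<close>)
  also have "\<dots> = (\<Sum>u\<in>V. - ent UNIV (\<lambda>z. m ?UZ (u, z)) f)"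
    by (simp add: sum.cartesian_product' ent_def marg_slice)
  finally show ?thesis by (simp add: sum_negf)
qed

end

lemma ent_scale:
  assumes "0 < c" and "finite_mass \<Omega> \<mu>"
  shows "ent \<Omega> (\<lambda>w. c * \<mu> w) X = c * ent \<Omega> \<mu> X - c * log 2 c * sum \<mu> \<Omega>"
proof -
  interpret finite_mass \<Omega> \<mu> by fact
  have "c * \<mu> w * log 2 (c * m X (X w)) = c * (\<mu> w * log 2 (m X (X w))) + c * log 2 c * \<mu> w"
    if w: "w \<in> \<Omega>" for w
  proof (cases "\<mu> w = 0")
    case False
    then have "0 < m X (X w)" using marg_pos[OF w] nonneg[OF w] by simp
    then show ?thesis using assms by (simp add: log_mult algebra_simps)
  qed simp
  then show ?thesis
    by (simp add: ent_def marg_scale sum.distrib sum_distrib_left)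
qed

lemma ent_diff_scale:
  assumes "0 \<le> c" and "finite_mass \<Omega> \<mu>"
  shows "ent \<Omega> (\<lambda>w. c * \<mu> w) X - ent \<Omega> (\<lambda>w. c * \<mu> w) Y = c * (ent \<Omega> \<mu> X - ent \<Omega> \<mu> Y)"
proof (cases "c = 0")
  case True then show ?thesis by (simp add: ent_def)
next
  case False then show ?thesis using assms by (simp add: ent_scale algebra_simps)
qed

section \<open>Continuity of entropy and i.i.d. blocks\<close>

lemma eta_nonneg: "0 \<le> t \<Longrightarrow> t \<le> 1 \<Longrightarrow> 0 \<le> eta t"
  by (cases "t = 0") (auto simp: eta_def mult_nonneg_nonpos)

lemma eta_add_le:
  assumes "0 \<le> b" "0 \<le> d" shows "eta (b + d) \<le> eta b + eta d"
proof (cases "b = 0 \<or> d = 0")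
  case False
  then have "b * log 2 b \<le> b * log 2 (b + d)" "d * log 2 d \<le> d * log 2 (b + d)"
    using assms by (auto intro!: mult_left_mono)
  then show ?thesis by (simp add: eta_def algebra_simps)
qed (auto simp: eta_def)

text \<open>On (0, 1] the derivative of \<open>eta\<close> is at least - 1 / ln 2, so
  \<open>eta\<close> drops by at most d / ln 2 along an interval of length d.\<close>

lemma eta_le_add:
  assumes "0 \<le> b" "0 \<le> d" "b + d \<le> 1" shows "eta b \<le> eta (b + d) + d / ln 2"
proof (cases "b = 0")
  case True
  have "0 \<le> eta d" using assms by (intro eta_nonneg) auto
  moreover have "0 \<le> d / ln 2" using assms by simp
  moreover have "eta b = 0" "eta (b + d) = eta d" using True by (simp_all add: eta_def)
  ultimately show ?thesis by linarith
next
  case False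
  then have b: "0 < b" using assms by simp
  have "ln ((b + d) / b) \<le> (b + d) / b - 1" by (rule ln_le_minus_one) (use b assms in simp)
  then have "b * (ln (b + d) - ln b) \<le> d"
    using b assms by (simp add: ln_div field_simps)
  moreover have "d * ln (b + d) \<le> 0" using b assms by (intro mult_nonneg_nonpos) auto
  ultimately have "(b + d) * ln (b + d) - b * ln b \<le> d" by (simp add: algebra_simps)
  then have "((b + d) * ln (b + d) - b * ln b) / ln 2 \<le> d / ln 2" by (simp add: divide_right_mono)
  moreover have "eta b - eta (b + d) = ((b + d) * ln (b + d) - b * ln b) / ln 2"
    by (simp add: eta_def log_def field_simps)
  ultimately show ?thesis by linarith
qed

lemma eta_dist:
  assumes "0 \<le> a" "a \<le> 1" "0 \<le> b" "b \<le> 1"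
  shows "\<bar>eta a - eta b\<bar> \<le> eta \<bar>a - b\<bar> + \<bar>a - b\<bar> / ln 2"
proof -
  have *: "\<bar>eta (c + d) - eta c\<bar> \<le> eta d + d / ln 2" if "0 \<le> c" "0 \<le> d" "c + d \<le> 1" for c d
  proof -
    have "0 \<le> eta d" using that by (intro eta_nonneg) auto
    moreover have "0 \<le> d / ln 2" using that by simp
    ultimately show ?thesis using eta_add_le[of c d] eta_le_add[of c d] that by linarith
  qed
  show ?thesis using *[of b "a - b"] *[of a "b - a"] assms
    by (cases "b \<le> a") (auto simp: abs_minus_commute)
qed

lemma sum_eta_le:
  assumes "finite S" "\<And>s. s \<in> S \<Longrightarrow> 0 \<le> d s" "sum d S \<le> e" "0 < e" "e \<le> N" "real (card S) \<le> N"
  shows "(\<Sum>s\<in>S. eta (d s)) \<le> e * log 2 (N / e) + e / ln 2"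
proof -
  have N: "0 < N" using assms by linarith
  \<comment> \<open>The right-hand side is the tangent of the concave function \<open>eta\<close> at
    e / N, the common value when mass e is spread evenly over N points.\<close>
  have pt: "eta (d s) \<le> d s * log 2 (N / e) + (e / N - d s) / ln 2" if s: "s \<in> S" for s
  proof (cases "d s = 0")
    case True
    then show ?thesis using N assms by (simp add: eta_def)
  next
    case False
    then have p: "0 < d s" using assms(2)[OF s] by simp
    have "ln (e / N / d s) \<le> e / N / d s - 1" by (rule ln_le_minus_one) (use p N assms in simp)
    then have "d s * ln (e / N / d s) \<le> d s * (e / N / d s - 1)" using p by simp
    also have "\<dots> = e / N - d s" using p by (simp add: right_diff_distrib)
    finally have le: "d s * ln (e / N / d s) \<le> e / N - d s" .
    have eq: "ln (e / N / d s) = - ln (N / e) - ln (d s)"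
      using p N assms(4) by (simp add: ln_div ln_mult)
    have "- d s * ln (d s) \<le> d s * ln (N / e) + (e / N - d s)"
      using le unfolding eq by (simp add: algebra_simps)
    then have "- d s * ln (d s) / ln 2 \<le> (d s * ln (N / e) + (e / N - d s)) / ln 2"
      by (rule divide_right_mono) simp
    then show ?thesis by (simp add: eta_def log_def add_divide_distrib)
  qed
  have "(\<Sum>s\<in>S. eta (d s)) \<le> (\<Sum>s\<in>S. d s * log 2 (N / e) + (e / N - d s) / ln 2)"
    by (rule sum_mono) (rule pt)
  also have "\<dots> = sum d S * log 2 (N / e) + (real (card S) * (e / N) - sum d S) / ln 2"
    by (simp add: sum.distrib sum_distrib_right sum_divide_distrib[symmetric] sum_subtractf)
  also have "\<dots> \<le> e * log 2 (N / e) + e / ln 2"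
  proof (rule add_mono)
    show "sum d S * log 2 (N / e) \<le> e * log 2 (N / e)"
      using assms N by (intro mult_right_mono) auto
    have "real (card S) * (e / N) \<le> N * (e / N)" using assms N by (intro mult_right_mono) auto
    then have "real (card S) * (e / N) - sum d S \<le> e"
      using N sum_nonneg[of S d] assms(2) by auto
    then show "(real (card S) * (e / N) - sum d S) / ln 2 \<le> e / ln 2"
      by (simp add: divide_right_mono)
  qed
  finally show ?thesis .
qed

lemma sum_marg_dist_le:
  assumes "finite \<Omega>"
  shows "(\<Sum>a\<in>X ` \<Omega>. \<bar>marg \<Omega> \<mu> X a - marg \<Omega> \<nu> X a\<bar>) \<le> (\<Sum>w\<in>\<Omega>. \<bar>\<mu> w - \<nu> w\<bar>)"
proof -
  have "\<bar>marg \<Omega> \<mu> X a - marg \<Omega> \<nu> X a\<bar> \<le> (\<Sum>w\<in>{w\<in>\<Omega>. X w = a}. \<bar>\<mu> w - \<nu> w\<bar>)" for a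
    unfolding marg_def sum_subtractf[symmetric] by (rule sum_abs)
  then have "(\<Sum>a\<in>X ` \<Omega>. \<bar>marg \<Omega> \<mu> X a - marg \<Omega> \<nu> X a\<bar>)
      \<le> (\<Sum>a\<in>X ` \<Omega>. \<Sum>w\<in>{w\<in>\<Omega>. X w = a}. \<bar>\<mu> w - \<nu> w\<bar>)"
    by (rule sum_mono)
  also have "\<dots> = (\<Sum>w\<in>\<Omega>. \<bar>\<mu> w - \<nu> w\<bar>)"
    by (rule sum.image_gen[symmetric]) fact
  finally show ?thesis .
qed

text \<open>A continuity bound of Fannes type. N bounds the sample space and not the range of
  \<open>X\<close>, so one estimate serves all variables; for blocks N is a power with exponent n,
  and the loss grows only linearly in n.\<close>

lemma ent_dist_le:
  assumes "finite_mass \<Omega> \<mu>" "finite_mass \<Omega> \<nu>" "sum \<mu> \<Omega> = 1" "sum \<nu> \<Omega> = 1"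
    and "(\<Sum>w\<in>\<Omega>. \<bar>\<mu> w - \<nu> w\<bar>) \<le> e" "0 < e" "e \<le> N" "real (card \<Omega>) \<le> N"
  shows "\<bar>ent \<Omega> \<mu> X - ent \<Omega> \<nu> X\<bar> \<le> e * log 2 (N / e) + 2 * e / ln 2"
proof -
  interpret M: finite_mass \<Omega> \<mu> by fact
  interpret N: finite_mass \<Omega> \<nu> by fact
  let ?d = "\<lambda>a. \<bar>marg \<Omega> \<mu> X a - marg \<Omega> \<nu> X a\<bar>"
  have d: "(\<Sum>a\<in>X ` \<Omega>. ?d a) \<le> e"
    using sum_marg_dist_le[OF M.fin, where X=X and \<mu>=\<mu> and \<nu>=\<nu>] assms by linarith
  have m1: "marg \<Omega> \<mu> X a \<le> 1" for a
    unfolding assms(3)[symmetric] marg_def by (rule sum_mono2) (use M.fin M.nonneg in auto)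
  have n1: "marg \<Omega> \<nu> X a \<le> 1" for a
    unfolding assms(4)[symmetric] marg_def by (rule sum_mono2) (use M.fin N.nonneg in auto)
  have "\<bar>ent \<Omega> \<mu> X - ent \<Omega> \<nu> X\<bar> \<le> (\<Sum>a\<in>X ` \<Omega>. \<bar>eta (marg \<Omega> \<mu> X a) - eta (marg \<Omega> \<nu> X a)\<bar>)"
    unfolding M.ent_eq_sum_eta N.ent_eq_sum_eta sum_subtractf[symmetric] by (rule sum_abs)
  also have "\<dots> \<le> (\<Sum>a\<in>X ` \<Omega>. eta (?d a) + ?d a / ln 2)"
    by (intro sum_mono eta_dist M.marg_nonneg N.marg_nonneg m1 n1)
  also have "\<dots> = (\<Sum>a\<in>X ` \<Omega>. eta (?d a)) + (\<Sum>a\<in>X ` \<Omega>. ?d a) / ln 2"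
    by (simp add: sum.distrib sum_divide_distrib)
  also have "\<dots> \<le> (e * log 2 (N / e) + e / ln 2) + e / ln 2"
  proof (rule add_mono)
    have "real (card (X ` \<Omega>)) \<le> N"
      using card_image_le[OF M.fin, of X] assms(8) by linarith
    then show "(\<Sum>a\<in>X ` \<Omega>. eta (?d a)) \<le> e * log 2 (N / e) + e / ln 2"
      using M.fin d assms by (intro sum_eta_le) auto
    show "(\<Sum>a\<in>X ` \<Omega>. ?d a) / ln 2 \<le> e / ln 2" using d by (simp add: divide_right_mono)
  qed
  finally show ?thesis by simp
qed

lemma continuous_on_eta: "continuous_on {0..} eta"
proof -
  have right: "(eta \<longlongrightarrow> 0) (at_right 0)"
    unfolding eta_def log_def by real_asymp
  have "continuous (at x within {0..}) eta" if "0 \<le> x" for x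
  proof (cases "x = 0")
    case True
    then show ?thesis using right
      by (simp add: continuous_within at_within_Ici_at_right) (simp add: eta_def)
  next
    case False
    then have "isCont eta x" unfolding eta_def log_def by (intro continuous_intros) auto
    then show ?thesis by (rule continuous_at_imp_continuous_at_within)
  qed
  then show ?thesis by (simp add: continuous_on_eq_continuous_within)
qed

section \<open>Product distributions on lists\<close>

lemma pmf_replicate_pmf:
  "pmf (replicate_pmf n p) xs = (if length xs = n then prod_list (map (pmf p) xs) else 0)"
proof (induction n arbitrary: xs)
  case 0 then show ?case by (auto simp: indicator_def)
next
  case (Suc n)
  have eq: "replicate_pmf (Suc n) p = map_pmf (\<lambda>(x, xs). x # xs) (pair_pmf p (replicate_pmf n p))"
    by (simp add: map_pmf_def pair_pmf_def bind_assoc_pmf bind_return_pmf)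
  show ?case
  proof (cases xs)
    case Nil
    have "[] \<notin> set_pmf (replicate_pmf (Suc n) p)" by (subst set_replicate_pmf) simp
    then show ?thesis using Nil by (simp add: set_pmf_iff del: replicate_pmf.simps)
  next
    case (Cons y ys)
    have "inj (\<lambda>(x, xs). x # xs :: 'a list)" by (auto simp: inj_on_def)
    then have "pmf (replicate_pmf (Suc n) p) ((\<lambda>(x, xs). x # xs) (y, ys)) = pmf (pair_pmf p (replicate_pmf n p)) (y, ys)"
      unfolding eq by (rule pmf_map_inj')
    then show ?thesis using Cons Suc by (simp add: pmf_pair)
  qed
qed

lemma map_replicate_pmf: "map_pmf (map f) (replicate_pmf n p) = replicate_pmf n (map_pmf f p)"
proof (induction n)
  case (Suc n)
  have "replicate_pmf (Suc n) (map_pmf f p)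
      = map_pmf f p \<bind> (\<lambda>x. map_pmf (map f) (replicate_pmf n p) \<bind> (\<lambda>xs. return_pmf (x # xs)))"
    by (simp add: Suc)
  then show ?case by (simp add: map_pmf_def bind_assoc_pmf bind_return_pmf)
qed simp

lemma pmf_map_finite:
  fixes X :: "'w \<Rightarrow> 'a"
  assumes "finite \<Omega>" "set_pmf p \<subseteq> \<Omega>"
  shows "pmf (map_pmf X p) a = marg \<Omega> (pmf p) X a"
proof -
  have "pmf (map_pmf X p) a = measure p (X -` {a} \<inter> \<Omega>)"
    unfolding pmf_map using assms by (intro measure_prob_cong_0) (auto simp: set_pmf_iff subset_iff)
  also have "\<dots> = sum (pmf p) (X -` {a} \<inter> \<Omega>)"
    by (rule measure_measure_pmf_finite) (use assms in auto)
  finally show ?thesis by (simp add: marg_def vimage_def Int_def conj_commute)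
qed

lemma finite_lists_length [simp]: "finite {t :: 'a::finite list. length t = n}"
  using finite_lists_length_eq[of "UNIV :: 'a set" n] by simp

lemma card_lists_length: "card {t :: 'a::finite list. length t = n} = CARD('a) ^ n"
  using card_lists_length_eq[of "UNIV :: 'a set" n] by simp

lemma marg_replicate:
  fixes q :: "'z::finite pmf"
  assumes "length b = n"
  shows "marg {t. length t = n} (pmf (replicate_pmf n q)) (map f) b = prod_list (map (marg UNIV (pmf q) f) b)"
proof -
  have "marg {t. length t = n} (pmf (replicate_pmf n q)) (map f) b = pmf (map_pmf (map f) (replicate_pmf n q)) b"
    by (rule pmf_map_finite[symmetric]) (auto simp: set_replicate_pmf)
  also have "\<dots> = pmf (replicate_pmf n (map_pmf f q)) b" by (simp add: map_replicate_pmf)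
  also have "\<dots> = prod_list (map (pmf (map_pmf f q)) b)" using assms by (simp add: pmf_replicate_pmf)
  also have "pmf (map_pmf f q) = marg UNIV (pmf q) f"
    by (rule ext, rule pmf_map_finite) auto
  finally show ?thesis .
qed

lemma finite_mass_pmf: "finite \<Omega> \<Longrightarrow> finite_mass \<Omega> (pmf p)"
  by unfold_locales auto

lemma sum_replicate_pmf: "(\<Sum>t | length t = n. pmf (replicate_pmf n (q :: 'z::finite pmf)) t) = 1"
  by (rule sum_pmf_eq_1) (auto simp: set_replicate_pmf)

text \<open>On the support the block marginal is a product of positive numbers, so its logarithm is
  a sum over the letters and additivity of the expectation finishes. Off the support the weight of
  the term is zero.\<close>

lemma ent_replicate:
  fixes q :: "'z::finite pmf"
  shows "ent {t. length t = n} (pmf (replicate_pmf n q)) (map f) = real n * ent UNIV (pmf q) f"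
proof -
  interpret M: finite_mass UNIV "pmf q" by (rule finite_mass_pmf) simp
  let ?L = "\<lambda>z. log 2 (marg UNIV (pmf q) f (f z))"
  have mp: "0 < marg UNIV (pmf q) f (f z)" if "z \<in> set_pmf q" for z
    using M.marg_pos[of z f] that by (simp add: pmf_positive)
  have lg: "log 2 (marg {t. length t = n} (pmf (replicate_pmf n q)) (map f) (map f t)) = sum_list (map ?L t)"
    if "t \<in> set_pmf (replicate_pmf n q)" for t
  proof -
    have "log 2 (prod_list (map (marg UNIV (pmf q) f) (map f t))) = sum_list (map ?L t)"
      if "set t \<subseteq> set_pmf q" for t using that
    proof (induction t)
      case (Cons z t)
      have "0 < prod_list (map (marg UNIV (pmf q) f) (map f t))"
        using Cons.prems mp by (induction t) auto
      then show ?case using Cons mp[of z] by (simp add: log_mult)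
    qed simp
    moreover have "set t \<subseteq> set_pmf q" "length t = n" using that by (auto simp: set_replicate_pmf)
    ultimately show ?thesis by (simp add: marg_replicate)
  qed
  have E: "measure_pmf.expectation (replicate_pmf n q) (\<lambda>t. sum_list (map ?L t))
      = real n * measure_pmf.expectation q ?L"
  proof (induction n)
    case (Suc n)
    have fin: "finite (set_pmf (replicate_pmf n q))"
      by (rule finite_subset[of _ "{t. length t = n}"]) (auto simp: set_replicate_pmf)
    have "measure_pmf.expectation (replicate_pmf (Suc n) q) (\<lambda>t. sum_list (map ?L t))
      = measure_pmf.expectation (pair_pmf q (replicate_pmf n q)) (\<lambda>(z, t). ?L z + sum_list (map ?L t))"
    proof -
      have "replicate_pmf (Suc n) q = map_pmf (\<lambda>(x, xs). x # xs) (pair_pmf q (replicate_pmf n q))"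
        by (simp add: map_pmf_def pair_pmf_def bind_assoc_pmf bind_return_pmf)
      then show ?thesis by (simp add: case_prod_unfold)
    qed
    also have "\<dots> = measure_pmf.expectation (pair_pmf q (replicate_pmf n q)) (\<lambda>w. ?L (fst w))
       + measure_pmf.expectation (pair_pmf q (replicate_pmf n q)) (\<lambda>w. sum_list (map ?L (snd w)))"
      unfolding case_prod_unfold
      by (rule Bochner_Integration.integral_add) (auto intro!: integrable_measure_pmf_finite simp: fin)
    also have "\<dots> = measure_pmf.expectation (map_pmf fst (pair_pmf q (replicate_pmf n q))) ?L
       + measure_pmf.expectation (map_pmf snd (pair_pmf q (replicate_pmf n q))) (\<lambda>t. sum_list (map ?L t))"
      by simp
    also have "\<dots> = real (Suc n) * measure_pmf.expectation q ?L"
      unfolding map_fst_pair_pmf map_snd_pair_pmf Suc by (simp add: algebra_simps)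
    finally show ?case .
  qed simp
  have "- ent {t. length t = n} (pmf (replicate_pmf n q)) (map f)
    = (\<Sum>t | length t = n. sum_list (map ?L t) * pmf (replicate_pmf n q) t)"
    unfolding ent_def by (simp, rule sum.cong) (use lg in \<open>auto simp: set_pmf_iff\<close>)
  also have "\<dots> = measure_pmf.expectation (replicate_pmf n q) (\<lambda>t. sum_list (map ?L t))"
    by (rule integral_measure_pmf_real[symmetric]) (auto simp: set_replicate_pmf)
  also have "\<dots> = real n * (\<Sum>z\<in>UNIV. ?L z * pmf q z)"
    unfolding E by (subst integral_measure_pmf_real[of UNIV]) auto
  finally show ?thesis by (simp add: ent_def mult.commute)
qed

section \<open>Cardinality of the auxiliary variable\<close>

text \<open>Stated for an indexed family because \<open>dependent\<close> speaks of sets and would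
  lose repeated columns; two equal columns give the relation with coefficients 1 and - 1.\<close>

lemma linear_dependence_family:
  fixes f :: "'i \<Rightarrow> 'e::euclidean_space"
  assumes "finite A" "DIM('e) < card A"
  obtains d where "\<exists>i\<in>A. d i \<noteq> 0" "(\<Sum>i\<in>A. d i *\<^sub>R f i) = 0"
proof (cases "inj_on f A")
  case True
  then have "dependent (f ` A)" using assms by (intro dependent_biggerset) (simp_all add: card_image)
  then obtain u where u: "\<exists>v\<in>f ` A. u v \<noteq> 0" "(\<Sum>v\<in>f ` A. u v *\<^sub>R v) = 0"
    using assms(1) by (auto simp: dependent_finite)
  have "(\<Sum>i\<in>A. u (f i) *\<^sub>R f i) = 0" using u(2) by (simp add: sum.reindex[OF True])
  then show ?thesis using u(1) that[of "\<lambda>i. u (f i)"] by auto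
next
  case False
  then obtain i j where ij: "i \<in> A" "j \<in> A" "i \<noteq> j" "f i = f j" by (auto simp: inj_on_def)
  let ?d = "\<lambda>k. if k = i then 1 else if k = j then - 1 else (0 :: real)"
  have "(\<Sum>k\<in>A. ?d k *\<^sub>R f k) = (\<Sum>k\<in>{i, j}. ?d k *\<^sub>R f k)"
    by (rule sum.mono_neutral_right) (use ij assms in auto)
  also have "\<dots> = 0" using ij by simp
  finally have "(\<Sum>k\<in>A. ?d k *\<^sub>R f k) = 0" .
  moreover have "\<exists>k\<in>A. ?d k \<noteq> 0" using ij by (intro bexI[of _ i]) auto
  ultimately show ?thesis by (intro that[of ?d])
qed

text \<open>Because of the positive functional \<open>\<phi>\<close>, every linear relation between the columns \<open>f i\<close> has a
  negative coefficient, so moving along it in a direction of non-decreasing objective \<open>c\<close> must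
  annihilate some weight.\<close>

lemma basic_solution:
  fixes f :: "'i \<Rightarrow> 'e::euclidean_space" and \<phi> :: "'e \<Rightarrow> real"
  assumes A: "finite A" and \<phi>: "linear \<phi>" "\<And>i. i \<in> A \<Longrightarrow> 0 < \<phi> (f i)"
  shows "(\<And>i. i \<in> A \<Longrightarrow> 0 \<le> w i) \<Longrightarrow>
    \<exists>w'. (\<forall>i\<in>A. 0 \<le> w' i) \<and> card {i\<in>A. w' i \<noteq> 0} \<le> DIM('e) \<and>
      (\<Sum>i\<in>A. w' i *\<^sub>R f i) = (\<Sum>i\<in>A. w i *\<^sub>R f i) \<and> (\<Sum>i\<in>A. w i * c i) \<le> (\<Sum>i\<in>A. w' i * (c i :: real))"
proof (induction "card {i\<in>A. w i \<noteq> 0}" arbitrary: w rule: less_induct)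
  case less
  let ?S = "{i\<in>A. w i \<noteq> 0}"
  have fS: "finite ?S" using A by simp
  show ?case
  proof (cases "card ?S \<le> DIM('e)")
    case True
    then show ?thesis using less.prems by (intro exI[of _ w]) auto
  next
    case False
    then have "DIM('e) < card ?S" by simp
    then obtain d0 where d0: "\<exists>i\<in>?S. d0 i \<noteq> 0" "(\<Sum>i\<in>?S. d0 i *\<^sub>R f i) = 0"
      by (rule linear_dependence_family[OF fS, of f])
    define \<sigma> :: real where "\<sigma> = (if 0 \<le> (\<Sum>i\<in>?S. d0 i * c i) then 1 else - 1)"
    define d where "d i = (if i \<in> ?S then \<sigma> * d0 i else 0)" for i
    have \<sigma>: "\<sigma> \<noteq> 0" by (simp add: \<sigma>_def)
    have sumd: "(\<Sum>i\<in>A. d i *\<^sub>R f i) = 0"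
    proof -
      have "(\<Sum>i\<in>A. d i *\<^sub>R f i) = (\<Sum>i\<in>?S. \<sigma> *\<^sub>R (d0 i *\<^sub>R f i))"
        by (rule sum.mono_neutral_cong_right) (use A in \<open>auto simp: d_def\<close>)
      then show ?thesis using d0(2) by (simp add: scaleR_right.sum[symmetric] del: scaleR_scaleR)
    qed
    have sumc: "0 \<le> (\<Sum>i\<in>A. d i * c i)"
    proof -
      have "(\<Sum>i\<in>A. d i * c i) = (\<Sum>i\<in>?S. \<sigma> * (d0 i * c i))"
        by (rule sum.mono_neutral_cong_right) (use A in \<open>auto simp: d_def\<close>)
      also have "\<dots> = \<sigma> * (\<Sum>i\<in>?S. d0 i * c i)" by (simp add: sum_distrib_left)
      finally show ?thesis by (simp add: \<sigma>_def)
    qed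
    obtain i0 where i0: "i0 \<in> ?S" "d i0 \<noteq> 0" using d0(1) \<sigma> by (auto simp: d_def)
    have "\<exists>i\<in>A. d i < 0"
    proof (rule ccontr)
      assume "\<not> ?thesis"
      then have nn: "\<And>i. i \<in> A \<Longrightarrow> 0 \<le> d i" by (auto simp: not_less)
      have "0 = \<phi> (\<Sum>i\<in>A. d i *\<^sub>R f i)" using \<phi>(1) by (simp add: sumd linear_0)
      also have "\<dots> = (\<Sum>i\<in>A. d i * \<phi> (f i))" using \<phi>(1) by (simp add: linear_sum linear_cmul)
      also have "\<dots> > 0"
        by (rule sum_pos2[of _ i0]) (use A i0 nn \<phi>(2) in \<open>auto simp: less_le\<close>)
      finally show False by simp
    qed
    then have Nne: "{i\<in>A. d i < 0} \<noteq> {}" by auto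
    define t where "t = Min ((\<lambda>i. w i / - d i) ` {i\<in>A. d i < 0})"
    have "t \<in> (\<lambda>i. w i / - d i) ` {i\<in>A. d i < 0}"
      unfolding t_def by (rule Min_in) (use A Nne in auto)
    then obtain i1 where i1: "i1 \<in> A" "d i1 < 0" "t = w i1 / - d i1" by blast
    have tle: "t \<le> w i / - d i" if "i \<in> A" "d i < 0" for i
      unfolding t_def by (rule Min_le) (use A that in auto)
    have t0: "0 \<le> t" using i1 less.prems[of i1] by (simp add: divide_nonneg_neg)
    define w1 where "w1 i = w i + t * d i" for i
    have w1nn: "0 \<le> w1 i" if i: "i \<in> A" for i
    proof (cases "d i < 0")
      case True
      then have "t * - d i \<le> w i" using tle[OF i True] by (simp add: field_simps)
      then show ?thesis by (simp add: w1_def)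
    next
      case False
      then show ?thesis using t0 less.prems[OF i] by (simp add: w1_def)
    qed
    have i1z: "w1 i1 = 0" using i1 by (simp add: w1_def)
    have i1S: "i1 \<in> ?S" using i1 by (auto simp: d_def split: if_splits)
    have "{i\<in>A. w1 i \<noteq> 0} \<subset> ?S"
      using i1z i1S by (auto simp: w1_def d_def)
    then have "card {i\<in>A. w1 i \<noteq> 0} < card ?S" using fS by (rule psubset_card_mono[rotated])
    from less.hyps[OF this w1nn] obtain w' where w': "\<forall>i\<in>A. 0 \<le> w' i"
      "card {i\<in>A. w' i \<noteq> 0} \<le> DIM('e)" "(\<Sum>i\<in>A. w' i *\<^sub>R f i) = (\<Sum>i\<in>A. w1 i *\<^sub>R f i)"
      "(\<Sum>i\<in>A. w1 i * c i) \<le> (\<Sum>i\<in>A. w' i * c i)" by blast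
    have "(\<Sum>i\<in>A. w1 i *\<^sub>R f i) = (\<Sum>i\<in>A. w i *\<^sub>R f i) + t *\<^sub>R (\<Sum>i\<in>A. d i *\<^sub>R f i)"
      by (simp add: w1_def scaleR_add_left sum.distrib scaleR_right.sum)
    moreover have "(\<Sum>i\<in>A. w1 i * c i) = (\<Sum>i\<in>A. w i * c i) + t * (\<Sum>i\<in>A. d i * c i)"
      by (simp add: w1_def distrib_right sum.distrib sum_distrib_left mult.assoc)
    moreover have "0 \<le> t * (\<Sum>i\<in>A. d i * c i)" using t0 sumc by simp
    ultimately show ?thesis using w' sumd by (intro exI[of _ w']) auto
  qed
qed

section \<open>Slices of an auxiliary variable and the linear program\<close>

type_synonym ('a, 'b, 'c, 'd) quad = "'a \<times> 'b \<times> 'c \<times> 'd"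

abbreviation X1 :: "('x1, 'x2, 'y1, 'y2) quad \<Rightarrow> 'x1" where "X1 \<equiv> \<lambda>(x1, x2, y1, y2). x1"
abbreviation X2 :: "('x1, 'x2, 'y1, 'y2) quad \<Rightarrow> 'x2" where "X2 \<equiv> \<lambda>(x1, x2, y1, y2). x2"
abbreviation XX :: "('x1, 'x2, 'y1, 'y2) quad \<Rightarrow> 'x1 \<times> 'x2" where "XX \<equiv> \<lambda>(x1, x2, y1, y2). (x1, x2)"

abbreviation Y1 :: "('x1, 'x2, 'y1, 'y2) quad \<Rightarrow> 'y1" where "Y1 \<equiv> \<lambda>(x1, x2, y1, y2). y1"
abbreviation Y2 :: "('x1, 'x2, 'y1, 'y2) quad \<Rightarrow> 'y2" where "Y2 \<equiv> \<lambda>(x1, x2, y1, y2). y2"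
abbreviation Y1X :: "('x1, 'x2, 'y1, 'y2) quad \<Rightarrow> 'y1 \<times> 'x1 \<times> 'x2" where "Y1X \<equiv> \<lambda>(x1, x2, y1, y2). (y1, x1, x2)"
abbreviation Y2X :: "('x1, 'x2, 'y1, 'y2) quad \<Rightarrow> 'y2 \<times> 'x1 \<times> 'x2" where "Y2X \<equiv> \<lambda>(x1, x2, y1, y2). (y2, x1, x2)"

text \<open>Summed over the slices of U, this and the next two give I(X1;X2|U), H(X1|X2 U) and
  H(X2|X1 U); \<open>out_mi\<close> at \<open>pmf q\<close> is I(Y1;Y2|X1 X2). Each bracket here is
  a difference of two entropies, the shape that \<open>ent_diff_scale\<close> needs; the constant
  variable stands for H(U).\<close>

definition slice_mi :: "(('x1::finite, 'x2::finite, 'y1::finite, 'y2::finite) quad \<Rightarrow> real) \<Rightarrow> real" where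
  "slice_mi v = (ent UNIV v X1 - ent UNIV v XX) + (ent UNIV v X2 - ent UNIV v (\<lambda>_. ()))"
definition slice_h1 :: "(('x1::finite, 'x2::finite, 'y1::finite, 'y2::finite) quad \<Rightarrow> real) \<Rightarrow> real" where
  "slice_h1 v = ent UNIV v XX - ent UNIV v X2"
definition slice_h2 :: "(('x1::finite, 'x2::finite, 'y1::finite, 'y2::finite) quad \<Rightarrow> real) \<Rightarrow> real" where
  "slice_h2 v = ent UNIV v XX - ent UNIV v X1"
definition out_mi :: "(('x1::finite, 'x2::finite, 'y1::finite, 'y2::finite) quad \<Rightarrow> real) \<Rightarrow> real" where
  "out_mi v = ent UNIV v Y1X + ent UNIV v Y2X
     - ent UNIV v (\<lambda>z. z) - ent UNIV v XX"

text \<open>Both Markov chains of \<open>T3\<close> inside one slice, cleared of denominators. The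
  equations are polynomial, hence closed, and both sides have degree two, hence they survive scaling
  of the slice.\<close>

definition slice_markov :: "(('x1::finite, 'x2::finite, 'y1::finite, 'y2::finite) quad \<Rightarrow> real) \<Rightarrow> bool" where
  "slice_markov v \<longleftrightarrow> (\<forall>x1 x2 y1 y2.
     v (x1, x2, y1, y2) * marg UNIV v X1 x1 =
       marg UNIV v (\<lambda>(x1, x2, y1, y2). (y1, x1)) (y1, x1) *
       marg UNIV v (\<lambda>(x1, x2, y1, y2). (x1, x2, y2)) (x1, x2, y2) \<and>
     v (x1, x2, y1, y2) * marg UNIV v X2 x2 =
       marg UNIV v (\<lambda>(x1, x2, y1, y2). (y2, x2)) (y2, x2) *
       marg UNIV v (\<lambda>(x1, x2, y1, y2). (x2, x1, y1)) (x2, x1, y1))"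

lemma slice_markov_scale:
  assumes "slice_markov v" shows "slice_markov (\<lambda>z. c * v z)"
proof -
  have sq: "(c * a) * (c * b) = (c * c) * (a * b)" for a b :: real by simp
  show ?thesis
    using assms unfolding slice_markov_def marg_scale sq by simp
qed

lemma finite_mass_UNIV: "(\<And>z. 0 \<le> v z) \<Longrightarrow> finite_mass (UNIV :: 'z::finite set) v"
  by unfold_locales auto

lemma slice_scale:
  fixes v :: "('x1::finite, 'x2::finite, 'y1::finite, 'y2::finite) quad \<Rightarrow> real"
  assumes "0 \<le> c" "\<And>z. 0 \<le> v z"
  shows "slice_mi (\<lambda>z. c * v z) = c * slice_mi v" "slice_h1 (\<lambda>z. c * v z) = c * slice_h1 v"
    "slice_h2 (\<lambda>z. c * v z) = c * slice_h2 v"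
proof -
  note scale = ent_diff_scale[OF assms(1) finite_mass_UNIV[of v, OF assms(2)]]
  show "slice_mi (\<lambda>z. c * v z) = c * slice_mi v"
    unfolding slice_mi_def by (simp only: scale distrib_left)
  show "slice_h1 (\<lambda>z. c * v z) = c * slice_h1 v"
    unfolding slice_h1_def by (rule scale)
  show "slice_h2 (\<lambda>z. c * v z) = c * slice_h2 v"
    unfolding slice_h2_def by (rule scale)
qed

lemma slice_zero:
  "slice_mi (\<lambda>_. 0) = 0" "slice_h1 (\<lambda>_. 0) = 0" "slice_h2 (\<lambda>_. 0) = 0" "slice_markov (\<lambda>_. 0)"
proof -
  have "ent UNIV (\<lambda>_. 0) X = 0" for X :: "('x1::finite, 'x2::finite, 'y1::finite, 'y2::finite) quad \<Rightarrow> 'a"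
    by (simp add: ent_def)
  then show "slice_mi (\<lambda>_. 0) = 0" "slice_h1 (\<lambda>_. 0) = 0" "slice_h2 (\<lambda>_. 0) = 0"
    unfolding slice_mi_def slice_h1_def slice_h2_def by (simp_all add: ent_def)
  have "marg UNIV (\<lambda>_. 0) X a = 0" for X :: "('x1::finite, 'x2::finite, 'y1::finite, 'y2::finite) quad \<Rightarrow> 'a" and a
    by (simp add: marg_def)
  then show "slice_markov (\<lambda>_. 0)" unfolding slice_markov_def by (simp add: marg_def)
qed

text \<open>The linear program reweights the given slices, starting from all weights 1. A column
  consists of the masses of a slice and its \<open>slice_mi\<close>, so a basic solution uses at
  most one slice more than there are quadruples, which is the size of the option type. The objective
  is a sum of conditional entropies and is maximised, since each rate is a constant minus such an
  entropy.\<close>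

lemma cardinality_reduction:
  fixes v :: "'i \<Rightarrow> ('x1::finite, 'x2::finite, 'y1::finite, 'y2::finite) quad \<Rightarrow> real"
  assumes A: "finite A" and nn: "\<And>i z. i \<in> A \<Longrightarrow> 0 \<le> v i z" and mk: "\<And>i. i \<in> A \<Longrightarrow> slice_markov (v i)"
  obtains g :: "('x1, 'x2, 'y1, 'y2) quad option \<Rightarrow> ('x1, 'x2, 'y1, 'y2) quad \<Rightarrow> real"
  where "\<forall>u z. 0 \<le> g u z" "\<forall>u. slice_markov (g u)"
    "\<forall>z. (\<Sum>u\<in>UNIV. g u z) = (\<Sum>i\<in>A. v i z)"
    "(\<Sum>u\<in>UNIV. slice_mi (g u)) = (\<Sum>i\<in>A. slice_mi (v i))"
    "(\<Sum>i\<in>A. l1 * slice_h1 (v i) + l2 * slice_h2 (v i)) \<le> (\<Sum>u\<in>UNIV. l1 * slice_h1 (g u) + l2 * slice_h2 (g u))"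
proof -
  \<comment> \<open>\<open>basic_solution\<close> needs a functional that is positive on every
    column; total mass is one as soon as the empty slices are removed.\<close>
  define B where "B = {i\<in>A. 0 < (\<Sum>z\<in>UNIV. v i z)}"
  have B: "finite B" "B \<subseteq> A" using A by (auto simp: B_def)
  have zero: "v i = (\<lambda>_. 0)" if "i \<in> A - B" for i
  proof -
    have "(\<Sum>z\<in>UNIV. v i z) = 0"
      using that nn[of i] sum_nonneg[of UNIV "v i"] by (auto simp: B_def not_less intro: antisym)
    then show ?thesis using nn[of i] that by (auto simp: sum_nonneg_eq_0_iff)
  qed
  let ?f = "\<lambda>i. (vec_lambda (v i), slice_mi (v i)) :: (real ^ ('x1, 'x2, 'y1, 'y2) quad) \<times> real"
  let ?\<phi> = "\<lambda>x :: (real ^ ('x1, 'x2, 'y1, 'y2) quad) \<times> real. \<Sum>z\<in>UNIV. fst x $ z"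
  let ?c = "\<lambda>i. l1 * slice_h1 (v i) + l2 * slice_h2 (v i)"
  have lin: "linear ?\<phi>"
    by (rule linearI) (simp_all add: sum.distrib sum_distrib_left)
  obtain w where w: "\<forall>i\<in>B. 0 \<le> w i" "card {i\<in>B. w i \<noteq> 0} \<le> DIM((real ^ ('x1, 'x2, 'y1, 'y2) quad) \<times> real)"
    "(\<Sum>i\<in>B. w i *\<^sub>R ?f i) = (\<Sum>i\<in>B. 1 *\<^sub>R ?f i)" "(\<Sum>i\<in>B. 1 * ?c i) \<le> (\<Sum>i\<in>B. w i * ?c i)"
    using basic_solution[OF B(1) lin, of ?f "\<lambda>_. 1" ?c] by (auto simp: B_def)
  define S where "S = {i\<in>B. w i \<noteq> 0}"
  have S: "finite S" "S \<subseteq> B" using B by (auto simp: S_def)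
  have "card S \<le> card (UNIV :: ('x1, 'x2, 'y1, 'y2) quad option set)"
    using w(2) by (simp add: S_def card_UNIV_option)
  then obtain e :: "'i \<Rightarrow> ('x1, 'x2, 'y1, 'y2) quad option" where e: "inj_on e S"
    using card_le_inj[OF S(1) finite, of "UNIV :: ('x1, 'x2, 'y1, 'y2) quad option set"] by blast
  define g where "g u = (if u \<in> e ` S then (\<lambda>z. w (the_inv_into S e u) * v (the_inv_into S e u) z) else (\<lambda>_. 0))" for u
  have ge: "g (e i) = (\<lambda>z. w i * v i z)" if "i \<in> S" for i
    using that e by (simp add: g_def the_inv_into_f_f)
  have wnn: "0 \<le> w i" if "i \<in> S" for i using that w(1) S by auto
  have g_cases: "(\<exists>i\<in>S. g u = (\<lambda>z. w i * v i z)) \<or> g u = (\<lambda>_. 0)" for u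
    using ge by (cases "u \<in> e ` S") (auto simp: g_def)
  have transfer: "(\<Sum>u\<in>UNIV. F (g u)) = (\<Sum>i\<in>B. w i * F (v i))"
    if F: "F (\<lambda>_. 0) = 0" "\<And>i. i \<in> S \<Longrightarrow> F (\<lambda>z. w i * v i z) = w i * F (v i)" for F :: "_ \<Rightarrow> real"
  proof -
    have "(\<Sum>u\<in>UNIV. F (g u)) = (\<Sum>u\<in>e ` S. F (g u))"
      by (rule sum.mono_neutral_right) (auto simp: g_def F)
    also have "\<dots> = (\<Sum>i\<in>S. F (g (e i)))" by (simp add: sum.reindex[OF e])
    also have "\<dots> = (\<Sum>i\<in>S. w i * F (v i))" by (rule sum.cong) (simp_all add: ge F)
    also have "\<dots> = (\<Sum>i\<in>B. w i * F (v i))"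
      by (rule sum.mono_neutral_left) (use B in \<open>auto simp: S_def\<close>)
    finally show ?thesis .
  qed
  have AB: "(\<Sum>i\<in>B. F (v i)) = (\<Sum>i\<in>A. F (v i))" if "F (\<lambda>_. 0) = 0" for F :: "_ \<Rightarrow> real"
    by (rule sum.mono_neutral_left) (use A B zero that in auto)
  have comp: "(\<Sum>i\<in>B. w i * v i z) = (\<Sum>i\<in>B. v i z)" "(\<Sum>i\<in>B. w i * slice_mi (v i)) = (\<Sum>i\<in>B. slice_mi (v i))" for z
  proof -
    have "fst (\<Sum>i\<in>B. w i *\<^sub>R ?f i) $ z = fst (\<Sum>i\<in>B. 1 *\<^sub>R ?f i) $ z" using w(3) by simp
    then show "(\<Sum>i\<in>B. w i * v i z) = (\<Sum>i\<in>B. v i z)" by (simp add: fst_sum sum_component)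
    have "snd (\<Sum>i\<in>B. w i *\<^sub>R ?f i) = snd (\<Sum>i\<in>B. 1 *\<^sub>R ?f i)" using w(3) by simp
    then show "(\<Sum>i\<in>B. w i * slice_mi (v i)) = (\<Sum>i\<in>B. slice_mi (v i))" by (simp add: snd_sum)
  qed
  have SA: "i \<in> A" if "i \<in> S" for i using that S B by auto
  have sc: "slice_mi (\<lambda>z. w i * v i z) = w i * slice_mi (v i)"
    "slice_h1 (\<lambda>z. w i * v i z) = w i * slice_h1 (v i)"
    "slice_h2 (\<lambda>z. w i * v i z) = w i * slice_h2 (v i)" if "i \<in> S" for i
    by (rule slice_scale; use that wnn nn SA in simp)+
  show ?thesis
  proof (rule that[of g]; (intro allI)?)
    fix u z
    show "0 \<le> g u z" using g_cases[of u]
    proof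
      assume "\<exists>i\<in>S. g u = (\<lambda>z. w i * v i z)"
      then obtain i where "i \<in> S" "g u = (\<lambda>z. w i * v i z)" by blast
      then show ?thesis using wnn[of i] nn[of i z] SA[of i] by simp
    qed simp
    show "slice_markov (g u)" using g_cases[of u]
    proof
      assume "\<exists>i\<in>S. g u = (\<lambda>z. w i * v i z)"
      then obtain i where "i \<in> S" "g u = (\<lambda>z. w i * v i z)" by blast
      then show ?thesis using slice_markov_scale mk[of i] SA[of i] by simp
    qed (simp add: slice_zero)
    show "(\<Sum>u\<in>UNIV. g u z) = (\<Sum>i\<in>A. v i z)"
      using transfer[of "\<lambda>k. k z"] comp(1)[of z] AB[of "\<lambda>k. k z"] by simp
  next
    show "(\<Sum>u\<in>UNIV. slice_mi (g u)) = (\<Sum>i\<in>A. slice_mi (v i))"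
      using transfer[of slice_mi, OF slice_zero(1) sc(1)] comp(2) AB[of slice_mi, OF slice_zero(1)] by simp
    have "(\<Sum>u\<in>UNIV. l1 * slice_h1 (g u) + l2 * slice_h2 (g u)) = (\<Sum>i\<in>B. w i * ?c i)"
      by (rule transfer[of "\<lambda>k. l1 * slice_h1 k + l2 * slice_h2 k"])
        (simp_all add: slice_zero sc algebra_simps)
    moreover have "(\<Sum>i\<in>B. ?c i) = (\<Sum>i\<in>A. ?c i)"
      using AB[of "\<lambda>k. l1 * slice_h1 k + l2 * slice_h2 k"] by (simp add: slice_zero)
    ultimately show "(\<Sum>i\<in>A. ?c i) \<le> (\<Sum>u\<in>UNIV. l1 * slice_h1 (g u) + l2 * slice_h2 (g u))"
      using w(4) by simp
  qed
qed

section \<open>Compactness and the convex hull\<close>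

lemma continuous_on_ent:
  fixes f :: "'a::topological_space \<Rightarrow> 'z::finite \<Rightarrow> real"
  assumes "\<And>z. continuous_on S (\<lambda>x. f x z)" "\<And>x z. x \<in> S \<Longrightarrow> 0 \<le> f x z"
  shows "continuous_on S (\<lambda>x. ent UNIV (f x) X)"
proof -
  \<comment> \<open>The passage to \<open>eta\<close> is what gives continuity at marginals equal to
    0, where the logarithm in \<open>ent\<close> has none.\<close>
  have "continuous_on S (\<lambda>x. \<Sum>a\<in>range X. eta (marg UNIV (f x) X a))"
  proof (intro continuous_on_sum continuous_on_compose2[OF continuous_on_eta])
    show "continuous_on S (\<lambda>x. marg UNIV (f x) X a)" for a
      unfolding marg_def by (intro continuous_on_sum assms)
    show "(\<lambda>x. marg UNIV (f x) X a) ` S \<subseteq> {0..}" for a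
      using assms(2) by (auto intro!: finite_mass.marg_nonneg finite_mass_UNIV)
  qed
  moreover have "ent UNIV (f x) X = (\<Sum>a\<in>range X. eta (marg UNIV (f x) X a))" if "x \<in> S" for x
    by (rule finite_mass.ent_eq_sum_eta[OF finite_mass_UNIV]) (rule assms(2)[OF that])
  ultimately show ?thesis by (subst continuous_on_cong[OF refl]) auto
qed

lemma closed_slice_markov:
  "closed {v :: real ^ ('x1::finite, 'x2::finite, 'y1::finite, 'y2::finite) quad. slice_markov (vec_nth v)}"
  unfolding slice_markov_def marg_def
  by (intro closed_Collect_all closed_Collect_conj closed_Collect_eq continuous_intros)

type_synonym ('a, 'b, 'c, 'd) slice_vec = "real ^ ('a, 'b, 'c, 'd) quad ^ ('a, 'b, 'c, 'd) quad option"

text \<open>The law of the quadruple is left free apart from total mass one, so that the systems of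
  all approximating codes lie in one compact set; it is forced to be \<open>q\<close> only in the
  limit. Vectors replace functions to have the Euclidean topology at hand.\<close>

definition slice_vecs :: "real \<Rightarrow> ('x1::finite, 'x2::finite, 'y1::finite, 'y2::finite) slice_vec set" where
  "slice_vecs c = {G. (\<forall>u z. 0 \<le> G $ u $ z) \<and> (\<Sum>z\<in>UNIV. \<Sum>u\<in>UNIV. G $ u $ z) = 1 \<and>
     (\<forall>u. slice_markov (vec_nth (G $ u))) \<and> (\<Sum>u\<in>UNIV. slice_mi (vec_nth (G $ u))) \<le> c}"

lemma compact_slice_vecs:
  fixes c :: real
  defines "S \<equiv> slice_vecs c :: ('x1::finite, 'x2::finite, 'y1::finite, 'y2::finite) slice_vec set"
  shows "compact S" "continuous_on S (\<lambda>G. slice_h1 (vec_nth (G $ u)))" "continuous_on S (\<lambda>G. slice_h2 (vec_nth (G $ u)))"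
proof -
  \<comment> \<open>The entropy constraint is left out at first: entropies are known to be
    continuous only on nonnegative vectors. Once D is closed, the last constraint is closed relative
    to D.\<close>
  define D where "D = {G :: ('x1, 'x2, 'y1, 'y2) slice_vec.
     (\<forall>u z. 0 \<le> G $ u $ z) \<and> (\<Sum>z\<in>UNIV. \<Sum>u\<in>UNIV. G $ u $ z) = 1 \<and> (\<forall>u. slice_markov (vec_nth (G $ u)))}"
  have closed_mk: "closed {G :: ('x1, 'x2, 'y1, 'y2) slice_vec.
       slice_markov (vec_nth (G $ u))}" for u
    using closed_vimage[OF closed_slice_markov, of "\<lambda>G. G $ u"] by (simp add: vimage_def continuous_intros)
  have "closed D" unfolding D_def
    by (intro closed_Collect_conj closed_Collect_all closed_Collect_le closed_Collect_eq closed_mk continuous_intros)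
  moreover have "bounded D"
  proof (rule boundedI)
    fix G assume G: "G \<in> D"
    have "norm G \<le> (\<Sum>u\<in>UNIV. norm (G $ u))"
      unfolding norm_vec_def by (rule L2_set_le_sum) simp
    also have "\<dots> \<le> (\<Sum>u\<in>UNIV. \<Sum>z\<in>UNIV. norm (G $ u $ z))"
      by (rule sum_mono) (use norm_le_l1_cart in auto)
    also have "\<dots> = (\<Sum>u\<in>UNIV. \<Sum>z\<in>UNIV. G $ u $ z)" using G by (simp add: D_def del: split_paired_All)
    also have "\<dots> = (\<Sum>z\<in>UNIV. \<Sum>u\<in>UNIV. G $ u $ z)" by (rule sum.swap)
    also have "\<dots> = 1" using G by (simp add: D_def)
    finally show "norm G \<le> 1" .
  qed
  ultimately have D: "compact D" by (simp add: compact_eq_bounded_closed)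
  have ent: "continuous_on D (\<lambda>G. ent UNIV (vec_nth (G $ u)) X)" for u X
    by (rule continuous_on_ent) (auto simp: D_def intro!: continuous_intros)
  have "S = {G\<in>D. (\<Sum>u\<in>UNIV. slice_mi (vec_nth (G $ u))) \<le> c}" by (auto simp: S_def D_def slice_vecs_def)
  moreover have "closed {G\<in>D. (\<Sum>u\<in>UNIV. slice_mi (vec_nth (G $ u))) \<le> c}"
    unfolding slice_mi_def
    by (rule continuous_on_closed_Collect_le) (intro continuous_intros ent compact_imp_closed D)+
  ultimately have SD: "S \<subseteq> D" "closed S" by auto
  then show "compact S" using D by (metis compact_Int_closed inf.absorb_iff2 inf_commute)
  show "continuous_on S (\<lambda>G. slice_h1 (vec_nth (G $ u)))" "continuous_on S (\<lambda>G. slice_h2 (vec_nth (G $ u)))"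
    unfolding slice_h1_def slice_h2_def
    by (rule continuous_on_subset[OF _ SD(1)]; intro continuous_intros ent)+
qed

definition slice_systems :: "('x1::finite, 'x2::finite, 'y1::finite, 'y2::finite) quad pmf
    \<Rightarrow> (('x1, 'x2, 'y1, 'y2) quad option \<Rightarrow> ('x1, 'x2, 'y1, 'y2) quad \<Rightarrow> real) set" where
  "slice_systems q = {g. (\<forall>u z. 0 \<le> g u z) \<and> (\<forall>u. slice_markov (g u)) \<and>
     (\<forall>z. (\<Sum>u\<in>UNIV. g u z) = pmf q z) \<and> (\<Sum>u\<in>UNIV. slice_mi (g u)) \<le> slice_mi (pmf q)}"

lemma slice_system_of_approximations:
  fixes q :: "('x1::finite, 'x2::finite, 'y1::finite, 'y2::finite) quad pmf"
  assumes approx: "\<And>e. 0 < e \<Longrightarrow> \<exists>g :: ('x1, 'x2, 'y1, 'y2) quad option \<Rightarrow> ('x1, 'x2, 'y1, 'y2) quad \<Rightarrow> real.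
      (\<forall>u z. 0 \<le> g u z) \<and> (\<forall>u. slice_markov (g u)) \<and> (\<Sum>z\<in>UNIV. \<Sum>u\<in>UNIV. g u z) = 1 \<and>
      (\<Sum>z\<in>UNIV. \<bar>(\<Sum>u\<in>UNIV. g u z) - pmf q z\<bar>) \<le> e \<and> (\<Sum>u\<in>UNIV. slice_mi (g u)) \<le> slice_mi (pmf q) \<and>
      L - (\<Sum>u\<in>UNIV. l1 * slice_h1 (g u) + l2 * slice_h2 (g u)) \<le> e"
  shows "\<exists>g\<in>slice_systems q. L \<le> (\<Sum>u\<in>UNIV. l1 * slice_h1 (g u) + l2 * slice_h2 (g u))"
proof -
  let ?S = "slice_vecs (slice_mi (pmf q)) :: ('x1, 'x2, 'y1, 'y2) slice_vec set"
  \<comment> \<open>Distance to \<open>q\<close> and shortfall of the objective are put into one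
    continuous function. Its minimum over the compact set is attained and lies below every positive
    e, so both defects vanish at the same system.\<close>
  let ?F = "\<lambda>G :: ('x1, 'x2, 'y1, 'y2) slice_vec.
     max (\<Sum>z\<in>UNIV. \<bar>(\<Sum>u\<in>UNIV. G $ u $ z) - pmf q z\<bar>)
         (L - (\<Sum>u\<in>UNIV. l1 * slice_h1 (vec_nth (G $ u)) + l2 * slice_h2 (vec_nth (G $ u))))"
  have ex: "\<exists>G\<in>?S. ?F G \<le> e" if e: "0 < e" for e
  proof -
    from approx[OF e] obtain g :: "('x1, 'x2, 'y1, 'y2) quad option \<Rightarrow> ('x1, 'x2, 'y1, 'y2) quad \<Rightarrow> real"
      where g: "\<forall>u z. 0 \<le> g u z" "\<forall>u. slice_markov (g u)" "(\<Sum>z\<in>UNIV. \<Sum>u\<in>UNIV. g u z) = 1"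
      "(\<Sum>z\<in>UNIV. \<bar>(\<Sum>u\<in>UNIV. g u z) - pmf q z\<bar>) \<le> e" "(\<Sum>u\<in>UNIV. slice_mi (g u)) \<le> slice_mi (pmf q)"
      "L - (\<Sum>u\<in>UNIV. l1 * slice_h1 (g u) + l2 * slice_h2 (g u)) \<le> e" by blast
    have "vec_nth (vec_lambda f) = f" for f :: "('x1, 'x2, 'y1, 'y2) quad \<Rightarrow> real" by (rule ext) simp
    then show ?thesis using g by (intro bexI[of _ "\<chi> u. \<chi> z. g u z"]) (auto simp: slice_vecs_def)
  qed
  have h: "continuous_on ?S (\<lambda>G. slice_h1 (vec_nth (G $ u)))" "continuous_on ?S (\<lambda>G. slice_h2 (vec_nth (G $ u)))" for u
    by (rule compact_slice_vecs)+
  have cont: "continuous_on ?S ?F" by (intro continuous_on_max continuous_intros h)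
  have ne: "?S \<noteq> {}" using ex[of 1] by auto
  have "\<exists>G\<in>?S. \<forall>G'\<in>?S. ?F G \<le> ?F G'"
    by (rule continuous_attains_inf[OF compact_slice_vecs(1) ne cont])
  then obtain G where G: "G \<in> ?S" "\<forall>G'\<in>?S. ?F G \<le> ?F G'" by (elim bexE)
  have "?F G \<le> 0"
  proof (rule field_le_epsilon)
    fix e :: real assume "0 < e"
    from ex[OF this] obtain G' where "G' \<in> ?S" "?F G' \<le> e" by (elim bexE)
    then show "?F G \<le> 0 + e" using bspec[OF G(2), of G'] by linarith
  qed
  then have F: "(\<Sum>z\<in>UNIV. \<bar>(\<Sum>u\<in>UNIV. G $ u $ z) - pmf q z\<bar>) \<le> 0"
    "L \<le> (\<Sum>u\<in>UNIV. l1 * slice_h1 (vec_nth (G $ u)) + l2 * slice_h2 (vec_nth (G $ u)))" by auto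
  have "(\<Sum>u\<in>UNIV. G $ u $ z) = pmf q z" for z
  proof -
    have "\<bar>(\<Sum>u\<in>UNIV. G $ u $ z) - pmf q z\<bar> \<le> (\<Sum>z\<in>UNIV. \<bar>(\<Sum>u\<in>UNIV. G $ u $ z) - pmf q z\<bar>)"
      by (rule member_le_sum) auto
    then show ?thesis using F(1) by simp
  qed
  then have "(\<lambda>u. vec_nth (G $ u)) \<in> slice_systems q" using G(1) by (simp add: slice_systems_def slice_vecs_def)
  then show ?thesis using F(2) by (intro bexI[of _ "\<lambda>u. vec_nth (G $ u)"]) auto
qed

text \<open>Since \<open>R3\<close> is not closed by definition, separation needs the sum of the
  hull of these points and a closed polyhedron to be closed; compactness of the points provides
  that.\<close>

lemma compact_slice_points:
  fixes q :: "('x1::finite, 'x2::finite, 'y1::finite, 'y2::finite) quad pmf"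
  shows "compact ((\<lambda>g. (a - (\<Sum>u\<in>UNIV. slice_h1 (g u)), b - (\<Sum>u\<in>UNIV. slice_h2 (g u)))) ` slice_systems q)"
proof -
  let ?S = "slice_vecs (slice_mi (pmf q)) :: ('x1, 'x2, 'y1, 'y2) slice_vec set"
  let ?T = "?S \<inter> {G. \<forall>z. (\<Sum>u\<in>UNIV. G $ u $ z) = pmf q z}"
  let ?P = "\<lambda>g. (a - (\<Sum>u\<in>UNIV. slice_h1 (g u)), b - (\<Sum>u\<in>UNIV. slice_h2 (g u)))"
  have "closed {G :: ('x1, 'x2, 'y1, 'y2) slice_vec.
      \<forall>z. (\<Sum>u\<in>UNIV. G $ u $ z) = pmf q z}"
    by (intro closed_Collect_all closed_Collect_eq continuous_intros)
  then have "compact ?T" by (intro compact_Int_closed compact_slice_vecs)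
  moreover have h: "continuous_on ?S (\<lambda>G. slice_h1 (vec_nth (G $ u)))" "continuous_on ?S (\<lambda>G. slice_h2 (vec_nth (G $ u)))" for u
    by (rule compact_slice_vecs)+
  have "continuous_on ?S (\<lambda>G. ?P (\<lambda>u. vec_nth (G $ u)))" by (intro continuous_intros h)
  then have "continuous_on ?T (\<lambda>G. ?P (\<lambda>u. vec_nth (G $ u)))" by (rule continuous_on_subset) auto
  ultimately have "compact ((\<lambda>G. ?P (\<lambda>u. vec_nth (G $ u))) ` ?T)" by (rule compact_continuous_image[rotated])
  moreover have "slice_systems q = (\<lambda>G u. vec_nth (G $ u)) ` ?T"
  proof (intro equalityI subsetI)
    fix g assume g: "g \<in> slice_systems q"
    have "vec_nth (vec_lambda f) = f" for f :: "('x1, 'x2, 'y1, 'y2) quad \<Rightarrow> real" by (rule ext) simp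
    moreover have "(\<Sum>z\<in>UNIV. \<Sum>u\<in>UNIV. g u z) = 1" using g by (simp add: slice_systems_def sum_pmf_eq_1 del: split_paired_All)
    ultimately have "(\<chi> u. \<chi> z. g u z) \<in> ?T" using g by (simp add: slice_systems_def slice_vecs_def del: split_paired_All)
    moreover have "(\<lambda>u. vec_nth ((\<chi> u. \<chi> z. g u z) $ u)) = g" by (intro ext) simp
    ultimately show "g \<in> (\<lambda>G u. vec_nth (G $ u)) ` ?T"
      by (intro image_eqI[of _ _ "\<chi> u. \<chi> z. g u z"]) auto
  qed (auto simp: slice_systems_def slice_vecs_def)
  ultimately show ?thesis by (simp add: image_image)
qed

text \<open>The target contains P + Q for the polyhedron Q of all (s, t) with s, t \<ge> 0 and s + t
  \<ge> c. In a direction with nonnegative l1 and l2 the minimum over Q is min l1 l2 * c, so the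
  hypothesis compares the point with the support function of the convex set W, the sum of the hull
  of P and Q. Other directions cannot separate, because Q contains the rays along both axes beyond
  c.\<close>

lemma hull_of_support_bound:
  fixes P :: "(real \<times> real) set"
  assumes P: "compact P" and c: "0 \<le> c"
    and sup: "\<And>l1 l2. 0 \<le> l1 \<Longrightarrow> 0 \<le> l2 \<Longrightarrow> \<exists>(a, b)\<in>P. l1 * a + l2 * b + min l1 l2 * c \<le> l1 * R + l2 * R'"
  shows "(R, R') \<in> convex hull {(x, y). \<exists>(a, b)\<in>P. a \<le> x \<and> b \<le> y \<and> a + b + c \<le> x + y}"
proof -
  define Q where "Q = {(x, y). 0 \<le> x \<and> 0 \<le> y \<and> c \<le> x + (y :: real)}"
  define W where "W = (\<Union>p\<in>convex hull P. \<Union>y\<in>Q. {p + y})"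
  have Q_eq: "Q = {x. 0 \<le> fst x} \<inter> {x. 0 \<le> snd x} \<inter> {x. c \<le> fst x + snd x}" by (auto simp: Q_def)
  have "closed Q" unfolding Q_eq by (intro closed_Int closed_Collect_le continuous_intros)
  then have W: "closed W" unfolding W_def by (intro compact_closed_sums compact_convex_hull P)
  have "convex Q"
  proof (rule convexI)
    fix p p' :: "real \<times> real" and u v :: real
    assume pq: "p \<in> Q" "p' \<in> Q" "0 \<le> u" "0 \<le> v" "u + v = 1"
    obtain x y x' y' where p: "p = (x, y)" "p' = (x', y')" by (cases p; cases p')
    have *: "0 \<le> x" "0 \<le> y" "c \<le> x + y" "0 \<le> x'" "0 \<le> y'" "c \<le> x' + y'" "0 \<le> u" "0 \<le> v" "u + v = 1"
      using pq by (auto simp: p Q_def)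
    have "c = u * c + v * c" using * by (simp add: distrib_right[symmetric])
    also have "\<dots> \<le> u * (x + y) + v * (x' + y')" using * by (intro add_mono mult_left_mono) auto
    finally have "c \<le> u * x + v * x' + (u * y + v * y')" by (simp add: algebra_simps)
    then show "u *\<^sub>R p + v *\<^sub>R p' \<in> Q" using * by (simp add: p Q_def)
  qed
  then have cW: "convex W" unfolding W_def by (intro convex_sums convex_convex_hull)
  have "(R, R') \<in> W"
  proof (rule ccontr)
    assume "(R, R') \<notin> W"
    then obtain l \<beta> where sep: "inner l (R, R') < \<beta>" "\<And>x. x \<in> W \<Longrightarrow> \<beta> < inner l x"
      using separating_hyperplane_closed_point[OF cW W] by blast
    obtain l1 l2 where l: "l = (l1, l2)" by (cases l)
    have W_I: "(a + s, b + t) \<in> W" if "(a, b) \<in> P" "0 \<le> s" "0 \<le> t" "c \<le> s + t" for a b s t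
      unfolding W_def using that by (intro UN_I[of "(a, b)"] UN_I[of "(s, t)"]) (auto simp: Q_def hull_inc)
    obtain a0 b0 where ab0: "(a0, b0) \<in> P" using sup[of 0 0] by auto
    have "0 \<le> l1"
    proof (rule ccontr)
      assume neg: "\<not> 0 \<le> l1"
      \<comment> \<open>The second entry pushes the functional at (a0 + s, b0) down to \<beta> or
        below; the first keeps (s, 0) inside Q.\<close>
      define s where "s = max c ((l1 * a0 + l2 * b0 - \<beta>) / - l1)"
      have "\<beta> < inner l (a0 + s, b0 + 0)" by (rule sep(2), rule W_I[OF ab0]) (use c in \<open>auto simp: s_def\<close>)
      moreover have "(l1 * a0 + l2 * b0 - \<beta>) / - l1 \<le> s" by (simp add: s_def)
      then have "l1 * a0 + l2 * b0 - \<beta> \<le> s * - l1" using neg by (simp add: field_simps)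
      ultimately show False by (simp add: l algebra_simps)
    qed
    moreover have "0 \<le> l2"
    proof (rule ccontr)
      assume neg: "\<not> 0 \<le> l2"
      define s where "s = max c ((l1 * a0 + l2 * b0 - \<beta>) / - l2)"
      have "\<beta> < inner l (a0 + 0, b0 + s)" by (rule sep(2), rule W_I[OF ab0]) (use c in \<open>auto simp: s_def\<close>)
      moreover have "(l1 * a0 + l2 * b0 - \<beta>) / - l2 \<le> s" by (simp add: s_def)
      then have "l1 * a0 + l2 * b0 - \<beta> \<le> s * - l2" using neg by (simp add: field_simps)
      ultimately show False by (simp add: l algebra_simps)
    qed
    ultimately obtain a b where ab: "(a, b) \<in> P" "l1 * a + l2 * b + min l1 l2 * c \<le> l1 * R + l2 * R'"
      using sup[of l1 l2] by blast
    \<comment> \<open>The minimum over Q is attained at the vertex (c, 0) or (0, c), according to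
      which weight is smaller.\<close>
    have "\<beta> < l1 * a + l2 * b + min l1 l2 * c"
    proof (cases "l1 \<le> l2")
      case True
      then show ?thesis using sep(2)[OF W_I[OF ab(1), of c 0]] c by (simp add: l algebra_simps)
    next
      case False
      then show ?thesis using sep(2)[OF W_I[OF ab(1), of 0 c]] c by (simp add: l algebra_simps min_def)
    qed
    then show False using ab(2) sep(1) by (simp add: l)
  qed
  \<comment> \<open>The displacement y in Q is the same for all points in the convex combination p,
    so translating P by y already suffices.\<close>
  then obtain p y where py: "p \<in> convex hull P" "y \<in> Q" "(R, R') = y + p"
    by (auto simp: W_def add.commute)
  have "(R, R') \<in> (+) y ` (convex hull P)" using py by auto
  also have "\<dots> = convex hull ((+) y ` P)" by (rule convex_hull_translation[symmetric])
  also have "\<dots> \<subseteq> convex hull {(x, y). \<exists>(a, b)\<in>P. a \<le> x \<and> b \<le> y \<and> a + b + c \<le> x + y}"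
  proof (rule hull_mono, rule subsetI)
    fix w assume "w \<in> (+) y ` P"
    then obtain a b where "(a, b) \<in> P" "w = y + (a, b)" by auto
    then show "w \<in> {(x, y). \<exists>(a, b)\<in>P. a \<le> x \<and> b \<le> y \<and> a + b + c \<le> x + y}"
      using py(2) by (cases y) (auto simp: Q_def intro!: bexI[of _ "(a, b)"])
  qed
  finally show ?thesis .
qed

section \<open>Mutual information of finitely supported distributions\<close>

text \<open>An entropy without a carrier set, so that it moves along \<open>map_pmf\<close>; on
  finite supports it agrees with \<open>ent\<close>.\<close>

definition pmf_ent :: "'o pmf \<Rightarrow> ('o \<Rightarrow> 'a) \<Rightarrow> real" where
  "pmf_ent p X = measure_pmf.expectation p (\<lambda>w. - log 2 (pmf (map_pmf X p) (X w)))"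

lemma pmf_ent_map: "pmf_ent (map_pmf h p) X = pmf_ent p (\<lambda>w. X (h w))"
  by (simp add: pmf_ent_def map_pmf_comp)

lemma pmf_ent_eq_ent:
  assumes "finite \<Omega>" "set_pmf p \<subseteq> \<Omega>"
  shows "pmf_ent p X = ent \<Omega> (pmf p) X"
proof -
  have "pmf_ent p X = (\<Sum>w\<in>\<Omega>. - log 2 (pmf (map_pmf X p) (X w)) * pmf p w)"
    unfolding pmf_ent_def by (rule integral_measure_pmf_real) (use assms in auto)
  then show ?thesis
    by (simp add: ent_def pmf_map_finite[OF assms] sum_negf mult.commute)
qed

text \<open>The bridge from the measure-theoretic information of \<open>T3\<close> and
  \<open>R3\<close> to entropies. Countable value types make the product of two counting spaces
  again a counting space, and on the finite support all logarithms have positive arguments.\<close>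

lemma mi_eq_pmf_ent:
  fixes X :: "'o \<Rightarrow> 'a::countable" and Y :: "'o \<Rightarrow> 'b::countable"
  assumes fin: "finite (set_pmf p)"
  shows "mi p X Y = pmf_ent p X + pmf_ent p Y - pmf_ent p (X \<otimes> Y)"
proof -
  interpret P: information_space "measure_pmf p" 2 by unfold_locales simp
  let ?x = "map_pmf X p" and ?y = "map_pmf Y p" and ?xy = "map_pmf (X \<otimes> Y) p"
  have pair: "count_space (UNIV :: 'a set) \<Otimes>\<^sub>M count_space (UNIV :: 'b set) = count_space UNIV"
    by (simp add: pair_measure_countable)
  have dist: "distributed (measure_pmf p) (count_space UNIV) Z (pmf (map_pmf Z p))" for Z :: "'o \<Rightarrow> 'c"
    unfolding distributed_def by (simp add: map_pmf_rep_eq[symmetric]) (rule measure_pmf_eq_density)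
  have "mi p X Y = (\<integral>z. pmf ?xy z * log 2 (pmf ?xy z / (pmf ?x (fst z) * pmf ?y (snd z))) \<partial>count_space UNIV)"
    unfolding mi_def
    by (subst P.mutual_information_distr[where Px="pmf ?x" and Py="pmf ?y" and Pxy="pmf ?xy"])
      (auto simp: pair intro!: dist sigma_finite_measure_count_space_countable)
  also have "\<dots> = measure_pmf.expectation ?xy (\<lambda>z. log 2 (pmf ?xy z / (pmf ?x (fst z) * pmf ?y (snd z))))"
    by (simp add: measure_pmf_eq_density[of ?xy] integral_density)
  also have "\<dots> = measure_pmf.expectation p (\<lambda>w. log 2 (pmf ?xy (X w, Y w) / (pmf ?x (X w) * pmf ?y (Y w))))"
    by simp
  also have "\<dots> = measure_pmf.expectation p (\<lambda>w. - log 2 (pmf ?x (X w)) + - log 2 (pmf ?y (Y w))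
      - - log 2 (pmf ?xy (X w, Y w)))"
  proof (rule integral_cong_AE)
    have "log 2 (pmf ?xy (X w, Y w) / (pmf ?x (X w) * pmf ?y (Y w)))
      = - log 2 (pmf ?x (X w)) + - log 2 (pmf ?y (Y w)) - - log 2 (pmf ?xy (X w, Y w))" if "w \<in> set_pmf p" for w
    proof -
      have "0 < pmf ?x (X w)" "0 < pmf ?y (Y w)" "0 < pmf ?xy (X w, Y w)"
        using that by (auto simp: pmf_positive_iff)
      then show ?thesis by (simp add: log_divide log_mult)
    qed
    then show "AE w in p. log 2 (pmf ?xy (X w, Y w) / (pmf ?x (X w) * pmf ?y (Y w)))
      = - log 2 (pmf ?x (X w)) + - log 2 (pmf ?y (Y w)) - - log 2 (pmf ?xy (X w, Y w))"
      by (simp add: AE_measure_pmf_iff)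
  qed auto
  also have "\<dots> = pmf_ent p X + pmf_ent p Y - pmf_ent p (X \<otimes> Y)"
    unfolding pmf_ent_def
    by (subst Bochner_Integration.integral_diff Bochner_Integration.integral_add;
        (intro integrable_measure_pmf_finite fin)?)+ simp
  finally show ?thesis .
qed

lemma cmi_eq_pmf_ent:
  fixes X :: "'o \<Rightarrow> 'a::countable" and Y :: "'o \<Rightarrow> 'b::countable" and Z :: "'o \<Rightarrow> 'c::countable"
  assumes fin: "finite (set_pmf p)"
  shows "cmi p X Y Z = pmf_ent p (X \<otimes> Z) + pmf_ent p (Y \<otimes> Z)
     - pmf_ent p (X \<otimes> Y \<otimes> Z) - pmf_ent p Z"
proof -
  have "cmi p X Y Z = mi p X (Y \<otimes> Z) - mi p X Z"
    unfolding cmi_def mi_def prob_space.conditional_mutual_information_def[OF measure_pmf.prob_space_axioms] by (simp add: pair_measure_countable)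
  then show ?thesis using fin by (simp add: mi_eq_pmf_ent)
qed

lemma pmf_map_slice:
  fixes p :: "('u \<times> 'z::finite) pmf"
  assumes "\<And>u' z. X (u', z) = a \<longleftrightarrow> u' = u \<and> f z = b"
  shows "pmf (map_pmf X p) a = marg UNIV (\<lambda>z. pmf p (u, z)) f b"
proof -
  have "pmf (map_pmf X p) a = measure p ({u} \<times> {z. f z = b})"
    unfolding pmf_map by (rule arg_cong[where f="measure p"]) (use assms in auto)
  also have "\<dots> = sum (pmf p) ({u} \<times> {z. f z = b})" by (rule measure_measure_pmf_finite) simp
  finally show ?thesis by (simp add: marg_def sum.cartesian_product')
qed

lemma markov_chain_of_slices:
  fixes p :: "('u \<times> 'z::finite) pmf"
  assumes "\<And>u x y z. marg UNIV (\<lambda>k. pmf p (u, k)) (\<lambda>k. (a k, b k, c k)) (x, y, z) * marg UNIV (\<lambda>k. pmf p (u, k)) b y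
    = marg UNIV (\<lambda>k. pmf p (u, k)) (\<lambda>k. (a k, b k)) (x, y) * marg UNIV (\<lambda>k. pmf p (u, k)) (\<lambda>k. (b k, c k)) (y, z)"
  shows "markov_chain p (\<lambda>w. a (snd w)) (\<lambda>w. (fst w, b (snd w))) (\<lambda>w. c (snd w))"
  unfolding markov_chain_def
proof (intro allI, clarify)
  fix x u y z
  have "pmf (map_pmf (\<lambda>w. (a (snd w), (fst w, b (snd w)), c (snd w))) p) (x, (u, y), z)
      = marg UNIV (\<lambda>k. pmf p (u, k)) (\<lambda>k. (a k, b k, c k)) (x, y, z)"
    "pmf (map_pmf (\<lambda>w. (fst w, b (snd w))) p) (u, y) = marg UNIV (\<lambda>k. pmf p (u, k)) b y"
    "pmf (map_pmf (\<lambda>w. (a (snd w), (fst w, b (snd w)))) p) (x, (u, y)) = marg UNIV (\<lambda>k. pmf p (u, k)) (\<lambda>k. (a k, b k)) (x, y)"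
    "pmf (map_pmf (\<lambda>w. ((fst w, b (snd w)), c (snd w))) p) ((u, y), z) = marg UNIV (\<lambda>k. pmf p (u, k)) (\<lambda>k. (b k, c k)) (y, z)"
    by (rule pmf_map_slice; auto)+
  then show "pmf (map_pmf (\<lambda>w. (a (snd w), (fst w, b (snd w)), c (snd w))) p) (x, (u, y), z) *
      pmf (map_pmf (\<lambda>w. (fst w, b (snd w))) p) (u, y) =
      pmf (map_pmf (\<lambda>w. (a (snd w), (fst w, b (snd w)))) p) (x, (u, y)) *
      pmf (map_pmf (\<lambda>w. ((fst w, b (snd w)), c (snd w))) p) ((u, y), z)"
    using assms by simp
qed

lemma marg_single: "(\<And>z. X z = a \<longleftrightarrow> z = k) \<Longrightarrow> marg UNIV \<mu> X a = \<mu> k"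
  by (simp add: marg_def)

text \<open>The encoding of \<open>U\<close> by \<open>'z option\<close> matches the cardinality bound of \<open>T3\<close>; the
  enumeration \<open>e\<close> turns it into an initial segment of the naturals.\<close>

lemma T3_of_slice_system:
  fixes q :: "('x1::finite, 'x2::finite, 'y1::finite, 'y2::finite) quad pmf"
    and g :: "('x1, 'x2, 'y1, 'y2) quad option \<Rightarrow> ('x1, 'x2, 'y1, 'y2) quad \<Rightarrow> real"
  assumes nn: "\<And>u z. 0 \<le> g u z" and mk: "\<And>u. slice_markov (g u)"
    and mg: "\<And>z. (\<Sum>u\<in>UNIV. g u z) = pmf q z" and mi: "(\<Sum>u\<in>UNIV. slice_mi (g u)) \<le> slice_mi (pmf q)"
  obtains p where "p \<in> T3 q"
    "cmi p (\<lambda>(u, x1, x2, y1, y2). x1) (\<lambda>(u, x1, x2, y1, y2). u) (\<lambda>(u, x1, x2, y1, y2). x2)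
       = slice_h1 (pmf q) - (\<Sum>u\<in>UNIV. slice_h1 (g u))"
    "cmi p (\<lambda>(u, x1, x2, y1, y2). x2) (\<lambda>(u, x1, x2, y1, y2). u) (\<lambda>(u, x1, x2, y1, y2). x1)
       = slice_h2 (pmf q) - (\<Sum>u\<in>UNIV. slice_h2 (g u))"
    "cmi p (\<lambda>(u, x1, x2, y1, y2). y1) (\<lambda>(u, x1, x2, y1, y2). y2) (\<lambda>(u, x1, x2, y1, y2). (x1, x2))
       = out_mi (pmf q)"
proof -
  let ?N = "CARD('x1) * CARD('y1) * CARD('x2) * CARD('y2) + 1"
  have card: "card (UNIV :: ('x1, 'x2, 'y1, 'y2) quad option set) = ?N" by (simp add: card_UNIV_option)
  obtain e :: "('x1, 'x2, 'y1, 'y2) quad option \<Rightarrow> nat" where e: "bij_betw e UNIV {..<?N}"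
    using ex_bij_betw_finite_nat[of "UNIV :: ('x1, 'x2, 'y1, 'y2) quad option set"]
    unfolding card atLeast0LessThan by auto
  have inj: "inj e" using e by (simp add: bij_betw_def)
  define p0 where "p0 = embed_pmf (\<lambda>(u, z). g u z)"
  have tot: "(\<Sum>w\<in>UNIV. (\<lambda>(u, z). g u z) w) = 1"
  proof -
    have "(\<Sum>w\<in>UNIV. (\<lambda>(u, z). g u z) w) = (\<Sum>u\<in>UNIV. \<Sum>z\<in>UNIV. g u z)"
      by (simp add: UNIV_Times_UNIV[symmetric] sum.cartesian_product del: UNIV_Times_UNIV)
    also have "\<dots> = (\<Sum>z\<in>UNIV. \<Sum>u\<in>UNIV. g u z)" by (rule sum.swap)
    also have "\<dots> = 1" by (simp add: mg sum_pmf_eq_1)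
    finally show ?thesis .
  qed
  have p0: "pmf p0 (u, z) = g u z" for u z
  proof -
    have "pmf p0 (u, z) = (\<lambda>(u, z). g u z) (u, z)" unfolding p0_def
    proof (rule pmf_embed_pmf)
      show "0 \<le> (case x of (u, z) \<Rightarrow> g u z)" for x using nn by (cases x) auto
      have "(\<integral>\<^sup>+ x. ennreal (case x of (u, z) \<Rightarrow> g u z) \<partial>count_space UNIV)
          = (\<Sum>x\<in>UNIV. ennreal (case x of (u, z) \<Rightarrow> g u z))"
        by (simp add: nn_integral_count_space_finite)
      also have "\<dots> = ennreal (\<Sum>w\<in>UNIV. (\<lambda>(u, z). g u z) w)"
        by (rule sum_ennreal) (use nn in auto)
      finally show "(\<integral>\<^sup>+ x. ennreal (case x of (u, z) \<Rightarrow> g u z) \<partial>count_space UNIV) = 1"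
        using tot by simp
    qed
    then show ?thesis by simp
  qed
  define p where "p = map_pmf (\<lambda>(u, z). (e u, z)) p0"
  have pe: "pmf p (e u, z) = g u z" for u z
  proof -
    have "inj (\<lambda>(u, z). (e u, z :: ('x1, 'x2, 'y1, 'y2) quad))" using inj by (auto simp: inj_on_def)
    from pmf_map_inj'[OF this, of p0 "(u, z)"] show ?thesis by (simp add: p_def p0)
  qed
  let ?\<Omega> = "{..<?N} \<times> (UNIV :: ('x1, 'x2, 'y1, 'y2) quad set)"
  have sub: "set_pmf p \<subseteq> ?\<Omega>" using e by (auto simp: p_def bij_betw_def)
  then have fin: "finite (set_pmf p)" by (rule finite_subset) simp
  interpret P: finite_mass ?\<Omega> "pmf p" by (rule finite_mass_pmf) simp
  have sl: "slice_markov (\<lambda>z. pmf p (n, z))" for n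
  proof (cases "n \<in> range e")
    case True then show ?thesis using mk by (auto simp: pe)
  next
    case False
    then have "pmf p (n, z) = 0" for z by (auto simp: p_def pmf_eq_0_set_pmf)
    then show ?thesis by (simp add: slice_zero)
  qed
  have snd_p: "map_pmf snd p = q"
  proof (rule pmf_eqI)
    fix z
    have "pmf (map_pmf snd p) z = pmf (map_pmf snd p0) z" by (simp add: p_def map_pmf_comp case_prod_unfold)
    also have "\<dots> = measure p0 (UNIV \<times> {z})"
      unfolding pmf_map by (rule arg_cong[where f="measure p0"]) auto
    also have "\<dots> = (\<Sum>u\<in>UNIV. g u z)"
      by (simp add: measure_measure_pmf_finite sum.cartesian_product' p0)
    finally show "pmf (map_pmf snd p) z = pmf q z" by (simp add: mg)
  qed
  have Hq: "pmf_ent p (\<lambda>w. f (snd w)) = ent UNIV (pmf q) f" for f :: "_ \<Rightarrow> 'd"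
    unfolding pmf_ent_map[symmetric] snd_p by (rule pmf_ent_eq_ent) auto
  have HU: "pmf_ent p X = (\<Sum>u\<in>UNIV. ent UNIV (g u) f)"
    if "\<And>w w'. X w = X w' \<longleftrightarrow> fst w = fst w' \<and> f (snd w) = f (snd w')" for X :: "_ \<Rightarrow> 'd" and f :: "_ \<Rightarrow> 'e"
  proof -
    have "pmf_ent p X = P.H X" by (rule pmf_ent_eq_ent) (use sub in auto)
    also have "\<dots> = P.H (\<lambda>w. (fst w, f (snd w)))" by (rule P.ent_cong) (auto simp: that)
    also have "\<dots> = (\<Sum>n\<in>{..<?N}. ent UNIV (\<lambda>z. P.m (fst \<otimes> snd) (n, z)) f)"
      by (rule P.ent_disintegrate) auto
    also have "\<dots> = (\<Sum>n\<in>{..<?N}. ent UNIV (\<lambda>z. pmf p (n, z)) f)"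
    proof (rule sum.cong[OF refl])
      fix n assume "n \<in> {..<?N}"
      then have "{w \<in> ?\<Omega>. (fst w, snd w) = (n, z)} = {(n, z)}" for z by auto
      then show "ent UNIV (\<lambda>z. P.m (fst \<otimes> snd) (n, z)) f = ent UNIV (\<lambda>z. pmf p (n, z)) f"
        by (simp add: marg_def)
    qed
    also have "\<dots> = (\<Sum>u\<in>UNIV. ent UNIV (\<lambda>z. pmf p (e u, z)) f)"
      using e by (rule sum.reindex_bij_betw[symmetric])
    finally show ?thesis by (simp add: pe)
  qed
  have XU: "pmf_ent p (\<lambda>w. (X1 (snd w), fst w)) = (\<Sum>u\<in>UNIV. ent UNIV (g u) X1)"
    "pmf_ent p (\<lambda>w. (fst w, X1 (snd w))) = (\<Sum>u\<in>UNIV. ent UNIV (g u) X1)"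
    "pmf_ent p (\<lambda>w. (X2 (snd w), fst w)) = (\<Sum>u\<in>UNIV. ent UNIV (g u) X2)"
    "pmf_ent p (\<lambda>w. (fst w, X2 (snd w))) = (\<Sum>u\<in>UNIV. ent UNIV (g u) X2)"
    "pmf_ent p (\<lambda>w. (X1 (snd w), X2 (snd w), fst w)) = (\<Sum>u\<in>UNIV. ent UNIV (g u) XX)"
    "pmf_ent p (\<lambda>w. (X1 (snd w), fst w, X2 (snd w))) = (\<Sum>u\<in>UNIV. ent UNIV (g u) XX)"
    "pmf_ent p (\<lambda>w. (X2 (snd w), fst w, X1 (snd w))) = (\<Sum>u\<in>UNIV. ent UNIV (g u) XX)"
    "pmf_ent p fst = (\<Sum>u\<in>UNIV. ent UNIV (g u) (\<lambda>_. ()))"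
    by (rule HU; auto)+
  have qc: "ent UNIV (pmf q) (\<lambda>z. (X1 z, X2 z)) = ent UNIV (pmf q) XX"
    "ent UNIV (pmf q) (\<lambda>z. (X2 z, X1 z)) = ent UNIV (pmf q) XX"
    "ent UNIV (pmf q) (\<lambda>z. (Y1 z, XX z)) = ent UNIV (pmf q) Y1X"
    "ent UNIV (pmf q) (\<lambda>z. (Y2 z, XX z)) = ent UNIV (pmf q) Y2X"
    "ent UNIV (pmf q) (\<lambda>z. (Y1 z, Y2 z, XX z)) = ent UNIV (pmf q) (\<lambda>z. z)"
    by (rule finite_mass.ent_cong[OF finite_mass_pmf]; auto)+
  have q1: "ent UNIV (pmf q) (\<lambda>_. ()) = 0" by (simp add: ent_def marg_def sum_pmf_eq_1)
  have proj: "(\<lambda>(u, x1, x2, y1, y2). x1) = (\<lambda>w. X1 (snd w))" "(\<lambda>(u, x1, x2, y1, y2). x2) = (\<lambda>w. X2 (snd w))"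
    "(\<lambda>(u, x1, x2, y1, y2). u) = fst"
    "(\<lambda>(u, x1, x2, y1, y2). y1) = (\<lambda>w. Y1 (snd w))"
    "(\<lambda>(u, x1, x2, y1, y2). y2) = (\<lambda>w. Y2 (snd w))"
    "(\<lambda>(u, x1, x2, y1, y2). (x1, x2)) = (\<lambda>w. XX (snd w))"
    by (auto simp: fun_eq_iff)
  have quad_pairs: "(\<lambda>(x1, x2, y1, y2). (y1, x1)) = (\<lambda>z. (Y1 z, X1 z))" "(\<lambda>(x1, x2, y1, y2). (x1, x2, y2)) = (\<lambda>z. (X1 z, X2 z, Y2 z))"
    "(\<lambda>(x1, x2, y1, y2). (y2, x2)) = (\<lambda>z. (Y2 z, X2 z))" "(\<lambda>(x1, x2, y1, y2). (x2, x1, y1)) = (\<lambda>z. (X2 z, X1 z, Y1 z))"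
    by (auto simp: fun_eq_iff)
  show ?thesis
  proof (rule that[of p])
    show "p \<in> T3 q" unfolding T3_def
    proof (intro CollectI conjI)
      have "(\<lambda>(u, x1, x2, y1, y2). (x1, x2, y1, y2)) = (snd :: nat \<times> ('x1, 'x2, 'y1, 'y2) quad \<Rightarrow> _)"
        by (auto simp: fun_eq_iff)
      then show "map_pmf (\<lambda>(u, x1, x2, y1, y2). (x1, x2, y1, y2)) p = q"
        using snd_p by simp
      have "cmi p (\<lambda>w. X1 (snd w)) (\<lambda>w. X2 (snd w)) fst = (\<Sum>u\<in>UNIV. slice_mi (g u))"
        unfolding cmi_eq_pmf_ent[OF fin] XU slice_mi_def by (simp add: sum.distrib sum_subtractf)
      moreover have "mi p (\<lambda>w. X1 (snd w)) (\<lambda>w. X2 (snd w)) = slice_mi (pmf q)"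
        unfolding mi_eq_pmf_ent[OF fin] Hq[of X1] Hq[of X2] Hq[of "\<lambda>z. (X1 z, X2 z)"] qc slice_mi_def
        by (simp add: q1)
      ultimately show "cmi p (\<lambda>(u, x1, x2, y1, y2). x1) (\<lambda>(u, x1, x2, y1, y2). x2) (\<lambda>(u, x1, x2, y1, y2). u)
         \<le> mi p (\<lambda>(u, x1, x2, y1, y2). x1) (\<lambda>(u, x1, x2, y1, y2). x2)"
        using mi unfolding proj by simp
      have "marg UNIV (\<lambda>z. pmf p (n, z)) (\<lambda>z. (Y1 z, X1 z, (X2 z, Y2 z))) (y1, x1, (x2, y2)) = pmf p (n, x1, x2, y1, y2)"
        "marg UNIV (\<lambda>z. pmf p (n, z)) (\<lambda>z. (Y2 z, X2 z, (X1 z, Y1 z))) (y2, x2, (x1, y1)) = pmf p (n, x1, x2, y1, y2)"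
        for n x1 x2 y1 y2
        by (rule marg_single; auto)+
      then have "markov_chain p (\<lambda>w. Y1 (snd w)) (\<lambda>w. (fst w, X1 (snd w))) (\<lambda>w. (\<lambda>z. (X2 z, Y2 z)) (snd w))"
        "markov_chain p (\<lambda>w. Y2 (snd w)) (\<lambda>w. (fst w, X2 (snd w))) (\<lambda>w. (\<lambda>z. (X1 z, Y1 z)) (snd w))"
        using sl unfolding slice_markov_def quad_pairs by (intro markov_chain_of_slices; force)+
      then show "markov_chain p (\<lambda>(u, x1, x2, y1, y2). y1) (\<lambda>(u, x1, x2, y1, y2). (u, x1)) (\<lambda>(u, x1, x2, y1, y2). (x2, y2))"
        "markov_chain p (\<lambda>(u, x1, x2, y1, y2). y2) (\<lambda>(u, x1, x2, y1, y2). (u, x2)) (\<lambda>(u, x1, x2, y1, y2). (x1, y1))"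
        by (simp_all add: case_prod_unfold)
      show "fst ` set_pmf p \<subseteq> {..<?N}" using sub by auto
    qed
    show "cmi p (\<lambda>(u, x1, x2, y1, y2). x1) (\<lambda>(u, x1, x2, y1, y2). u) (\<lambda>(u, x1, x2, y1, y2). x2)
       = slice_h1 (pmf q) - (\<Sum>u\<in>UNIV. slice_h1 (g u))"
      unfolding proj cmi_eq_pmf_ent[OF fin] XU Hq[of X2] Hq[of "\<lambda>z. (X1 z, X2 z)"] qc slice_h1_def
      by (simp add: sum_subtractf)
    show "cmi p (\<lambda>(u, x1, x2, y1, y2). x2) (\<lambda>(u, x1, x2, y1, y2). u) (\<lambda>(u, x1, x2, y1, y2). x1)
       = slice_h2 (pmf q) - (\<Sum>u\<in>UNIV. slice_h2 (g u))"
      unfolding proj cmi_eq_pmf_ent[OF fin] XU Hq[of X1] Hq[of "\<lambda>z. (X2 z, X1 z)"] qc slice_h2_def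
      by (simp add: sum_subtractf)
    show "cmi p (\<lambda>(u, x1, x2, y1, y2). y1) (\<lambda>(u, x1, x2, y1, y2). y2) (\<lambda>(u, x1, x2, y1, y2). (x1, x2))
       = out_mi (pmf q)"
      unfolding proj cmi_eq_pmf_ent[OF fin] Hq[of XX] Hq[of "\<lambda>z. (Y1 z, XX z)"]
        Hq[of "\<lambda>z. (Y2 z, XX z)"]
        Hq[of "\<lambda>z. (Y1 z, Y2 z, XX z)"] qc out_mi_def
      by simp
  qed
qed

section \<open>Information inequalities for interactive messages\<close>

lemma take_Suc_eq_iff:
  assumes "k < length c" "k < length c'"
  shows "take (Suc k) c = take (Suc k) c' \<longleftrightarrow> c ! k = c' ! k \<and> take k c = take k c'"
  using assms by (auto simp: take_Suc_conv_app_nth)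

lemma drop_eq_iff_Suc:
  assumes "k < length c" "k < length c'"
  shows "drop k c = drop k c' \<longleftrightarrow> c ! k = c' ! k \<and> drop (Suc k) c = drop (Suc k) c'"
  using assms by (auto simp: Cons_nth_drop_Suc[symmetric])

context finite_mass
begin

lemma ent_messages_le:
  assumes "sum \<mu> \<Omega> = 1" "\<And>w. w \<in> \<Omega> \<Longrightarrow> length (C w) = r"
  shows "H C \<le> (\<Sum>i<r. H (\<lambda>w. C w ! i))"
proof -
  have "H (\<lambda>w. take k (C w)) \<le> (\<Sum>i<k. H (\<lambda>w. C w ! i))" if "k \<le> r" for k using that
  proof (induction k)
    case 0
    then show ?case using assms(1) by (simp add: ent_def marg_def)
  next
    case (Suc k)
    have "H (\<lambda>w. take (Suc k) (C w)) = H (\<lambda>w. (take k (C w), C w ! k))"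
      by (rule ent_cong) (use Suc.prems assms(2) in \<open>auto simp: take_Suc_eq_iff\<close>)
    also have "\<dots> \<le> H (\<lambda>w. take k (C w)) + H (\<lambda>w. C w ! k)" by (rule ent_subadditive) fact
    finally show ?case using Suc by simp
  qed
  from this[of r] have "H (\<lambda>w. take r (C w)) \<le> (\<Sum>i<r. H (\<lambda>w. C w ! i))" by simp
  moreover have "H (\<lambda>w. take r (C w)) = H C" by (rule ent_cong) (use assms(2) in auto)
  ultimately show ?thesis by simp
qed

text \<open>I(A;C|B) is accumulated round by round. A round outside P is sent by the node that holds
  B, so its message is independent of A given B and the history and adds nothing; a round in P adds
  at most the entropy of its message.\<close>

lemma rate_bound:
  assumes one: "sum \<mu> \<Omega> = 1" and len: "\<And>w. w \<in> \<Omega> \<Longrightarrow> length (C w) = r"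
    and fac: "\<And>k. k < r \<Longrightarrow> \<not> P k \<Longrightarrow> factors \<Omega> \<mu> (\<lambda>w. C w ! k) A (\<lambda>w. (take k (C w), B w))"
  shows "H (A \<otimes> B) + H (C \<otimes> B) - H (A \<otimes> C \<otimes> B) - H B
     \<le> (\<Sum>i\<in>{i\<in>{..<r}. P i}. H (\<lambda>w. C w ! i))"
proof -
  have "H (A \<otimes> B) + H (\<lambda>w. (take k (C w), B w)) - H (\<lambda>w. (A w, take k (C w), B w)) - H B
     \<le> (\<Sum>i\<in>{i\<in>{..<k}. P i}. H (\<lambda>w. C w ! i))" if "k \<le> r" for k using that
  proof (induction k)
    case 0
    have "H (\<lambda>w. (take 0 (C w), B w)) = H B" "H (\<lambda>w. (A w, take 0 (C w), B w)) = H (A \<otimes> B)"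
      by (rule ent_cong; simp)+
    then show ?case by simp
  next
    case (Suc k)
    let ?X = "\<lambda>w. C w ! k" and ?Z = "\<lambda>w. (take k (C w), B w)"
    have eq: "H (\<lambda>w. (take (Suc k) (C w), B w)) = H (?X \<otimes> ?Z)"
      "H (\<lambda>w. (A w, take (Suc k) (C w), B w)) = H (?X \<otimes> A \<otimes> ?Z)"
      by (rule ent_cong; use Suc.prems len in \<open>auto simp: take_Suc_eq_iff\<close>)+
    show ?case
    proof (cases "P k")
      case True
      have "{i\<in>{..<Suc k}. P i} = insert k {i\<in>{..<k}. P i}" using True by (auto simp: less_Suc_eq)
      then have "(\<Sum>i\<in>{i\<in>{..<Suc k}. P i}. H (\<lambda>w. C w ! i)) = H ?X + (\<Sum>i\<in>{i\<in>{..<k}. P i}. H (\<lambda>w. C w ! i))"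
        by simp
      moreover have "H (?X \<otimes> ?Z) \<le> H ?X + H ?Z" by (rule ent_subadditive) fact
      moreover have "H (A \<otimes> ?Z) \<le> H (?X \<otimes> A \<otimes> ?Z)" by (rule ent_mono)
      ultimately show ?thesis using Suc unfolding eq by simp
    next
      case False
      have "{i\<in>{..<Suc k}. P i} = {i\<in>{..<k}. P i}" using False by (auto simp: less_Suc_eq)
      moreover have "H (?X \<otimes> A \<otimes> ?Z) + H ?Z = H (?X \<otimes> ?Z) + H (A \<otimes> ?Z)"
        using Suc.prems False by (intro factors_ent fac) auto
      ultimately show ?thesis using Suc unfolding eq by simp
    qed
  qed
  from this[of r] have "H (A \<otimes> B) + H (\<lambda>w. (take r (C w), B w)) - H (\<lambda>w. (A w, take r (C w), B w)) - H B
     \<le> (\<Sum>i\<in>{i\<in>{..<r}. P i}. H (\<lambda>w. C w ! i))" by simp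
  moreover have "H (\<lambda>w. (take r (C w), B w)) = H (C \<otimes> B)"
    "H (\<lambda>w. (A w, take r (C w), B w)) = H (A \<otimes> C \<otimes> B)"
    by (rule ent_cong; use len in auto)+
  ultimately show ?thesis by simp
qed

text \<open>With T the history and X the next message, I(A;B|T X) = I(A;B|T) + I(A;X|T B) -
  I(A;X|T). If the holder of B speaks, the middle term is zero and the last one is nonnegative; the
  other case is symmetric.\<close>

lemma interaction_decreases_mi:
  assumes one: "sum \<mu> \<Omega> = 1" and len: "\<And>w. w \<in> \<Omega> \<Longrightarrow> length (C w) = r"
    and fac: "\<And>k. k < r \<Longrightarrow> factors \<Omega> \<mu> (\<lambda>w. C w ! k) A (\<lambda>w. (take k (C w), B w)) \<or>
       factors \<Omega> \<mu> (\<lambda>w. C w ! k) B (\<lambda>w. (take k (C w), A w))"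
  shows "H (C \<otimes> A) + H (C \<otimes> B) - H (A \<otimes> C \<otimes> B) - H C
     \<le> H A + H B - H (A \<otimes> B)"
proof -
  have "H (\<lambda>w. (take k (C w), A w)) + H (\<lambda>w. (take k (C w), B w)) - H (\<lambda>w. (A w, take k (C w), B w))
      - H (\<lambda>w. take k (C w)) \<le> H A + H B - H (A \<otimes> B)" if "k \<le> r" for k using that
  proof (induction k)
    case 0
    have "H (\<lambda>w. (take 0 (C w), A w)) = H A" "H (\<lambda>w. (take 0 (C w), B w)) = H B"
      "H (\<lambda>w. (A w, take 0 (C w), B w)) = H (A \<otimes> B)"
      by (rule ent_cong; simp)+
    moreover have "H (\<lambda>w. take 0 (C w)) = 0" using one by (simp add: ent_def marg_def)
    ultimately show ?case by simp
  next
    case (Suc k)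
    let ?X = "\<lambda>w. C w ! k" and ?T = "\<lambda>w. take k (C w)"
    have eq: "H (\<lambda>w. (take (Suc k) (C w), A w)) = H (?X \<otimes> ?T \<otimes> A)"
      "H (\<lambda>w. (take (Suc k) (C w), B w)) = H (?X \<otimes> ?T \<otimes> B)"
      "H (\<lambda>w. (A w, take (Suc k) (C w), B w)) = H (?X \<otimes> A \<otimes> ?T \<otimes> B)"
      "H (\<lambda>w. take (Suc k) (C w)) = H (?X \<otimes> ?T)"
      by (rule ent_cong; use Suc.prems len in \<open>auto simp: take_Suc_eq_iff\<close>)+
    have eq2: "H (?X \<otimes> B \<otimes> ?T \<otimes> A) = H (?X \<otimes> A \<otimes> ?T \<otimes> B)"
      "H (B \<otimes> ?T \<otimes> A) = H (A \<otimes> ?T \<otimes> B)"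
      "H (B \<otimes> ?T) = H (?T \<otimes> B)" "H (A \<otimes> ?T) = H (?T \<otimes> A)"
      "H (?X \<otimes> A \<otimes> ?T) = H (?X \<otimes> ?T \<otimes> A)"
      "H (?X \<otimes> B \<otimes> ?T) = H (?X \<otimes> ?T \<otimes> B)"
      by (rule ent_cong; auto)+
    from fac[of k] Suc.prems consider "factors \<Omega> \<mu> ?X A (?T \<otimes> B)" | "factors \<Omega> \<mu> ?X B (?T \<otimes> A)"
      by auto
    then show ?case
    proof cases
      case 1
      show ?thesis using factors_ent[OF 1] ent_submodular[of ?X A ?T] Suc unfolding eq eq2 by simp
    next
      case 2
      show ?thesis using factors_ent[OF 2] ent_submodular[of ?X B ?T] Suc unfolding eq eq2 by simp
    qed
  qed
  from this[of r] have "H (\<lambda>w. (take r (C w), A w)) + H (\<lambda>w. (take r (C w), B w)) - H (\<lambda>w. (A w, take r (C w), B w))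
      - H (\<lambda>w. take r (C w)) \<le> H A + H B - H (A \<otimes> B)" by simp
  moreover have "H (\<lambda>w. (take r (C w), A w)) = H (C \<otimes> A)" "H (\<lambda>w. (take r (C w), B w)) = H (C \<otimes> B)"
    "H (\<lambda>w. (A w, take r (C w), B w)) = H (A \<otimes> C \<otimes> B)" "H (\<lambda>w. take r (C w)) = H C"
    by (rule ent_cong; use len in auto)+
  ultimately show ?thesis by simp
qed

text \<open>With H(X) added on both sides this is I(V;W|X) \<le> H(C|X): V and W are independent
  given X and C, so all their dependence given X must pass through C, and I(V;W|X) \<le>
  I(V;C|X).\<close>

lemma mi_outputs_le_ent_message:
  assumes "factors \<Omega> \<mu> V W (X \<otimes> C)"
  shows "H (V \<otimes> X) + H (W \<otimes> X) - H (V \<otimes> W \<otimes> X) \<le> H (X \<otimes> C)"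
proof -
  let ?Z = "\<lambda>w. (X w, C w)"
  have "H (V \<otimes> W \<otimes> ?Z) + H ?Z = H (V \<otimes> ?Z) + H (W \<otimes> ?Z)"
    using assms by (rule factors_ent)
  moreover have "H (C \<otimes> W \<otimes> V \<otimes> X) + H (V \<otimes> X) \<le> H (C \<otimes> V \<otimes> X) + H (W \<otimes> V \<otimes> X)"
    by (rule ent_submodular)
  moreover have "H (W \<otimes> X) \<le> H (C \<otimes> W \<otimes> X)" by (rule ent_mono)
  moreover have "H (C \<otimes> W \<otimes> V \<otimes> X) = H (V \<otimes> W \<otimes> ?Z)"
    "H (C \<otimes> V \<otimes> X) = H (V \<otimes> ?Z)" "H (W \<otimes> V \<otimes> X) = H (V \<otimes> W \<otimes> X)"
    "H (C \<otimes> W \<otimes> X) = H (W \<otimes> ?Z)"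
    by (rule ent_cong; auto)+
  ultimately show ?thesis by linarith
qed

text \<open>Submodularity for letter i of A and letter j of B: conditioning in addition on letter j
  of B can only lower the conditional entropy of letter i of A.\<close>

lemma ent_take_drop_exchange:
  assumes len: "\<And>w. w \<in> \<Omega> \<Longrightarrow> length (A w) = n \<and> length (B w) = n" and "i < n" "j < n"
  shows "H (\<lambda>w. (C w, take (Suc i) (A w), drop j (B w))) - H (\<lambda>w. (C w, take i (A w), drop j (B w)))
    \<le> H (\<lambda>w. (C w, take (Suc i) (A w), drop (Suc j) (B w))) - H (\<lambda>w. (C w, take i (A w), drop (Suc j) (B w)))"
proof -
  let ?X = "\<lambda>w. A w ! i" and ?Y = "\<lambda>w. B w ! j" and ?Z = "\<lambda>w. (C w, take i (A w), drop (Suc j) (B w))"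
  have "H (\<lambda>w. (C w, take (Suc i) (A w), drop j (B w))) = H (?X \<otimes> ?Y \<otimes> ?Z)"
    "H (\<lambda>w. (C w, take i (A w), drop j (B w))) = H (?Y \<otimes> ?Z)"
    "H (\<lambda>w. (C w, take (Suc i) (A w), drop (Suc j) (B w))) = H (?X \<otimes> ?Z)"
    by (rule ent_cong; use assms in \<open>auto simp: take_Suc_eq_iff drop_eq_iff_Suc[of j]\<close>)+
  then show ?thesis using ent_submodular[of ?X ?Y ?Z] by linarith
qed

text \<open>With \<open>S i j = H(C, take i A, drop j B)\<close>, all three single-letterisations say that the increments of
  \<open>S\<close> in the first argument grow with the second.\<close>

lemma single_letterise:
  fixes A :: "'w \<Rightarrow> 'a list" and B :: "'w \<Rightarrow> 'b list" and C :: "'w \<Rightarrow> 'c"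
  assumes len: "\<And>w. w \<in> \<Omega> \<Longrightarrow> length (A w) = n \<and> length (B w) = n"
  defines "S \<equiv> \<lambda>i j. H (\<lambda>w. (C w, take i (A w), drop j (B w)))"
  shows "S n 0 - S 0 0 \<le> (\<Sum>i<n. S (Suc i) i - S i i)"
    and "S n 0 - S n n \<le> (\<Sum>i<n. S (Suc i) i - S (Suc i) (Suc i))"
    and "(\<Sum>i<n. S (Suc i) (Suc i) + S i i - S (Suc i) i - S i (Suc i)) \<le> S n n - S 0 n - S n 0 + S 0 0"
proof -
  have ex: "S (Suc i) j - S i j \<le> S (Suc i) (Suc j) - S i (Suc j)" if "i < n" "j < n" for i j
    unfolding S_def by (rule ent_take_drop_exchange) (use len that in auto)
  have mono_j: "S (Suc i) j - S i j \<le> S (Suc i) (j + d) - S i (j + d)" if "i < n" "j + d \<le> n" for i j d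
    using that(2)
  proof (induction d)
    case (Suc d)
    then show ?case using ex[of i "j + d"] that(1) by auto
  qed simp
  have mono_i: "S i j - S i (Suc j) \<le> S k j - S k (Suc j)" if "k \<le> i" "i \<le> n" "j < n" for i j k
    using that(1,2)
  proof (induction i rule: dec_induct)
    case (step i)
    then show ?case using ex[of i j] that(3) by auto
  qed simp
  have tel: "(\<Sum>i<n. S (Suc i) j - S i j) = S n j - S 0 j" for j by (rule sum_lessThan_telescope)
  have d0: "S (Suc i) 0 - S i 0 \<le> S (Suc i) i - S i i" if "i < n" for i using mono_j[of i 0 i] that by simp
  have dn: "S (Suc i) (Suc i) - S i (Suc i) \<le> S (Suc i) n - S i n" if "i < n" for i
    using mono_j[of i "Suc i" "n - Suc i"] that by simp
  show "S n 0 - S 0 0 \<le> (\<Sum>i<n. S (Suc i) i - S i i)"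
    unfolding tel[symmetric] by (rule sum_mono) (use d0 in auto)
  have "S n 0 - S n n = (\<Sum>j<n. S n j - S n (Suc j))" by (rule sum_lessThan_telescope'[symmetric])
  also have "\<dots> \<le> (\<Sum>j<n. S (Suc j) j - S (Suc j) (Suc j))" by (rule sum_mono) (use mono_i in auto)
  finally show "S n 0 - S n n \<le> (\<Sum>i<n. S (Suc i) i - S (Suc i) (Suc i))" .
  have "(\<Sum>i<n. S (Suc i) (Suc i) + S i i - S (Suc i) i - S i (Suc i))
    \<le> (\<Sum>i<n. (S (Suc i) n - S i n) - (S (Suc i) 0 - S i 0))"
  proof (rule sum_mono)
    fix i assume "i \<in> {..<n}"
    then show "S (Suc i) (Suc i) + S i i - S (Suc i) i - S i (Suc i) \<le> (S (Suc i) n - S i n) - (S (Suc i) 0 - S i 0)"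
      using d0[of i] dn[of i] by simp
  qed
  also have "\<dots> = (S n n - S 0 n) - (S n 0 - S 0 0)" by (simp only: sum_subtractf[of "\<lambda>i. S (Suc i) n - S i n"] tel)
  finally show "(\<Sum>i<n. S (Suc i) (Suc i) + S i i - S (Suc i) i - S i (Suc i)) \<le> S n n - S 0 n - S n 0 + S 0 0"
    by simp
qed

end

section \<open>Single-letterisation\<close>

lemma ent_cong_marg:
  assumes "finite_mass \<Omega> \<mu>" "finite_mass \<Omega>' \<mu>'" and eq: "\<And>a. marg \<Omega> \<mu> X a = marg \<Omega>' \<mu>' X' a"
  shows "ent \<Omega> \<mu> X = ent \<Omega>' \<mu>' X'"
proof -
  interpret M: finite_mass \<Omega> \<mu> by fact
  interpret M': finite_mass \<Omega>' \<mu>' by fact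
  have "M.H X = (\<Sum>a\<in>X ` \<Omega> \<union> X' ` \<Omega>'. eta (M.m X a))"
    unfolding M.ent_eq_sum_eta by (rule sum.mono_neutral_left) (auto simp: M.fin M'.fin marg_eq_0 eta_def)
  also have "\<dots> = (\<Sum>a\<in>X ` \<Omega> \<union> X' ` \<Omega>'. eta (M'.m X' a))" by (simp add: eq)
  also have "\<dots> = M'.H X'"
    unfolding M'.ent_eq_sum_eta by (rule sum.mono_neutral_right) (auto simp: M.fin M'.fin marg_eq_0 eta_def)
  finally show ?thesis .
qed

lemma marg_comp_cong:
  assumes "finite_mass \<Omega> \<mu>" "finite_mass \<Omega>' \<mu>'" and eq: "\<And>a. marg \<Omega> \<mu> X a = marg \<Omega>' \<mu>' X' a"
  shows "marg \<Omega> \<mu> (\<lambda>w. f (X w)) b = marg \<Omega>' \<mu>' (\<lambda>w. f (X' w)) b"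
proof -
  interpret M: finite_mass \<Omega> \<mu> by fact
  interpret M': finite_mass \<Omega>' \<mu>' by fact
  let ?S = "{a\<in>X ` \<Omega> \<union> X' ` \<Omega>'. f a = b}"
  have "M.m (\<lambda>w. f (X w)) b = (\<Sum>a\<in>?S. M.m X a)"
    unfolding M.marg_comp by (rule sum.mono_neutral_left) (use M.fin M'.fin in \<open>auto intro!: marg_eq_0\<close>)
  also have "\<dots> = (\<Sum>a\<in>?S. M'.m X' a)" by (simp add: eq)
  also have "\<dots> = M'.m (\<lambda>w. f (X' w)) b"
    unfolding M'.marg_comp by (rule sum.mono_neutral_right) (use M.fin M'.fin in \<open>auto intro!: marg_eq_0\<close>)
  finally show ?thesis .
qed

lemma map_nth_replicate_pmf: "i < n \<Longrightarrow> map_pmf (\<lambda>t. t ! i) (replicate_pmf n q) = q"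
proof (induction n arbitrary: i)
  case (Suc n)
  have *: "map_pmf (\<lambda>t. t ! i) (replicate_pmf (Suc n) q)
      = q \<bind> (\<lambda>x. map_pmf (\<lambda>t. (x # t) ! i) (replicate_pmf n q))"
    by (simp add: map_bind_pmf map_pmf_def bind_assoc_pmf bind_return_pmf)
  show ?case
  proof (cases i)
    case 0
    then show ?thesis unfolding * by (simp add: bind_return_pmf')
  next
    case (Suc j)
    then show ?thesis unfolding * using Suc.IH[of j] Suc.prems by simp
  qed
qed simp

text \<open>What the converse uses of a code with finitely many transcripts. G1 and G2 are the
  probabilities, over private randomness, of a full transcript together with the own output; K1 and
  K2 are those of a partial transcript. Rounds are counted from zero here: after a history of odd
  length node 2 speaks, which leaves K1 unchanged.\<close>

locale interactive_law =
  fixes q :: "('x1::finite, 'x2::finite, 'y1::finite, 'y2::finite) quad pmf" and n r :: nat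
    and Cs :: "nat list set"
    and G1 :: "nat list \<Rightarrow> 'x1 list \<Rightarrow> 'y1 list \<Rightarrow> real" and G2 :: "nat list \<Rightarrow> 'x2 list \<Rightarrow> 'y2 list \<Rightarrow> real"
    and K1 :: "nat list \<Rightarrow> 'x1 list \<Rightarrow> real" and K2 :: "nat list \<Rightarrow> 'x2 list \<Rightarrow> real"
    and \<Omega> :: "(('x1, 'x2, 'y1, 'y2) quad list \<times> nat list) set"
    and J :: "('x1, 'x2, 'y1, 'y2) quad list \<times> nat list \<Rightarrow> real"
  assumes finCs: "finite Cs" and lenCs: "\<And>c. c \<in> Cs \<Longrightarrow> length c = r"
    and G_nonneg: "\<And>c x y. 0 \<le> G1 c x y" "\<And>c x y. 0 \<le> G2 c x y"
    and Omega_eq: "\<Omega> = {t. length t = n} \<times> Cs"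
    and J_eq: "\<And>t c. J (t, c) = pmf (replicate_pmf n (map_pmf XX q)) (map XX t)
       * G1 c (map X1 t) (map Y1 t) * G2 c (map X2 t) (map Y2 t)"
    and marg_hist: "\<And>k a b h. k \<le> r \<Longrightarrow> length a = n \<Longrightarrow> length b = n \<Longrightarrow> length h = k \<Longrightarrow>
      marg \<Omega> J (\<lambda>(t, c). (map X1 t, map X2 t, take k c)) (a, b, h)
        = pmf (replicate_pmf n (map_pmf XX q)) (zip a b) * K1 h a * K2 h b"
    and K_Nil: "\<And>a. K1 [] a = 1" "\<And>b. K2 [] b = 1"
    and K1_step: "\<And>h x a. odd (length h) \<Longrightarrow> K1 (h @ [x]) a = K1 h a"
    and K2_step: "\<And>h x b. even (length h) \<Longrightarrow> K2 (h @ [x]) b = K2 h b"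
begin

abbreviation "PX \<equiv> pmf (replicate_pmf n (map_pmf XX q))"
abbreviation "A \<equiv> \<lambda>w :: ('x1, 'x2, 'y1, 'y2) quad list \<times> nat list. map X1 (fst w)"
abbreviation "B \<equiv> \<lambda>w :: ('x1, 'x2, 'y1, 'y2) quad list \<times> nat list. map X2 (fst w)"
abbreviation "V \<equiv> \<lambda>w :: ('x1, 'x2, 'y1, 'y2) quad list \<times> nat list. map Y1 (fst w)"
abbreviation "W \<equiv> \<lambda>w :: ('x1, 'x2, 'y1, 'y2) quad list \<times> nat list. map Y2 (fst w)"
abbreviation "C \<equiv> \<lambda>w :: ('x1, 'x2, 'y1, 'y2) quad list \<times> nat list. snd w"

sublocale finite_mass \<Omega> J
  by unfold_locales (auto simp: Omega_eq finCs J_eq G_nonneg)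

lemma quads_unique:
  fixes a :: "'x1 list" and b :: "'x2 list" and v :: "'y1 list" and w :: "'y2 list"
  assumes "length a = n" "length b = n" "length v = n" "length w = n" "c \<in> Cs"
  shows "{\<omega>\<in>\<Omega>. A \<omega> = a \<and> B \<omega> = b \<and> V \<omega> = v \<and> W \<omega> = w \<and> C \<omega> = c} = {(zip a (zip b (zip v w)), c)}"
proof -
  have proj: "map X1 (zip a (zip b (zip v w))) = a" "map X2 (zip a (zip b (zip v w))) = b"
    "map Y1 (zip a (zip b (zip v w))) = v" "map Y2 (zip a (zip b (zip v w))) = w"
    using assms by (auto intro!: nth_equalityI)
  have uniq: "t = zip (map X1 t) (zip (map X2 t) (zip (map Y1 t) (map Y2 t)))"
    for t :: "('x1, 'x2, 'y1, 'y2) quad list"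
    by (rule nth_equalityI) (auto split: prod.split)
  show ?thesis
  proof (intro equalityI subsetI)
    fix \<omega> assume "\<omega> \<in> {\<omega>\<in>\<Omega>. A \<omega> = a \<and> B \<omega> = b \<and> V \<omega> = v \<and> W \<omega> = w \<and> C \<omega> = c}"
    then have "fst \<omega> = zip a (zip b (zip v w))" "snd \<omega> = c" using uniq[of "fst \<omega>"] by auto
    then show "\<omega> \<in> {(zip a (zip b (zip v w)), c)}" by (simp add: prod_eq_iff)
  next
    fix \<omega> assume "\<omega> \<in> {(zip a (zip b (zip v w)), c)}"
    then show "\<omega> \<in> {\<omega>\<in>\<Omega>. A \<omega> = a \<and> B \<omega> = b \<and> V \<omega> = v \<and> W \<omega> = w \<and> C \<omega> = c}"
      using assms proj by (simp add: Omega_eq)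
  qed
qed

lemma J_zip:
  assumes "length a = n" "length b = n" "length v = n" "length w = n"
  shows "J (zip a (zip b (zip v w)), c) = PX (zip a b) * G1 c a v * G2 c b w"
proof -
  have "map X1 (zip a (zip b (zip v w))) = a" "map X2 (zip a (zip b (zip v w))) = b"
    "map Y1 (zip a (zip b (zip v w))) = v" "map Y2 (zip a (zip b (zip v w))) = w"
    "map XX (zip a (zip b (zip v w))) = zip a b"
    using assms by (auto intro!: nth_equalityI)
  then show ?thesis by (simp add: J_eq)
qed

lemma PX_zip:
  assumes "length a = n" "length b = n"
  shows "PX (zip a b) = (\<Prod>j<n. pmf (map_pmf XX q) (a ! j, b ! j))"
proof -
  have "PX (zip a b) = prod_list (map (pmf (map_pmf XX q)) (zip a b))"
    using assms by (simp add: pmf_replicate_pmf)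
  also have "\<dots> = (\<Prod>j<n. pmf (map_pmf XX q) (a ! j, b ! j))"
    using assms by (simp add: prod.list_conv_set_nth atLeast0LessThan)
  finally show ?thesis .
qed

text \<open>The source law is a product over positions. Before k the first letter is known and the
  factor depends on node 2's block only; from k on the second letter is known and the factor depends
  on node 1's block only. G1 and G2 already separate, so the outputs can be carried along.\<close>

lemma factors_letter:
  assumes k: "k \<le> n"
  shows "factors \<Omega> J (A \<otimes> V) (B \<otimes> W) (\<lambda>w. (C w, take k (A w), drop k (B w)))"
proof -
  let ?m = "m (\<lambda>w. ((A w, V w), (B w, W w), (C w, take k (A w), drop k (B w))))"
  let ?p = "pmf (map_pmf XX q)"
  \<comment> \<open>The tests for c, s and u confine the product to attained triples. Position j of
    the block b is position j - k of its tail u.\<close>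
  define F where "F = (\<lambda>(a, v) (c, s, u). if length a = n \<and> length v = n \<and> c \<in> Cs \<and> take k a = s
      then (\<Prod>j\<in>{k..<n}. ?p (a ! j, u ! (j - k))) * G1 c a v else 0)"
  define G where "G = (\<lambda>(b, w) (c, s, u). if length b = n \<and> length w = n \<and> drop k b = u
      then (\<Prod>j<k. ?p (s ! j, b ! j)) * G2 c b w else 0)"
  have "?m (x, y, z) = F x z * G y z" for x y z
  proof -
    obtain a v b w c s u where xyz: "x = (a, v)" "y = (b, w)" "z = (c, s, u)" by (cases x; cases y; cases z)
    show ?thesis
    proof (cases "length a = n \<and> length v = n \<and> c \<in> Cs \<and> take k a = s \<and> length b = n \<and> length w = n \<and> drop k b = u")
      case True
      then have "{\<omega>\<in>\<Omega>. ((A \<omega>, V \<omega>), (B \<omega>, W \<omega>), (C \<omega>, take k (A \<omega>), drop k (B \<omega>))) = (x, y, z)}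
         = {\<omega>\<in>\<Omega>. A \<omega> = a \<and> B \<omega> = b \<and> V \<omega> = v \<and> W \<omega> = w \<and> C \<omega> = c}" by (auto simp: xyz)
      also have "\<dots> = {(zip a (zip b (zip v w)), c)}" using True by (intro quads_unique) auto
      finally have "?m (x, y, z)
          = PX (zip a b) * G1 c a v * G2 c b w"
        using True by (simp add: marg_def J_zip)
      moreover have "PX (zip a b) = (\<Prod>j<k. ?p (s ! j, b ! j)) * (\<Prod>j\<in>{k..<n}. ?p (a ! j, u ! (j - k)))"
      proof -
        have "PX (zip a b) = (\<Prod>j\<in>{..<k} \<union> {k..<n}. ?p (a ! j, b ! j))"
          using True k by (simp add: PX_zip ivl_disj_un)
        also have "\<dots> = (\<Prod>j<k. ?p (a ! j, b ! j)) * (\<Prod>j\<in>{k..<n}. ?p (a ! j, b ! j))"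
          by (rule prod.union_disjoint) auto
        also have "(\<Prod>j<k. ?p (a ! j, b ! j)) = (\<Prod>j<k. ?p (s ! j, b ! j))"
          using True by (intro prod.cong) auto
        also have "(\<Prod>j\<in>{k..<n}. ?p (a ! j, b ! j)) = (\<Prod>j\<in>{k..<n}. ?p (a ! j, u ! (j - k)))"
          using True k by (intro prod.cong) auto
        finally show ?thesis .
      qed
      ultimately show ?thesis using True by (simp add: F_def G_def xyz)
    next
      case False
      then have "?m (x, y, z) = 0"
        by (intro marg_eq_0) (auto simp: xyz Omega_eq)
      moreover have "F x z * G y z = 0" using False by (auto simp: F_def G_def xyz)
      ultimately show ?thesis by simp
    qed
  qed
  then show ?thesis unfolding factors_def by blast
qed

lemma factors_outputs: "factors \<Omega> J V W ((A \<otimes> B) \<otimes> C)"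
proof -
  let ?m = "m (\<lambda>w. (V w, W w, ((A w, B w), C w)))"
  define F where "F = (\<lambda>v ((a, b), c). if length a = n \<and> length b = n \<and> length v = n \<and> c \<in> Cs
      then PX (zip a b) * G1 c a v else 0)"
  define G where "G = (\<lambda>w ((a :: 'x1 list, b), c). if length w = n then G2 c b w else 0)"
  have "?m (v, w, z) = F v z * G w z" for v w z
  proof -
    obtain a b c where z: "z = ((a, b), c)" by (cases z) auto
    show ?thesis
    proof (cases "length a = n \<and> length v = n \<and> c \<in> Cs \<and> length b = n \<and> length w = n")
      case True
      then have "{\<omega>\<in>\<Omega>. (V \<omega>, W \<omega>, ((A \<omega>, B \<omega>), C \<omega>)) = (v, w, z)}
         = {\<omega>\<in>\<Omega>. A \<omega> = a \<and> B \<omega> = b \<and> V \<omega> = v \<and> W \<omega> = w \<and> C \<omega> = c}" by (auto simp: z)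
      also have "\<dots> = {(zip a (zip b (zip v w)), c)}" using True by (intro quads_unique) auto
      finally show ?thesis using True by (simp add: marg_def J_zip F_def G_def z)
    next
      case False
      then have "?m (v, w, z) = 0"
        by (intro marg_eq_0) (auto simp: z Omega_eq)
      moreover have "F v z * G w z = 0" using False by (auto simp: F_def G_def z)
      ultimately show ?thesis by simp
    qed
  qed
  then show ?thesis unfolding factors_def by blast
qed

lemma marg_next_message:
  assumes k: "k < r" and "length h = k" "length a = n" "length b = n"
  shows "m (\<lambda>w. (A w, B w, C w ! k, take k (C w))) (a, b, x, h) = PX (zip a b) * K1 (h @ [x]) a * K2 (h @ [x]) b"
proof -
  have "m (\<lambda>w. (A w, B w, C w ! k, take k (C w))) (a, b, x, h)
      = m (\<lambda>(t, c). (map X1 t, map X2 t, take (Suc k) c)) (a, b, h @ [x])"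
  proof (rule marg_cong)
    fix w :: "('x1, 'x2, 'y1, 'y2) quad list \<times> nat list" assume w: "w \<in> \<Omega>"
    obtain t c where tc: "w = (t, c)" by (cases w)
    have "k < length c" using w k lenCs[of c] by (simp add: tc Omega_eq)
    then have "take (Suc k) c = take k c @ [c ! k]" by (rule take_Suc_conv_app_nth)
    then show "(A w, B w, C w ! k, take k (C w)) = (a, b, x, h) \<longleftrightarrow>
        (case w of (t, c) \<Rightarrow> (map X1 t, map X2 t, take (Suc k) c)) = (a, b, h @ [x])"
      by (auto simp: tc)
  qed
  also have "\<dots> = PX (zip a b) * K1 (h @ [x]) a * K2 (h @ [x]) b"
    using assms by (intro marg_hist) auto
  finally show ?thesis .
qed

text \<open>For odd k, counted from zero, node 2 speaks. By \<open>K1_step\<close> the new entry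
  changes the K2 factor only, and that factor depends on B and the history.\<close>

lemma factors_message_2:
  assumes k: "k < r" "odd k"
  shows "factors \<Omega> J (\<lambda>w. C w ! k) A (\<lambda>w. (take k (C w), B w))"
proof -
  let ?m = "m (\<lambda>w. (C w ! k, A w, (take k (C w), B w)))"
  define F where "F = (\<lambda>x (h, b). if length h = k \<and> length b = n then K2 (h @ [x]) b else 0)"
  define G where "G = (\<lambda>a (h, b). if length a = n then PX (zip a b) * K1 h a else 0)"
  have "?m (x, a, z) = F x z * G a z" for x a z
  proof -
    obtain h b where z: "z = (h, b)" by (cases z)
    show ?thesis
    proof (cases "length h = k \<and> length a = n \<and> length b = n")
      case True
      have "?m (x, a, z) = m (\<lambda>w. (A w, B w, C w ! k, take k (C w))) (a, b, x, h)"
        by (rule marg_cong) (auto simp: z)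
      then show ?thesis using marg_next_message[of k h a b x] True k K1_step[of h x a] by (simp add: z F_def G_def)
    next
      case False
      then have "?m (x, a, z) = 0"
        using k lenCs by (intro marg_eq_0) (auto simp: z Omega_eq)
      moreover have "F x z * G a z = 0" using False by (auto simp: F_def G_def z)
      ultimately show ?thesis by simp
    qed
  qed
  then show ?thesis unfolding factors_def by blast
qed

lemma factors_message_1:
  assumes k: "k < r" "even k"
  shows "factors \<Omega> J (\<lambda>w. C w ! k) B (\<lambda>w. (take k (C w), A w))"
proof -
  let ?m = "m (\<lambda>w. (C w ! k, B w, (take k (C w), A w)))"
  define F where "F = (\<lambda>x (h, a). if length h = k \<and> length a = n then K1 (h @ [x]) a else 0)"
  define G where "G = (\<lambda>b (h, a). if length b = n then PX (zip a b) * K2 h b else 0)"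
  have "?m (x, b, z) = F x z * G b z" for x b z
  proof -
    obtain h a where z: "z = (h, a)" by (cases z)
    show ?thesis
    proof (cases "length h = k \<and> length a = n \<and> length b = n")
      case True
      have "?m (x, b, z) = m (\<lambda>w. (A w, B w, C w ! k, take k (C w))) (a, b, x, h)"
        by (rule marg_cong) (auto simp: z)
      then show ?thesis using marg_next_message[of k h a b x] True k K2_step[of h x b] by (simp add: z F_def G_def)
    next
      case False
      then have "?m (x, b, z) = 0"
        using k lenCs by (intro marg_eq_0) (auto simp: z Omega_eq)
      moreover have "F x z * G b z = 0" using False by (auto simp: F_def G_def z)
      ultimately show ?thesis by simp
    qed
  qed
  then show ?thesis unfolding factors_def by blast
qed

abbreviation "T \<equiv> {t :: ('x1, 'x2, 'y1, 'y2) quad list. length t = n}"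
abbreviation "Q \<equiv> pmf (replicate_pmf n q)"
abbreviation "Out \<equiv> m fst"

lemma finite_mass_Q: "finite_mass T Q" by (rule finite_mass_pmf) simp

lemma finite_mass_Out: "finite_mass T Out" by unfold_locales (auto simp: marg_nonneg)

lemma marg_Out: "m (\<lambda>w. f (fst w)) a = marg T Out f a"
proof -
  have "m (\<lambda>w. f (fst w)) a = (\<Sum>t\<in>{t\<in>fst ` \<Omega>. f t = a}. Out t)" by (rule marg_comp)
  also have "\<dots> = (\<Sum>t\<in>{t\<in>T. f t = a}. Out t)"
    by (rule sum.mono_neutral_left) (auto simp: Omega_eq intro!: marg_eq_0)
  finally show ?thesis by (simp add: marg_def)
qed

lemma ent_Out: "H (\<lambda>w. f (fst w)) = ent T Out f"
  by (rule ent_cong_marg[OF _ finite_mass_Out marg_Out]) unfold_locales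

text \<open>The case k = 0 of \<open>marg_hist\<close>: the inputs have exactly their i.i.d. law, so
  the continuity bound is needed only where outputs occur.\<close>

lemma marg_XX: "m (\<lambda>w. map XX (fst w)) b = marg T Q (map XX) b"
proof (cases "length b = n")
  case True
  have "m (\<lambda>w. map XX (fst w)) b = m (\<lambda>(t, c). (map X1 t, map X2 t, take 0 c)) (map fst b, map snd b, [])"
  proof (rule marg_cong)
    fix w :: "('x1, 'x2, 'y1, 'y2) quad list \<times> nat list" assume w: "w \<in> \<Omega>"
    obtain t c where tc: "w = (t, c)" by (cases w)
    have "map fst (map XX t) = map X1 t" "map snd (map XX t) = map X2 t"
      "map XX t = zip (map X1 t) (map X2 t)" by (auto intro!: nth_equalityI split: prod.split)
    moreover have "b = zip (map fst b) (map snd b)" by (simp add: zip_map_fst_snd)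
    ultimately show "map XX (fst w) = b \<longleftrightarrow> (case w of (t, c) \<Rightarrow> (map X1 t, map X2 t, take 0 c)) = (map fst b, map snd b, [])"
      by (auto simp: tc)
  qed
  also have "\<dots> = PX (zip (map fst b) (map snd b)) * K1 [] (map fst b) * K2 [] (map snd b)"
    using True by (intro marg_hist) auto
  also have "\<dots> = PX b" by (simp add: K_Nil zip_map_fst_snd)
  also have "\<dots> = pmf (map_pmf (map XX) (replicate_pmf n q)) b" by (simp add: map_replicate_pmf)
  also have "\<dots> = marg T Q (map XX) b" by (rule pmf_map_finite) (auto simp: set_replicate_pmf)
  finally show ?thesis .
next
  case False
  then have "m (\<lambda>w. map XX (fst w)) b = 0" "marg T Q (map XX) b = 0"
    by (auto simp: Omega_eq intro!: marg_eq_0)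
  then show ?thesis by simp
qed

lemma marg_inputs: "m (\<lambda>w. map (\<lambda>z. g (XX z)) (fst w)) a = marg T Q (map (\<lambda>z. g (XX z))) a"
proof -
  have "m (\<lambda>w. map g (map XX (fst w))) a = marg T Q (\<lambda>t. map g (map XX t)) a"
    by (rule marg_comp_cong[OF _ finite_mass_Q marg_XX]) unfold_locales
  then show ?thesis by (simp add: comp_def)
qed

lemma ent_inputs: "H (\<lambda>w. map (\<lambda>z. g (XX z)) (fst w)) = real n * ent UNIV (pmf q) (\<lambda>z. g (XX z))"
proof -
  have "H (\<lambda>w. map (\<lambda>z. g (XX z)) (fst w)) = ent T Q (map (\<lambda>z. g (XX z)))"
    by (rule ent_cong_marg[OF _ finite_mass_Q marg_inputs]) unfold_locales
  then show ?thesis by (simp add: ent_replicate)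
qed

lemma sum_J: "sum J \<Omega> = 1"
proof -
  have "sum J \<Omega> = m (\<lambda>w. (\<lambda>_. ()) (map XX (fst w))) ()" by (simp add: marg_def)
  also have "\<dots> = marg T Q (\<lambda>t. (\<lambda>_. ()) (map XX t)) ()"
    by (rule marg_comp_cong[OF _ finite_mass_Q marg_XX]) unfold_locales
  also have "\<dots> = 1" using sum_replicate_pmf[of n q] by (simp add: marg_def)
  finally show ?thesis .
qed

lemma sum_Out: "sum Out T = 1"
proof -
  have "sum Out T = sum Out (fst ` \<Omega>)"
    by (rule sum.mono_neutral_right) (auto simp: Omega_eq intro!: marg_eq_0)
  then show ?thesis by (simp add: sum_marg sum_J)
qed

end

text \<open>The bound of \<open>ent_dist_le\<close> with N = K ^ n, per letter. Only its first term
  really grows with n; the other two are enlarged by the factor n so that all can be divided by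
  n.\<close>

definition continuity_error :: "nat \<Rightarrow> real \<Rightarrow> real" where
  "continuity_error K e = e * log 2 (real K) + e * log 2 (1 / e) + 2 * e / ln 2"

lemma map_pair_eq_iff:
  "map (\<lambda>z. (f z, g z)) t = map (\<lambda>z. (f z, g z)) t' \<longleftrightarrow> map f t = map f t' \<and> map g t = map g t'"
proof
  assume *: "map (\<lambda>z. (f z, g z)) t = map (\<lambda>z. (f z, g z)) t'"
  from arg_cong[OF *, of "map fst"] arg_cong[OF *, of "map snd"]
  show "map f t = map f t' \<and> map g t = map g t'" by (simp add: comp_def)
next
  have "map (\<lambda>z. (f z, g z)) t = zip (map f t) (map g t)" for t by (induction t) auto
  then show "map f t = map f t' \<and> map g t = map g t' \<Longrightarrow> map (\<lambda>z. (f z, g z)) t = map (\<lambda>z. (f z, g z)) t'" by simp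
qed

lemma quad_maps:
  "(\<lambda>(x1, x2, y1, y2). (x1, x2)) = (\<lambda>z. (X1 z, X2 z))"
  "Y1X = (\<lambda>z. (Y1 z, X1 z, X2 z))"
  "Y2X = (\<lambda>z. (Y2 z, X1 z, X2 z))"
  "(\<lambda>z. z) = (\<lambda>z. (X1 z, X2 z, Y1 z, Y2 z))"
  by (auto simp: fun_eq_iff)

lemma factors_cong:
  assumes "factors \<Omega> \<mu> X Y Z" "\<And>w. w \<in> \<Omega> \<Longrightarrow> X' w = X w \<and> Y' w = Y w"
  shows "factors \<Omega> \<mu> X' Y' Z"
proof -
  have "marg \<Omega> \<mu> (X \<otimes> Y \<otimes> Z) a = marg \<Omega> \<mu> (X' \<otimes> Y' \<otimes> Z) a" for a
    by (rule marg_cong) (use assms(2) in simp)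
  then show ?thesis using assms(1) by (simp only: factors_def)
qed

section \<open>Letter slices of a block law\<close>

context interactive_law
begin

definition U :: "nat \<Rightarrow> ('x1, 'x2, 'y1, 'y2) quad list \<times> nat list \<Rightarrow> nat list \<times> 'x1 list \<times> 'x2 list" where
  "U i w = (C w, take i (A w), drop (Suc i) (B w))"

text \<open>The factor 1 / n makes the position uniform, so that the pair (i, u) serves as a single
  value of the auxiliary variable.\<close>

definition slice :: "nat \<Rightarrow> nat list \<times> 'x1 list \<times> 'x2 list \<Rightarrow> ('x1, 'x2, 'y1, 'y2) quad \<Rightarrow> real" where
  "slice i u z = (1 / real n) * m (\<lambda>w. (U i w, fst w ! i)) (u, z)"

definition S :: "nat \<Rightarrow> nat \<Rightarrow> real" where
  "S i j = H (\<lambda>w. (C w, take i (A w), drop j (B w)))"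

lemma slice_nonneg: "0 \<le> slice i u z"
  by (simp add: slice_def marg_nonneg)

text \<open>The letter X1_i completes the prefix of length i, the letter X2_i completes the suffix
  behind i. Hence the four entropies needed for position i are the values of S at the corners of one
  grid cell.\<close>

lemma ent_letter:
  assumes "i < n"
  shows "H (\<lambda>w. (U i w, X1 (fst w ! i))) = S (Suc i) (Suc i)"
    "H (\<lambda>w. (U i w, X2 (fst w ! i))) = S i i"
    "H (\<lambda>w. (U i w, XX (fst w ! i))) = S (Suc i) i"
    "H (\<lambda>w. (U i w, ())) = S i (Suc i)"
  unfolding S_def U_def
  by (rule ent_cong; use assms in \<open>auto simp: Omega_eq take_Suc_eq_iff drop_eq_iff_Suc[of i] split: prod.splits\<close>)+

lemma sum_slices:
  "(\<Sum>u\<in>U i ` \<Omega>. slice_h1 (slice i u)) = (1 / real n) * (H (\<lambda>w. (U i w, XX (fst w ! i))) - H (\<lambda>w. (U i w, X2 (fst w ! i))))"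
  "(\<Sum>u\<in>U i ` \<Omega>. slice_h2 (slice i u)) = (1 / real n) * (H (\<lambda>w. (U i w, XX (fst w ! i))) - H (\<lambda>w. (U i w, X1 (fst w ! i))))"
  "(\<Sum>u\<in>U i ` \<Omega>. slice_mi (slice i u)) = (1 / real n) * (H (\<lambda>w. (U i w, X1 (fst w ! i))) - H (\<lambda>w. (U i w, XX (fst w ! i)))
      + (H (\<lambda>w. (U i w, X2 (fst w ! i))) - H (\<lambda>w. (U i w, ()))))"
proof -
  let ?v = "\<lambda>u z. m (\<lambda>w. (U i w, fst w ! i)) (u, z)"
  have dis: "H (\<lambda>w. (U i w, f (fst w ! i))) = (\<Sum>u\<in>U i ` \<Omega>. ent UNIV (?v u) f)" for f :: "_ \<Rightarrow> 'd"
    by (rule ent_disintegrate) (use fin in auto)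
  have sc: "slice_h1 (slice i u) = (1 / real n) * slice_h1 (?v u)" "slice_h2 (slice i u) = (1 / real n) * slice_h2 (?v u)"
    "slice_mi (slice i u) = (1 / real n) * slice_mi (?v u)" for u
    unfolding slice_def[abs_def] by (rule slice_scale; simp add: marg_nonneg)+
  show "(\<Sum>u\<in>U i ` \<Omega>. slice_h1 (slice i u)) = (1 / real n) * (H (\<lambda>w. (U i w, XX (fst w ! i))) - H (\<lambda>w. (U i w, X2 (fst w ! i))))"
    unfolding sc dis sum_distrib_left[symmetric] by (simp add: slice_h1_def sum_subtractf)
  show "(\<Sum>u\<in>U i ` \<Omega>. slice_h2 (slice i u)) = (1 / real n) * (H (\<lambda>w. (U i w, XX (fst w ! i))) - H (\<lambda>w. (U i w, X1 (fst w ! i))))"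
    unfolding sc dis sum_distrib_left[symmetric] by (simp add: slice_h2_def sum_subtractf)
  show "(\<Sum>u\<in>U i ` \<Omega>. slice_mi (slice i u)) = (1 / real n) * (H (\<lambda>w. (U i w, X1 (fst w ! i))) - H (\<lambda>w. (U i w, XX (fst w ! i)))
      + (H (\<lambda>w. (U i w, X2 (fst w ! i))) - H (\<lambda>w. (U i w, ()))))"
    unfolding sc dis[of "\<lambda>_. ()"] dis[of X1] dis[of X2] dis[of XX] sum_distrib_left[symmetric]
    by (simp add: slice_mi_def sum_subtractf sum.distrib)
qed

text \<open>U_i together with X1_i is the split of \<open>factors_letter\<close> at i + 1, and U_i
  together with X2_i is the split at i. The first leaves X2_i and Y2_i on node 2's side, the second
  leaves X1_i and Y1_i on node 1's side.\<close>

lemma slice_markov_slice: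
  assumes i: "i < n" and u: "u \<in> U i ` \<Omega>"
  shows "slice_markov (slice i u)"
proof -
  let ?v = "\<lambda>z. m (\<lambda>w. (U i w, fst w ! i)) (u, z)"
  obtain c s d where ucsd: "u = (c, s, d)" by (cases u)
  have ls: "length s = i" using u i by (auto simp: ucsd U_def Omega_eq)
  have tS: "take (Suc i) (A w) = s @ [x] \<longleftrightarrow> take i (A w) = s \<and> X1 (fst w ! i) = x" if "w \<in> \<Omega>" for w x
    using that i by (auto simp: Omega_eq take_Suc_conv_app_nth)
  have dS: "drop i (B w) = x # d \<longleftrightarrow> drop (Suc i) (B w) = d \<and> X2 (fst w ! i) = x" if "w \<in> \<Omega>" for w x
    using that i Cons_nth_drop_Suc[of i "B w"] by (auto simp: Omega_eq)
  have cong: "m X a = m Y b"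
    if "\<And>w x1 x2 y1 y2. w \<in> \<Omega> \<Longrightarrow> fst w ! i = (x1, x2, y1, y2) \<Longrightarrow> X w = a \<longleftrightarrow> Y w = b"
    for X :: "_ \<Rightarrow> 'e" and Y :: "_ \<Rightarrow> 'f" and a b
  proof (rule marg_cong)
    fix w :: "('x1, 'x2, 'y1, 'y2) quad list \<times> nat list" assume w: "w \<in> \<Omega>"
    obtain x1 x2 y1 y2 where "fst w ! i = (x1, x2, y1, y2)" by (cases "fst w ! i") auto
    then show "X w = a \<longleftrightarrow> Y w = b" by (rule that[OF w])
  qed
  have f1: "factors \<Omega> J (\<lambda>w. Y1 (fst w ! i)) (\<lambda>w. (X2 (fst w ! i), Y2 (fst w ! i))) (\<lambda>w. (C w, take (Suc i) (A w), drop (Suc i) (B w)))"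
  proof -
    have "factors \<Omega> J (\<lambda>w. (\<lambda>(a, v). v ! i) (A w, V w)) (\<lambda>w. (\<lambda>(b, v). (b ! i, v ! i)) (B w, W w))
        (\<lambda>w. (C w, take (Suc i) (A w), drop (Suc i) (B w)))"
      by (rule factors_comp[OF factors_letter]) (use i in simp)
    then show ?thesis by (rule factors_cong) (use i in \<open>auto simp: Omega_eq\<close>)
  qed
  have f2: "factors \<Omega> J (\<lambda>w. (X1 (fst w ! i), Y1 (fst w ! i))) (\<lambda>w. Y2 (fst w ! i)) (\<lambda>w. (C w, take i (A w), drop i (B w)))"
  proof -
    have "factors \<Omega> J (\<lambda>w. (\<lambda>(a, v). (a ! i, v ! i)) (A w, V w)) (\<lambda>w. (\<lambda>(b, v). v ! i) (B w, W w))
        (\<lambda>w. (C w, take i (A w), drop i (B w)))"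
      by (rule factors_comp[OF factors_letter]) (use i in simp)
    then show ?thesis by (rule factors_cong) (use i in \<open>auto simp: Omega_eq\<close>)
  qed
  have "slice_markov ?v" unfolding slice_markov_def
  proof (intro allI conjI)
    fix x1 x2 y1 y2
    let ?Z = "\<lambda>w. (C w, take (Suc i) (A w), drop (Suc i) (B w))" and ?z = "(c, s @ [x1], d)"
    have e: "?v (x1, x2, y1, y2) = m (\<lambda>w. (Y1 (fst w ! i), (X2 (fst w ! i), Y2 (fst w ! i)), ?Z w)) (y1, (x2, y2), ?z)"
      "m (\<lambda>w. (U i w, X1 (fst w ! i))) (u, x1) = m ?Z ?z"
      "m (\<lambda>w. (U i w, (\<lambda>(x1, x2, y1, y2). (y1, x1)) (fst w ! i))) (u, y1, x1) = m (\<lambda>w. (Y1 (fst w ! i), ?Z w)) (y1, ?z)"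
      "m (\<lambda>w. (U i w, (\<lambda>(x1, x2, y1, y2). (x1, x2, y2)) (fst w ! i))) (u, x1, x2, y2)
        = m (\<lambda>w. ((X2 (fst w ! i), Y2 (fst w ! i)), ?Z w)) ((x2, y2), ?z)"
      by (rule cong; auto simp: U_def ucsd tS)+
    show "?v (x1, x2, y1, y2) * marg UNIV ?v X1 x1 = marg UNIV ?v (\<lambda>(x1, x2, y1, y2). (y1, x1)) (y1, x1) *
        marg UNIV ?v (\<lambda>(x1, x2, y1, y2). (x1, x2, y2)) (x1, x2, y2)"
      unfolding marg_slice e by (rule factors_imp_markov[OF f1])
    let ?Z' = "\<lambda>w. (C w, take i (A w), drop i (B w))" and ?z' = "(c, s, x2 # d)"
    have e': "?v (x1, x2, y1, y2) = m (\<lambda>w. ((X1 (fst w ! i), Y1 (fst w ! i)), Y2 (fst w ! i), ?Z' w)) ((x1, y1), y2, ?z')"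
      "m (\<lambda>w. (U i w, X2 (fst w ! i))) (u, x2) = m ?Z' ?z'"
      "m (\<lambda>w. (U i w, (\<lambda>(x1, x2, y1, y2). (y2, x2)) (fst w ! i))) (u, y2, x2) = m (\<lambda>w. (Y2 (fst w ! i), ?Z' w)) (y2, ?z')"
      "m (\<lambda>w. (U i w, (\<lambda>(x1, x2, y1, y2). (x2, x1, y1)) (fst w ! i))) (u, x2, x1, y1)
        = m (\<lambda>w. ((X1 (fst w ! i), Y1 (fst w ! i)), ?Z' w)) ((x1, y1), ?z')"
      by (rule cong; auto simp: U_def ucsd dS)+
    show "?v (x1, x2, y1, y2) * marg UNIV ?v X2 x2 = marg UNIV ?v (\<lambda>(x1, x2, y1, y2). (y2, x2)) (y2, x2) *
        marg UNIV ?v (\<lambda>(x1, x2, y1, y2). (x2, x1, y1)) (x2, x1, y1)"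
      unfolding marg_slice e' factors_imp_markov[OF f2] by (rule mult.commute)
  qed
  then show ?thesis unfolding slice_def[abs_def] by (rule slice_markov_scale)
qed

lemma sum_slice:
  "(\<Sum>u\<in>U i ` \<Omega>. slice i u z) = (1 / real n) * m (\<lambda>w. fst w ! i) z"
  unfolding slice_def sum_distrib_left[symmetric] using marg_sum_left[of "U i" "\<lambda>w. fst w ! i" z] by simp

lemma letter_dist:
  assumes "i < n"
  shows "(\<Sum>z\<in>UNIV. \<bar>m (\<lambda>w. fst w ! i) z - pmf q z\<bar>) \<le> (\<Sum>t\<in>T. \<bar>Out t - Q t\<bar>)"
proof -
  have q: "pmf q z = marg T Q (\<lambda>t. t ! i) z" for z
    using pmf_map_finite[of T "replicate_pmf n q" "\<lambda>t. t ! i" z] map_nth_replicate_pmf[OF assms, of q]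
    by (auto simp: set_replicate_pmf)
  have "(\<Sum>z\<in>UNIV. \<bar>m (\<lambda>w. fst w ! i) z - pmf q z\<bar>)
      = (\<Sum>z\<in>UNIV. \<bar>marg T Out (\<lambda>t. t ! i) z - marg T Q (\<lambda>t. t ! i) z\<bar>)"
    using marg_Out[of "\<lambda>t. t ! i"] by (simp add: q)
  also have "\<dots> = (\<Sum>z\<in>(\<lambda>t. t ! i) ` T. \<bar>marg T Out (\<lambda>t. t ! i) z - marg T Q (\<lambda>t. t ! i) z\<bar>)"
    by (rule sum.mono_neutral_right) (auto simp: marg_eq_0)
  also have "\<dots> \<le> (\<Sum>t\<in>T. \<bar>Out t - Q t\<bar>)" by (rule sum_marg_dist_le) simp
  finally show ?thesis .
qed

lemma ent_inputs_single:
  "H A = real n * ent UNIV (pmf q) X1" "H B = real n * ent UNIV (pmf q) X2"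
  "H (A \<otimes> B) = real n * ent UNIV (pmf q) XX"
proof -
  have e: "(\<lambda>z :: ('x1, 'x2, 'y1, 'y2) quad. fst (XX z)) = X1" "(\<lambda>z :: ('x1, 'x2, 'y1, 'y2) quad. snd (XX z)) = X2"
    by (auto simp: fun_eq_iff)
  show "H A = real n * ent UNIV (pmf q) X1" using ent_inputs[of fst] unfolding e .
  show "H B = real n * ent UNIV (pmf q) X2" using ent_inputs[of snd] unfolding e .
  have "H (A \<otimes> B) = H (\<lambda>w. map XX (fst w))"
    unfolding quad_maps by (rule ent_cong) (simp add: map_pair_eq_iff)
  then show "H (A \<otimes> B) = real n * ent UNIV (pmf q) XX" using ent_inputs[of "\<lambda>x. x"] by simp
qed

text \<open>Three error terms, for (Y1, X1, X2), (Y2, X1, X2) and the full quadruple; the fourth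
  entropy of \<open>out_mi\<close> concerns the inputs only and is exact.\<close>

lemma out_mi_bound:
  assumes n: "0 < n" and e: "0 < e" "e \<le> 1" and dist: "(\<Sum>t\<in>T. \<bar>Out t - Q t\<bar>) \<le> e"
  shows "real n * out_mi (pmf q) - 3 * (real n * continuity_error CARD(('x1, 'x2, 'y1, 'y2) quad) e)
    \<le> H (C \<otimes> A \<otimes> B) - H (A \<otimes> B)"
proof -
  let ?K = "real CARD(('x1, 'x2, 'y1, 'y2) quad)" and ?E = "real n * continuity_error CARD(('x1, 'x2, 'y1, 'y2) quad) e"
  have "0 < CARD(('x1, 'x2, 'y1, 'y2) quad)" by (rule finite_UNIV_card_ge_0) simp
  then have K: "1 \<le> ?K" by linarith
  have cont: "\<bar>H (\<lambda>w. map f (fst w)) - real n * ent UNIV (pmf q) f\<bar> \<le> ?E" for f :: "_ \<Rightarrow> 'd"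
  proof -
    have "\<bar>ent T Out (map f) - ent T Q (map f)\<bar> \<le> e * log 2 (?K ^ n / e) + 2 * e / ln 2"
    proof (rule ent_dist_le[OF finite_mass_Out finite_mass_Q sum_Out sum_replicate_pmf dist e(1)])
      show "e \<le> ?K ^ n" using e(2) one_le_power[OF K, of n] by linarith
      show "real (card T) \<le> ?K ^ n" by (simp only: card_lists_length of_nat_power order_refl)
    qed
    also have "e * log 2 (?K ^ n / e) + 2 * e / ln 2 = real n * (e * log 2 ?K) + e * log 2 (1 / e) + 2 * e / ln 2"
    proof -
      have "log 2 (k ^ n / e) = real n * log 2 k + log 2 (1 / e)" if "1 \<le> k" for k
        using e that by (simp add: log_divide log_nat_power)
      from this[OF K] show ?thesis by (simp only: distrib_left mult.left_commute)
    qed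
    \<comment> \<open>This enlargement by the factor n needs log 2 (1 / e) \<ge> 0, hence the
      assumption e \<le> 1.\<close>
    also have "\<dots> \<le> real n * (e * log 2 ?K) + real n * (e * log 2 (1 / e)) + real n * (2 * e / ln 2)"
    proof (intro add_mono order_refl)
      have *: "x \<le> real n * x" if "0 \<le> x" for x using that n by (simp add: mult_le_cancel_right1)
      show "e * log 2 (1 / e) \<le> real n * (e * log 2 (1 / e))" by (rule *) (use e in simp)
      show "2 * e / ln 2 \<le> real n * (2 * e / ln 2)" by (rule *) (use e in simp)
    qed
    also have "\<dots> = ?E" by (simp add: continuity_error_def distrib_left)
    finally show ?thesis by (simp add: ent_Out ent_replicate)
  qed
  have eq: "H (V \<otimes> A \<otimes> B) = H (\<lambda>w. map Y1X (fst w))"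
    "H (W \<otimes> A \<otimes> B) = H (\<lambda>w. map Y2X (fst w))"
    unfolding quad_maps(2,3) by (rule ent_cong; simp only: map_pair_eq_iff prod.inject)+
  have eq3: "H (V \<otimes> W \<otimes> A \<otimes> B) = H (\<lambda>w. map (\<lambda>z. z) (fst w))"
    by (subst quad_maps(4), rule ent_cong, unfold map_pair_eq_iff) auto
  have "H (V \<otimes> A \<otimes> B) + H (W \<otimes> A \<otimes> B) - H (V \<otimes> W \<otimes> A \<otimes> B) \<le> H ((A \<otimes> B) \<otimes> C)"
    by (rule mi_outputs_le_ent_message) (rule factors_outputs)
  moreover have "H ((A \<otimes> B) \<otimes> C) = H (C \<otimes> A \<otimes> B)" by (rule ent_cong) auto
  moreover have "real n * out_mi (pmf q) = real n * ent UNIV (pmf q) Y1X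
      + real n * ent UNIV (pmf q) Y2X - real n * ent UNIV (pmf q) (\<lambda>z. z)
      - real n * ent UNIV (pmf q) XX"
    by (simp add: out_mi_def algebra_simps)
  ultimately show ?thesis
    using cont[of Y1X] cont[of Y2X] cont[of "\<lambda>z. z"]
    unfolding eq eq3 ent_inputs_single by linarith
qed

abbreviation "I \<equiv> Sigma {..<n} (\<lambda>i. U i ` \<Omega>)"

abbreviation "sum_h1 \<equiv> \<Sum>(i, u)\<in>I. slice_h1 (slice i u)"
abbreviation "sum_h2 \<equiv> \<Sum>(i, u)\<in>I. slice_h2 (slice i u)"

lemma single_letter_slices:
  assumes n: "0 < n" and e: "0 < e" "e \<le> 1" and dist: "(\<Sum>t\<in>T. \<bar>Out t - Q t\<bar>) \<le> e"
  shows "finite I" "\<And>i u z. 0 \<le> slice i u z" "\<And>i u. (i, u) \<in> I \<Longrightarrow> slice_markov (slice i u)"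
    and "(\<Sum>z\<in>UNIV. \<Sum>(i, u)\<in>I. slice i u z) = 1"
    and "(\<Sum>z\<in>UNIV. \<bar>(\<Sum>(i, u)\<in>I. slice i u z) - pmf q z\<bar>) \<le> e"
    and "(\<Sum>(i, u)\<in>I. slice_mi (slice i u)) \<le> slice_mi (pmf q)"
    and "real n * (slice_h1 (pmf q) - sum_h1) \<le> (\<Sum>k\<in>{k\<in>{..<r}. even k}. H (\<lambda>w. C w ! k))"
    and "real n * (slice_h2 (pmf q) - sum_h2) \<le> (\<Sum>k\<in>{k\<in>{..<r}. odd k}. H (\<lambda>w. C w ! k))"
    and "real n * (slice_h1 (pmf q) - sum_h1
         + (slice_h2 (pmf q) - sum_h2) + out_mi (pmf q))
       \<le> (\<Sum>k<r. H (\<lambda>w. C w ! k)) + 3 * (real n * continuity_error CARD(('x1, 'x2, 'y1, 'y2) quad) e)"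
proof -
  have sumI: "(\<Sum>(i, u)\<in>I. F i u) = (\<Sum>i<n. \<Sum>u\<in>U i ` \<Omega>. F i u)" for F :: "_ \<Rightarrow> _ \<Rightarrow> real"
    by (rule sum.Sigma[symmetric]) (use fin in auto)
  have mass: "(\<Sum>(i, u)\<in>I. slice i u z) = (\<Sum>i<n. (1 / real n) * m (\<lambda>w. fst w ! i) z)" for z
    by (simp add: sumI sum_slice)
  show "finite I" using fin by auto
  show "0 \<le> slice i u z" for i u z by (rule slice_nonneg)
  show "slice_markov (slice i u)" if "(i, u) \<in> I" for i u using that by (auto intro: slice_markov_slice)
  show "(\<Sum>z\<in>UNIV. \<Sum>(i, u)\<in>I. slice i u z) = 1"
  proof -
    have one: "(\<Sum>z\<in>UNIV. m (\<lambda>w. fst w ! i) z) = 1" for i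
    proof -
      have "(\<Sum>z\<in>UNIV. m (\<lambda>w. fst w ! i) z) = (\<Sum>z\<in>(\<lambda>w. fst w ! i) ` \<Omega>. m (\<lambda>w. fst w ! i) z)"
        by (rule sum.mono_neutral_right) (auto simp: marg_eq_0)
      then show ?thesis by (simp add: sum_marg sum_J)
    qed
    have "(\<Sum>z\<in>UNIV. \<Sum>(i, u)\<in>I. slice i u z) = (\<Sum>i<n. \<Sum>z\<in>UNIV. (1 / real n) * m (\<lambda>w. fst w ! i) z)"
      unfolding mass by (rule sum.swap)
    also have "\<dots> = (\<Sum>i<n. 1 / real n)" unfolding sum_distrib_left[symmetric] one by simp
    finally show ?thesis using n by simp
  qed
  show "(\<Sum>z\<in>UNIV. \<bar>(\<Sum>(i, u)\<in>I. slice i u z) - pmf q z\<bar>) \<le> e"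
  proof -
    have "\<bar>(\<Sum>(i, u)\<in>I. slice i u z) - pmf q z\<bar> \<le> (\<Sum>i<n. (1 / real n) * \<bar>m (\<lambda>w. fst w ! i) z - pmf q z\<bar>)" for z
    proof -
      have "(\<Sum>(i, u)\<in>I. slice i u z) - pmf q z = (\<Sum>i<n. (1 / real n) * (m (\<lambda>w. fst w ! i) z - pmf q z))"
        unfolding mass using n by (simp add: right_diff_distrib sum_subtractf diff_divide_distrib)
      then show ?thesis
        by (simp only: order_trans[OF sum_abs] abs_mult) (simp add: order_trans[OF sum_abs] abs_mult)
    qed
    then have "(\<Sum>z\<in>UNIV. \<bar>(\<Sum>(i, u)\<in>I. slice i u z) - pmf q z\<bar>)
        \<le> (\<Sum>z\<in>UNIV. \<Sum>i<n. (1 / real n) * \<bar>m (\<lambda>w. fst w ! i) z - pmf q z\<bar>)" by (rule sum_mono)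
    also have "\<dots> = (\<Sum>i<n. \<Sum>z\<in>UNIV. (1 / real n) * \<bar>m (\<lambda>w. fst w ! i) z - pmf q z\<bar>)" by (rule sum.swap)
    also have "\<dots> = (\<Sum>i<n. (1 / real n) * (\<Sum>z\<in>UNIV. \<bar>m (\<lambda>w. fst w ! i) z - pmf q z\<bar>))"
      by (simp add: sum_distrib_left)
    also have "\<dots> \<le> (\<Sum>i<n. (1 / real n) * e)"
      by (intro sum_mono mult_left_mono) (use letter_dist dist in force)+
    also have "\<dots> = e" using n by simp
    finally show ?thesis .
  qed
  have len: "length (A w) = n \<and> length (B w) = n" if "w \<in> \<Omega>" for w using that by (auto simp: Omega_eq)
  have lenC: "length (C w) = r" if "w \<in> \<Omega>" for w using that lenCs by (auto simp: Omega_eq)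
  note letters = single_letterise[where A=A and B=B and C=C and n=n, OF len, folded S_def]
  have S_ends: "S n 0 = H (C \<otimes> A \<otimes> B)" "S 0 0 = H (C \<otimes> B)" "S n n = H (C \<otimes> A)" "S 0 n = H C"
    unfolding S_def by (rule ent_cong; use len in auto)+
  have h1: "real n * sum_h1 = (\<Sum>i<n. S (Suc i) i - S i i)"
    unfolding sumI sum_slices sum_distrib_left[symmetric] using n by (simp add: ent_letter)
  have h2: "real n * sum_h2 = (\<Sum>i<n. S (Suc i) i - S (Suc i) (Suc i))"
    unfolding sumI sum_slices sum_distrib_left[symmetric] using n by (simp add: ent_letter)
  have mi: "real n * (\<Sum>(i, u)\<in>I. slice_mi (slice i u)) = (\<Sum>i<n. S (Suc i) (Suc i) + S i i - S (Suc i) i - S i (Suc i))"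
    unfolding sumI sum_slices sum_distrib_left[symmetric] using n by (simp add: ent_letter algebra_simps)
  have perm: "H (A \<otimes> C \<otimes> B) = H (C \<otimes> A \<otimes> B)" "H (B \<otimes> C \<otimes> A) = H (C \<otimes> A \<otimes> B)"
    "H (B \<otimes> A) = H (A \<otimes> B)" by (rule ent_cong; auto)+
  have nq: "real n * slice_h1 (pmf q) = H (A \<otimes> B) - H B" "real n * slice_h2 (pmf q) = H (A \<otimes> B) - H A"
    unfolding slice_h1_def slice_h2_def ent_inputs_single by (simp_all add: right_diff_distrib)
  have nmi: "real n * slice_mi (pmf q) = H A + H B - H (A \<otimes> B)"
  proof -
    have "ent UNIV (pmf q) (\<lambda>_. ()) = 0" by (simp add: ent_def marg_def sum_pmf_eq_1)
    then show ?thesis unfolding slice_mi_def ent_inputs_single by (simp add: algebra_simps)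
  qed
  have "H (C \<otimes> A) + H (C \<otimes> B) - H (A \<otimes> C \<otimes> B) - H C \<le> H A + H B - H (A \<otimes> B)"
    by (rule interaction_decreases_mi[OF sum_J lenC]) (use factors_message_1 factors_message_2 in auto)
  note dec = this[unfolded perm]
  have "real n * (\<Sum>(i, u)\<in>I. slice_mi (slice i u)) \<le> real n * slice_mi (pmf q)"
    using letters(3) dec unfolding mi nmi S_ends by linarith
  then show "(\<Sum>(i, u)\<in>I. slice_mi (slice i u)) \<le> slice_mi (pmf q)" using n by simp
  have b1: "real n * (slice_h1 (pmf q) - sum_h1)
      \<le> H (A \<otimes> B) + H (C \<otimes> B) - H (C \<otimes> A \<otimes> B) - H B"
    unfolding right_diff_distrib nq h1 using letters(1) unfolding S_ends by linarith
  have b2: "real n * (slice_h2 (pmf q) - sum_h2)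
      \<le> H (A \<otimes> B) + H (C \<otimes> A) - H (C \<otimes> A \<otimes> B) - H A"
    unfolding right_diff_distrib nq h2 using letters(2) unfolding S_ends by linarith
  have "H (A \<otimes> B) + H (C \<otimes> B) - H (A \<otimes> C \<otimes> B) - H B \<le> (\<Sum>k\<in>{k\<in>{..<r}. even k}. H (\<lambda>w. C w ! k))"
    by (rule rate_bound[OF sum_J lenC factors_message_2])
  then show "real n * (slice_h1 (pmf q) - sum_h1) \<le> (\<Sum>k\<in>{k\<in>{..<r}. even k}. H (\<lambda>w. C w ! k))"
    using b1 unfolding perm by linarith
  have "H (B \<otimes> A) + H (C \<otimes> A) - H (B \<otimes> C \<otimes> A) - H A \<le> (\<Sum>k\<in>{k\<in>{..<r}. odd k}. H (\<lambda>w. C w ! k))"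
    by (rule rate_bound[OF sum_J lenC]) (auto intro: factors_message_1)
  then show "real n * (slice_h2 (pmf q) - sum_h2) \<le> (\<Sum>k\<in>{k\<in>{..<r}. odd k}. H (\<lambda>w. C w ! k))"
    using b2 unfolding perm by linarith
  \<comment> \<open>The three terms on the left are bounded by I(A;C|B), I(B;C|A) and H(C|A B) up to
    the error. Their sum is H(C) - (I(A;B) - I(A;B|C)), and \<open>dec\<close> says that the bracket
    is nonnegative.\<close>
  have "H C \<le> (\<Sum>k<r. H (\<lambda>w. C w ! k))" by (rule ent_messages_le[OF sum_J lenC])
  then show "real n * (slice_h1 (pmf q) - sum_h1
         + (slice_h2 (pmf q) - sum_h2) + out_mi (pmf q))
       \<le> (\<Sum>k<r. H (\<lambda>w. C w ! k)) + 3 * (real n * continuity_error CARD(('x1, 'x2, 'y1, 'y2) quad) e)"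
    using b1 b2 dec out_mi_bound[OF n e dist] unfolding distrib_left by linarith
qed

end

section \<open>The law of an interactive code\<close>

lemma length_hist [simp]: "length (hist C xs m1 m2 k) = k"
  by (induction k) (simp_all add: Let_def)

lemma take_hist: "j \<le> k \<Longrightarrow> take j (hist C xs m1 m2 k) = hist C xs m1 m2 j"
proof (induction k)
  case (Suc k)
  then show ?case by (cases "j = Suc k") (simp_all add: Let_def)
qed simp

text \<open>Whether node 1 would have sent its entries of the prescribed transcript h. The other
  node's randomness does not occur, because the history is read off h itself. Entry i, counted from
  zero, is message \<open>Suc i\<close>, so node 1 owns the even positions.\<close>

definition cons1 :: "('x1, 'x2, 'y1, 'y2) coord_code \<Rightarrow> nat list \<Rightarrow> 'x1 list \<Rightarrow> real \<Rightarrow> bool" where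
  "cons1 C h x m \<longleftrightarrow> (\<forall>i<length h. even i \<longrightarrow> enc1 C (Suc i) (take i h) x m = h ! i)"

definition cons2 :: "('x1, 'x2, 'y1, 'y2) coord_code \<Rightarrow> nat list \<Rightarrow> 'x2 list \<Rightarrow> real \<Rightarrow> bool" where
  "cons2 C h x m \<longleftrightarrow> (\<forall>i<length h. odd i \<longrightarrow> enc2 C (Suc i) (take i h) x m = h ! i)"

lemma cons1_snoc: "cons1 C (h @ [c]) x m \<longleftrightarrow> cons1 C h x m \<and> (even (length h) \<longrightarrow> enc1 C (Suc (length h)) h x m = c)"
  unfolding cons1_def by (auto simp: less_Suc_eq nth_append)

lemma cons2_snoc: "cons2 C (h @ [c]) x m \<longleftrightarrow> cons2 C h x m \<and> (odd (length h) \<longrightarrow> enc2 C (Suc (length h)) h x m = c)"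
  unfolding cons2_def by (auto simp: less_Suc_eq nth_append)

text \<open>Since each message is chosen by one node from the history and its own data, the event of a
  given transcript is a rectangle in the private randomness of the two nodes.\<close>

lemma hist_eq_iff:
  "hist C xs m1 m2 k = h \<longleftrightarrow> length h = k \<and> cons1 C h (map fst xs) m1 \<and> cons2 C h (map snd xs) m2"
proof (induction k arbitrary: h)
  case 0 then show ?case by (auto simp: cons1_def cons2_def)
next
  case (Suc k)
  show ?case
  proof (cases h rule: rev_cases)
    case Nil then show ?thesis by (simp add: Let_def)
  next
    case (snoc h' c)
    show ?thesis
      using Suc[of h'] Suc[of "hist C xs m1 m2 k"]
      by (auto simp: snoc Let_def cons1_snoc cons2_snoc)
  qed
qed

definition kern1 :: "('x1, 'x2, 'y1, 'y2) coord_code \<Rightarrow> nat list \<Rightarrow> 'x1 list \<Rightarrow> real" where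
  "kern1 C h x = measure (rnd1 C) {m. cons1 C h x m}"
definition kern2 :: "('x1, 'x2, 'y1, 'y2) coord_code \<Rightarrow> nat list \<Rightarrow> 'x2 list \<Rightarrow> real" where
  "kern2 C h x = measure (rnd2 C) {m. cons2 C h x m}"
definition out1 :: "nat \<Rightarrow> ('x1, 'x2, 'y1, 'y2) coord_code \<Rightarrow> nat list \<Rightarrow> 'x1 list \<Rightarrow> 'y1 list \<Rightarrow> real" where
  "out1 n C c x y = measure (rnd1 C) {m. cons1 C c x m \<and> map (\<lambda>j. dec1 C j c x m) [0..<n] = y}"
definition out2 :: "nat \<Rightarrow> ('x1, 'x2, 'y1, 'y2) coord_code \<Rightarrow> nat list \<Rightarrow> 'x2 list \<Rightarrow> 'y2 list \<Rightarrow> real" where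
  "out2 n C c x y = measure (rnd2 C) {m. cons2 C c x m \<and> map (\<lambda>j. dec2 C j c x m) [0..<n] = y}"

locale code =
  fixes q :: "('x1::finite, 'x2::finite, 'y1::finite, 'y2::finite) quad pmf" and n :: nat
    and C :: "('x1, 'x2, 'y1, 'y2) coord_code"
  assumes valid: "valid_code C"
begin

abbreviation "M \<equiv> code_space q n C"
abbreviation "PX \<equiv> replicate_pmf n (map_pmf XX q)"

sublocale R1: prob_space "rnd1 C" using valid by (simp add: valid_code_def)
sublocale R2: prob_space "rnd2 C" using valid by (simp add: valid_code_def)
sublocale R: pair_prob_space "rnd1 C" "rnd2 C" ..
sublocale MP: pair_prob_space "measure_pmf PX" "rnd1 C \<Otimes>\<^sub>M rnd2 C" ..
sublocale M: prob_space M
  unfolding code_space_def by (rule MP.prob_space_axioms)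

lemma sets_rnd [simp, measurable_cong]: "sets (rnd1 C) = sets borel" "sets (rnd2 C) = sets borel"
  using valid by (simp_all add: valid_code_def)

lemma space_rnd [simp]: "space (rnd1 C) = UNIV" "space (rnd2 C) = UNIV"
  using sets_eq_imp_space_eq[OF sets_rnd(1)] sets_eq_imp_space_eq[OF sets_rnd(2)] by simp_all

lemma space_M [simp]: "space M = UNIV"
  by (simp add: code_space_def space_pair_measure)

lemma enc_dec_measurable [measurable]:
  "enc1 C i h xs \<in> measurable borel (count_space UNIV)" "enc2 C i h ys \<in> measurable borel (count_space UNIV)"
  "dec1 C i h xs \<in> measurable borel (count_space UNIV)" "dec2 C i h ys \<in> measurable borel (count_space UNIV)"
  using valid by (simp_all add: valid_code_def)

lemma measurable_coords [measurable]:
  "fst \<in> measurable M (count_space UNIV)" "(\<lambda>w. fst (snd w)) \<in> measurable M borel" "(\<lambda>w. snd (snd w)) \<in> measurable M borel"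
proof -
  have "fst \<in> measurable M (measure_pmf PX)" unfolding code_space_def by (rule measurable_fst)
  then show "fst \<in> measurable M (count_space UNIV)" by simp
  have "(\<lambda>w. fst (snd w)) \<in> measurable M (rnd1 C)" unfolding code_space_def by measurable
  then show "(\<lambda>w. fst (snd w)) \<in> measurable M borel" by (simp cong: measurable_cong_sets)
  have "(\<lambda>w. snd (snd w)) \<in> measurable M (rnd2 C)" unfolding code_space_def by measurable
  then show "(\<lambda>w. snd (snd w)) \<in> measurable M borel" by (simp cong: measurable_cong_sets)
qed

abbreviation hs :: "nat \<Rightarrow> ('x1 \<times> 'x2) list \<times> real \<times> real \<Rightarrow> nat list" where
  "hs k w \<equiv> hist C (fst w) (fst (snd w)) (snd (snd w)) k"

text \<open>Encoders are measurable in the randomness only for a fixed history and source block.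
  Both take countably many values, so they are frozen first and then released one after the
  other.\<close>

lemma hist_measurable [measurable]: "hs k \<in> measurable M (count_space UNIV)"
proof (induction k)
  case (Suc k)
  have "(\<lambda>w. h @ [if odd (Suc k) then enc1 C (Suc k) h (map fst xs) (fst (snd w))
           else enc2 C (Suc k) h (map snd xs) (snd (snd w))]) \<in> measurable M (count_space UNIV)" for h xs
  proof (cases "odd (Suc k)")
    case True
    have "(\<lambda>w. enc1 C (Suc k) h (map fst xs) (fst (snd w))) \<in> measurable M (count_space UNIV)" by measurable
    from measurable_compose[OF this, of "\<lambda>c. h @ [c]" "count_space UNIV"] True show ?thesis by simp
  next
    case False
    have "(\<lambda>w. enc2 C (Suc k) h (map snd xs) (snd (snd w))) \<in> measurable M (count_space UNIV)" by measurable
    from measurable_compose[OF this, of "\<lambda>c. h @ [c]" "count_space UNIV"] False show ?thesis by simp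
  qed
  then have "(\<lambda>w. hs k w @ [if odd (Suc k) then enc1 C (Suc k) (hs k w) (map fst xs) (fst (snd w))
           else enc2 C (Suc k) (hs k w) (map snd xs) (snd (snd w))]) \<in> measurable M (count_space UNIV)" for xs
    by (rule measurable_compose_countable[OF _ Suc])
  then have "(\<lambda>w. hs k w @ [if odd (Suc k) then enc1 C (Suc k) (hs k w) (map fst (fst w)) (fst (snd w))
           else enc2 C (Suc k) (hs k w) (map snd (fst w)) (snd (snd w))]) \<in> measurable M (count_space UNIV)"
    by (rule measurable_compose_countable[OF _ measurable_coords(1)])
  then show ?case by (simp only: hist.simps Let_def)
qed simp

lemma output_measurable: "code_output n r C \<in> measurable M (count_space UNIV)"
proof -
  let ?o = "\<lambda>xs h w. map (\<lambda>j. (fst (xs ! j), snd (xs ! j), dec1 C j h (map fst xs) (fst (snd w)),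
      dec2 C j h (map snd xs) (snd (snd w)))) [0..<n]"
  have "?o xs h \<in> measurable M (count_space UNIV)" for xs h
  proof -
    have l: "(\<lambda>w. map (\<lambda>j. F j w) [0..<k]) \<in> measurable M (count_space UNIV)"
      if F: "\<And>j. F j \<in> measurable M (count_space UNIV)" for F :: "nat \<Rightarrow> _ \<Rightarrow> 'd::countable" and k
    proof (induction k)
      case (Suc k)
      have "(\<lambda>w. l @ [F k w]) \<in> measurable M (count_space UNIV)" for l
        by (rule measurable_compose[OF F, of "\<lambda>c. l @ [c]" "count_space UNIV"]) simp
      then have "(\<lambda>w. map (\<lambda>j. F j w) [0..<k] @ [F k w]) \<in> measurable M (count_space UNIV)"
        by (rule measurable_compose_countable[OF _ Suc])
      then show ?case by simp
    qed simp
    show ?thesis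
    proof (rule l)
      fix j
      have 1: "(\<lambda>w. dec1 C j h (map fst xs) (fst (snd w))) \<in> measurable M (count_space UNIV)" by measurable
      have 2: "(\<lambda>w. dec2 C j h (map snd xs) (snd (snd w))) \<in> measurable M (count_space UNIV)" by measurable
      have "(\<lambda>w. (fst (xs ! j), snd (xs ! j), y, dec2 C j h (map snd xs) (snd (snd w)))) \<in> measurable M (count_space UNIV)" for y :: 'y1
        by (rule measurable_compose[OF 2, of "\<lambda>c. (fst (xs ! j), snd (xs ! j), y, c)" "count_space UNIV"]) simp
      then show "(\<lambda>w. (fst (xs ! j), snd (xs ! j), dec1 C j h (map fst xs) (fst (snd w)),
          dec2 C j h (map snd xs) (snd (snd w)))) \<in> measurable M (count_space UNIV)"
        by (rule measurable_compose_countable[OF _ 1])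
    qed
  qed
  then have "(\<lambda>w. ?o xs (hs r w) w) \<in> measurable M (count_space UNIV)" for xs
    by (rule measurable_compose_countable[OF _ hist_measurable])
  then have "(\<lambda>w. ?o (fst w) (hs r w) w) \<in> measurable M (count_space UNIV)"
    by (rule measurable_compose_countable[OF _ measurable_coords(1)])
  moreover have "code_output n r C = (\<lambda>w. ?o (fst w) (hs r w) w)"
    by (rule ext) (simp only: code_output_def split_beta)
  ultimately show ?thesis by (simp only:)
qed

lemma event_sets: "f \<in> measurable M (count_space UNIV) \<Longrightarrow> {w. P (f w)} \<in> sets M"
  using measurable_sets[of f M "count_space UNIV" "Collect P"] by (simp add: vimage_def)

lemma cons_sets [measurable]: "{m. cons1 C h x m} \<in> sets borel" "{m. cons2 C h y m} \<in> sets borel"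
proof -
  have "Measurable.pred borel (cons1 C h x)" unfolding cons1_def by measurable
  then show "{m. cons1 C h x m} \<in> sets borel" by (simp add: pred_def)
  have "Measurable.pred borel (cons2 C h y)" unfolding cons2_def by measurable
  then show "{m. cons2 C h y m} \<in> sets borel" by (simp add: pred_def)
qed

lemma out_sets:
  "{m. cons1 C c x m \<and> map (\<lambda>j. dec1 C j c x m) [0..<n] = v} \<in> sets borel"
  "{m. cons2 C c y m \<and> map (\<lambda>j. dec2 C j c y m) [0..<n] = w} \<in> sets borel"
proof -
  have eq: "map f [0..<n] = v \<longleftrightarrow> length v = n \<and> (\<forall>j<n. f j = v ! j)" for f :: "nat \<Rightarrow> 'd" and v
    by (auto simp: list_eq_iff_nth_eq)
  have "Measurable.pred borel (\<lambda>m. length v = n \<and> (\<forall>j<n. dec1 C j c x m = v ! j))" by measurable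
  then have "{m. map (\<lambda>j. dec1 C j c x m) [0..<n] = v} \<in> sets borel" by (simp add: eq pred_def)
  from sets.Int[OF cons_sets(1) this] show "{m. cons1 C c x m \<and> map (\<lambda>j. dec1 C j c x m) [0..<n] = v} \<in> sets borel"
    by (simp add: Collect_conj_eq)
  have "Measurable.pred borel (\<lambda>m. length w = n \<and> (\<forall>j<n. dec2 C j c y m = w ! j))" by measurable
  then have "{m. map (\<lambda>j. dec2 C j c y m) [0..<n] = w} \<in> sets borel" by (simp add: eq pred_def)
  from sets.Int[OF cons_sets(2) this] show "{m. cons2 C c y m \<and> map (\<lambda>j. dec2 C j c y m) [0..<n] = w} \<in> sets borel"
    by (simp add: Collect_conj_eq)
qed

lemma rectangle:
  assumes "E1 \<in> sets borel" "E2 \<in> sets borel"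
  shows "{xs} \<times> (E1 \<times> E2) \<in> sets M"
    "measure M ({xs} \<times> (E1 \<times> E2)) = pmf PX xs * measure (rnd1 C) E1 * measure (rnd2 C) E2"
proof -
  have E: "E1 \<in> sets (rnd1 C)" "E2 \<in> sets (rnd2 C)" using assms by simp_all
  then have E12: "E1 \<times> E2 \<in> sets (rnd1 C \<Otimes>\<^sub>M rnd2 C)" by (rule pair_measureI)
  show "{xs} \<times> (E1 \<times> E2) \<in> sets M" unfolding code_space_def by (rule pair_measureI[OF _ E12]) simp
  have "emeasure M ({xs} \<times> (E1 \<times> E2)) = emeasure (measure_pmf PX) {xs} * emeasure (rnd1 C \<Otimes>\<^sub>M rnd2 C) (E1 \<times> E2)"
    unfolding code_space_def by (rule R.P.emeasure_pair_measure_Times[OF _ E12]) simp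
  also have "emeasure (rnd1 C \<Otimes>\<^sub>M rnd2 C) (E1 \<times> E2) = emeasure (rnd1 C) E1 * emeasure (rnd2 C) E2"
    by (rule R2.emeasure_pair_measure_Times) (rule E)+
  finally show "measure M ({xs} \<times> (E1 \<times> E2)) = pmf PX xs * measure (rnd1 C) E1 * measure (rnd2 C) E2"
    by (simp only: measure_def enn2real_mult emeasure_pmf_single enn2real_ennreal[OF pmf_nonneg] mult.assoc)
qed

text \<open>The sample space contains source lists of every length; only those of length n carry
  mass, and the output symbols are meaningful only there.\<close>

lemma AE_length: "AE w in M. length (fst w) = n"
proof -
  have "AE xs in measure_pmf PX. length xs = n"
    by (simp add: AE_measure_pmf_iff set_replicate_pmf)
  then have "AE xs in distr M (measure_pmf PX) fst. length xs = n"
    unfolding code_space_def by (subst R.P.distr_pair_fst) simp_all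
  then show ?thesis by (subst (asm) AE_distr_iff) (auto simp: code_space_def)
qed

end

locale bounded_code = code q n C
  for q :: "('x1::finite, 'x2::finite, 'y1::finite, 'y2::finite) quad pmf" and n
    and C :: "('x1, 'x2, 'y1, 'y2) coord_code" +
  fixes r N :: nat
  assumes bounded: "\<And>i h x m. enc1 C i h x m \<le> N" "\<And>i h x m. enc2 C i h x m \<le> N"
begin

definition Cs :: "nat list set" where "Cs = {c. set c \<subseteq> {..N} \<and> length c = r}"

definition \<Omega> :: "(('x1, 'x2, 'y1, 'y2) quad list \<times> nat list) set" where
  "\<Omega> = {t. length t = n} \<times> Cs"

definition J :: "('x1, 'x2, 'y1, 'y2) quad list \<times> nat list \<Rightarrow> real" where
  "J = (\<lambda>(t, c). pmf PX (map XX t) * out1 n C c (map X1 t) (map Y1 t) * out2 n C c (map X2 t) (map Y2 t))"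

text \<open>For fixed inputs, transcript and outputs, the conditions on the two private sources are
  separate; this is the origin of the product form of \<open>J\<close>.\<close>

definition rect :: "('x1, 'x2, 'y1, 'y2) quad list \<times> nat list \<Rightarrow> (('x1 \<times> 'x2) list \<times> real \<times> real) set" where
  "rect p = {map XX (fst p)} \<times>
     ({m. cons1 C (snd p) (map X1 (fst p)) m \<and> map (\<lambda>j. dec1 C j (snd p) (map X1 (fst p)) m) [0..<n] = map Y1 (fst p)}
    \<times> {m. cons2 C (snd p) (map X2 (fst p)) m \<and> map (\<lambda>j. dec2 C j (snd p) (map X2 (fst p)) m) [0..<n] = map Y2 (fst p)})"

abbreviation outcome where "outcome w \<equiv> (code_output n r C w, hs r w)"

lemma finite_Cs: "finite Cs"
  unfolding Cs_def by (rule finite_lists_length_eq) simp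

lemma finite_Omega: "finite \<Omega>"
  by (simp add: \<Omega>_def finite_Cs)

lemma hist_bounded: "set (hs k w) \<subseteq> {..N}"
  by (induction k) (simp_all add: Let_def bounded)

lemma outcome_in_Omega: "outcome w \<in> \<Omega>"
  using hist_bounded[where k=r and w=w] by (cases w) (auto simp: \<Omega>_def Cs_def code_output_def)

lemma map_output:
  assumes "length (fst w) = n"
  shows "map XX (code_output n r C w) = fst w" "map X1 (code_output n r C w) = map fst (fst w)"
    "map X2 (code_output n r C w) = map snd (fst w)"
    "map Y1 (code_output n r C w) = map (\<lambda>j. dec1 C j (hs r w) (map fst (fst w)) (fst (snd w))) [0..<n]"
    "map Y2 (code_output n r C w) = map (\<lambda>j. dec2 C j (hs r w) (map snd (fst w)) (snd (snd w))) [0..<n]"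
  using assms by (cases w; auto simp: code_output_def list_eq_iff_nth_eq)+

lemma quad_list_eqI:
  fixes t t' :: "('x1, 'x2, 'y1, 'y2) quad list"
  assumes "map XX t = map XX t'" "map Y1 t = map Y1 t'" "map Y2 t = map Y2 t'"
  shows "t = t'"
proof (rule nth_equalityI)
  show l: "length t = length t'" using arg_cong[OF assms(1), of length] by simp
  fix i assume i: "i < length t"
  have "XX (t ! i) = XX (t' ! i)" using arg_cong[OF assms(1), of "\<lambda>s. s ! i"] i l by simp
  moreover have "Y1 (t ! i) = Y1 (t' ! i)" using arg_cong[OF assms(2), of "\<lambda>s. s ! i"] i l by simp
  moreover have "Y2 (t ! i) = Y2 (t' ! i)" using arg_cong[OF assms(3), of "\<lambda>s. s ! i"] i l by simp
  ultimately show "t ! i = t' ! i" by (cases "t ! i"; cases "t' ! i") auto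
qed

lemma map_fst_XX: "map fst (map XX t) = map X1 t" "map snd (map XX t) = map X2 t"
  by (auto simp: list_eq_iff_nth_eq split: prod.split)

lemma mem_rect_iff:
  assumes len: "length (fst w) = n" and p: "p \<in> \<Omega>"
  shows "w \<in> rect p \<longleftrightarrow> outcome w = p"
proof
  assume w: "w \<in> rect p"
  obtain t c where tc: "p = (t, c)" by (cases p)
  have xs: "fst w = map XX t" using w by (auto simp: rect_def tc)
  have x: "map fst (fst w) = map X1 t" "map snd (fst w) = map X2 t" unfolding xs by (rule map_fst_XX)+
  have h: "hs r w = c" using w p unfolding hist_eq_iff x by (auto simp: rect_def tc \<Omega>_def Cs_def)
  have "code_output n r C w = t"
    by (rule quad_list_eqI; unfold map_output[OF len] h x; use w in \<open>auto simp: rect_def tc\<close>)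
  then show "outcome w = p" by (simp add: h tc)
next
  assume o: "outcome w = p"
  then have h: "snd p = hs r w" and t: "fst p = code_output n r C w" by auto
  have "cons1 C (hs r w) (map fst (fst w)) (fst (snd w))" "cons2 C (hs r w) (map snd (fst w)) (snd (snd w))"
    using hist_eq_iff[of C "fst w" "fst (snd w)" "snd (snd w)" r "hs r w"] by auto
  then show "w \<in> rect p" unfolding rect_def h t map_output[OF len] by (simp add: mem_Times_iff)
qed

lemma rect_measure: "rect p \<in> sets M" "measure M (rect p) = J p"
proof -
  obtain t c where tc: "p = (t, c)" by (cases p)
  show "rect p \<in> sets M" unfolding rect_def by (rule rectangle[OF out_sets])
  show "measure M (rect p) = J p" unfolding rect_def J_def tc
    by (subst rectangle(2)[OF out_sets]) (simp add: out1_def out2_def)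
qed

text \<open>Up to a null set, an event decided by outputs and transcript is a finite disjoint union
  of rectangles. This replaces the measure space by the finite law \<open>J\<close>.\<close>

lemma law_measure:
  assumes E: "E \<in> sets M" and eq: "\<And>w. length (fst w) = n \<Longrightarrow> w \<in> E \<longleftrightarrow> \<Phi> (outcome w)"
  shows "measure M E = (\<Sum>p\<in>{p\<in>\<Omega>. \<Phi> p}. J p)"
proof -
  let ?S = "{p\<in>\<Omega>. \<Phi> p}"
  have fin: "finite ?S" using finite_Omega by simp
  have sets: "(\<Union>p\<in>?S. rect p) \<in> sets M" by (rule sets.finite_UN[OF fin rect_measure(1)])
  have AE: "AE w in M. w \<in> E \<longleftrightarrow> w \<in> (\<Union>p\<in>?S. rect p)"
    using AE_length
  proof eventually_elim
    case (elim w)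
    have "w \<in> (\<Union>p\<in>?S. rect p) \<longleftrightarrow> (\<exists>p\<in>?S. outcome w = p)" using mem_rect_iff[OF elim] by auto
    also have "\<dots> \<longleftrightarrow> \<Phi> (outcome w)" using outcome_in_Omega[of w] by auto
    finally show ?case using eq[OF elim] by simp
  qed
  have "measure M E = measure M (\<Union>p\<in>?S. rect p)"
    by (rule M.finite_measure_eq_AE[OF AE E sets])
  also have "\<dots> = (\<Sum>p\<in>?S. measure M (rect p))"
  proof (rule M.finite_measure_finite_Union[OF fin])
    show "rect ` ?S \<subseteq> sets M" using rect_measure(1) by auto
    show "disjoint_family_on rect ?S"
      unfolding disjoint_family_on_def
    proof (intro ballI impI, rule ccontr)
      fix p p' assume p: "p \<in> ?S" "p' \<in> ?S" "p \<noteq> p'" "rect p \<inter> rect p' \<noteq> {}"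
      then obtain w where w: "w \<in> rect p" "w \<in> rect p'" by auto
      have "fst w = map XX (fst p)" using w(1) by (auto simp: rect_def)
      then have "length (fst w) = n" using p(1) by (auto simp: \<Omega>_def)
      then show False using mem_rect_iff[of w p] mem_rect_iff[of w p'] w p by auto
    qed
  qed
  finally show ?thesis by (simp add: rect_measure(2))
qed

lemma marg_law:
  assumes "E \<in> sets M" and "\<And>w. length (fst w) = n \<Longrightarrow> w \<in> E \<longleftrightarrow> X (outcome w) = a"
  shows "marg \<Omega> J X a = measure M E"
  unfolding marg_def by (rule law_measure[symmetric, OF assms])

lemma marg_output: "marg \<Omega> J fst t = measure M {w. code_output n r C w = t}"
  by (rule marg_law) (rule event_sets[OF output_measurable], simp)

lemma marg_message: "k < r \<Longrightarrow> marg \<Omega> J (\<lambda>p. snd p ! k) a = measure M {w. msg C (Suc k) w = a}"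
proof (rule marg_law)
  assume k: "k < r"
  have msg: "msg C (Suc k) w = hs (Suc k) w ! k" for w by (simp only: msg_def split_beta) simp
  show "{w. msg C (Suc k) w = a} \<in> sets M" unfolding msg by (rule event_sets[OF hist_measurable])
  fix w
  have "hs (Suc k) w ! k = hs r w ! k"
    using take_hist[of "Suc k" r C "fst w" "fst (snd w)" "snd (snd w)"] k by (metis Suc_leI lessI nth_take)
  then show "w \<in> {w. msg C (Suc k) w = a} \<longleftrightarrow> snd (outcome w) ! k = a" by (simp only: msg mem_Collect_eq snd_conv)
qed

lemma marg_transcript:
  assumes k: "k \<le> r" and len: "length a = n" "length b = n" "length h = k"
  shows "marg \<Omega> J (\<lambda>(t, c). (map X1 t, map X2 t, take k c)) (a, b, h) = pmf PX (zip a b) * kern1 C h a * kern2 C h b"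
proof -
  let ?E = "{zip a b} \<times> ({m. cons1 C h a m} \<times> {m. cons2 C h b m})"
  have "marg \<Omega> J (\<lambda>(t, c). (map X1 t, map X2 t, take k c)) (a, b, h) = measure M ?E"
  proof (rule marg_law)
    show "?E \<in> sets M" by (rule rectangle[OF cons_sets])
    fix w :: "('x1 \<times> 'x2) list \<times> real \<times> real" assume lw: "length (fst w) = n"
    have "fst w = zip a b \<longleftrightarrow> map fst (fst w) = a \<and> map snd (fst w) = b"
      using len by (metis map_fst_zip map_snd_zip zip_map_fst_snd)
    moreover have "take k (hs r w) = h \<longleftrightarrow> cons1 C h (map fst (fst w)) (fst (snd w)) \<and> cons2 C h (map snd (fst w)) (snd (snd w))"
      unfolding take_hist[OF k] hist_eq_iff using len by simp
    ultimately show "w \<in> ?E \<longleftrightarrow> (case outcome w of (t, c) \<Rightarrow> (map X1 t, map X2 t, take k c)) = (a, b, h)"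
      by (auto simp: map_output[OF lw] mem_Times_iff)
  qed
  also have "\<dots> = pmf PX (zip a b) * kern1 C h a * kern2 C h b"
    unfolding kern1_def kern2_def by (rule rectangle[OF cons_sets])
  finally show ?thesis .
qed

sublocale law: interactive_law q n r Cs "out1 n C" "out2 n C" "kern1 C" "kern2 C" \<Omega> J
proof
  show "finite Cs" by (rule finite_Cs)
  show "length c = r" if "c \<in> Cs" for c using that by (simp add: Cs_def)
  show "0 \<le> out1 n C c x y" "0 \<le> out2 n C c x' y'" for c x y x' y' by (simp_all add: out1_def out2_def)
  show "\<Omega> = {t. length t = n} \<times> Cs" by (rule \<Omega>_def)
  show "J (t, c) = pmf PX (map XX t) * out1 n C c (map X1 t) (map Y1 t) * out2 n C c (map X2 t) (map Y2 t)" for t c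
    unfolding J_def by (simp only: prod.case)
  show "marg \<Omega> J (\<lambda>(t, c). (map X1 t, map X2 t, take k c)) (a, b, h) = pmf PX (zip a b) * kern1 C h a * kern2 C h b"
    if "k \<le> r" "length a = n" "length b = n" "length h = k" for k a b h
    using that by (rule marg_transcript)
  show "kern1 C [] a = 1" for a using R1.prob_space by (simp add: kern1_def cons1_def)
  show "kern2 C [] b = 1" for b using R2.prob_space by (simp add: kern2_def cons2_def)
  show "kern1 C (h @ [x]) a = kern1 C h a" if "odd (length h)" for h x a
    using that by (simp add: kern1_def cons1_snoc)
  show "kern2 C (h @ [x]) b = kern2 C h b" if "even (length h)" for h x b
    using that by (simp add: kern2_def cons2_snoc)
qed

lemma ent_message:
  assumes "k < r"
  shows "law.H (\<lambda>p. snd p ! k) = (\<Sum>a\<le>N. eta (measure M {w. msg C (Suc k) w = a}))"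
proof -
  have "law.H (\<lambda>p. snd p ! k) = (\<Sum>a\<in>(\<lambda>p. snd p ! k) ` \<Omega>. eta (marg \<Omega> J (\<lambda>p. snd p ! k) a))"
    by (rule law.ent_eq_sum_eta)
  also have "\<dots> = (\<Sum>a\<le>N. eta (marg \<Omega> J (\<lambda>p. snd p ! k) a))"
  proof (rule sum.mono_neutral_left)
    show "(\<lambda>p. snd p ! k) ` \<Omega> \<subseteq> {..N}" using assms by (auto simp: \<Omega>_def Cs_def dest!: nth_mem)
  qed (auto simp: marg_eq_0 eta_def)
  finally show ?thesis by (simp add: marg_message[OF assms])
qed

end

section \<open>Truncation of the messages and the outer bound\<close>

text \<open>The value N is absorbing: once a message would reach it, all later messages are N. So
  each truncated message equals the original one as long as no overflow has happened and is the
  constant N afterwards.\<close>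

definition trunc :: "nat \<Rightarrow> ('x1, 'x2, 'y1, 'y2) coord_code \<Rightarrow> ('x1, 'x2, 'y1, 'y2) coord_code" where
  "trunc N C = C\<lparr>
     enc1 := \<lambda>i h x m. if \<exists>a\<in>set h. N \<le> a then N else min N (enc1 C i h x m),
     enc2 := \<lambda>i h x m. if \<exists>a\<in>set h. N \<le> a then N else min N (enc2 C i h x m)\<rparr>"

lemma code_space_trunc [simp]: "code_space q n (trunc N C) = code_space q n C"
  by (simp add: code_space_def trunc_def)

lemma hist_trunc:
  "(\<forall>a\<in>set (hist C xs m1 m2 k). a < N) \<Longrightarrow> hist (trunc N C) xs m1 m2 k = hist C xs m1 m2 k" (is "?good k \<Longrightarrow> ?eq k")
  "\<not> (\<forall>a\<in>set (hist C xs m1 m2 k). a < N) \<Longrightarrow> \<exists>a\<in>set (hist (trunc N C) xs m1 m2 k). N \<le> a" (is "\<not> ?good k \<Longrightarrow> ?ex k")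
proof -
  have "(?good k \<longrightarrow> ?eq k) \<and> (\<not> ?good k \<longrightarrow> ?ex k)"
  proof (induction k)
    case (Suc k)
    define v where "v = (if odd (Suc k) then enc1 C (Suc k) (hist C xs m1 m2 k) (map fst xs) m1
        else enc2 C (Suc k) (hist C xs m1 m2 k) (map snd xs) m2)"
    have h: "hist C xs m1 m2 (Suc k) = hist C xs m1 m2 k @ [v]" by (simp add: Let_def v_def)
    show ?case
    proof (cases "?good k")
      case True
      then have "\<not> (\<exists>a\<in>set (hist C xs m1 m2 k). N \<le> a)" by (auto simp: not_le)
      then have "hist (trunc N C) xs m1 m2 (Suc k) = hist C xs m1 m2 k @ [min N v]"
        using Suc True by (simp add: Let_def v_def) (simp add: trunc_def)
      then show ?thesis using True unfolding h by (auto simp: min_def)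
    next
      case False
      then obtain a where a: "a \<in> set (hist (trunc N C) xs m1 m2 k)" "N \<le> a" using Suc by blast
      have "set (hist (trunc N C) xs m1 m2 k) \<subseteq> set (hist (trunc N C) xs m1 m2 (Suc k))" by (simp add: Let_def) blast
      then have "?ex (Suc k)" using a by blast
      moreover have "\<not> ?good (Suc k)" using False unfolding h by simp
      ultimately show ?thesis by blast
    qed
  qed simp
  then show "?good k \<Longrightarrow> ?eq k" "\<not> ?good k \<Longrightarrow> ?ex k" by blast+
qed

lemma msg_trunc:
  "msg (trunc N C) (Suc k) (xs, m1, m2) =
    (if \<forall>a\<in>set (hist C xs m1 m2 (Suc k)). a < N then msg C (Suc k) (xs, m1, m2) else N)"
proof -
  define h where "h = hist C xs m1 m2 k"
  define h' where "h' = hist (trunc N C) xs m1 m2 k"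
  define v where "v = (\<lambda>h. if odd (Suc k) then enc1 C (Suc k) h (map fst xs) m1 else enc2 C (Suc k) h (map snd xs) m2)"
  have msg: "msg C (Suc k) (xs, m1, m2) = v h" by (simp add: msg_def Let_def nth_append h_def v_def)
  have msg': "msg (trunc N C) (Suc k) (xs, m1, m2) = (if \<exists>a\<in>set h'. N \<le> a then N else min N (v h'))"
    by (simp add: msg_def Let_def nth_append h'_def[symmetric] v_def) (simp add: trunc_def)
  have h: "hist C xs m1 m2 (Suc k) = h @ [v h]" by (simp add: Let_def h_def v_def)
  show ?thesis
  proof (cases "\<forall>a\<in>set h. a < N")
    case True
    then have "h' = h" "\<not> (\<exists>a\<in>set h. N \<le> a)" using hist_trunc(1) by (auto simp: h_def h'_def not_le)
    then show ?thesis using True unfolding msg msg' h by (simp add: min_def)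
  next
    case False
    then have "\<exists>a\<in>set h'. N \<le> a" unfolding h_def h'_def by (rule hist_trunc(2))
    then show ?thesis using False unfolding msg msg' h by simp
  qed
qed

lemma output_trunc:
  assumes "\<forall>a\<in>set (hist C xs m1 m2 r). a < N"
  shows "code_output n r (trunc N C) (xs, m1, m2) = code_output n r C (xs, m1, m2)"
proof -
  have "hist (trunc N C) xs m1 m2 r = hist C xs m1 m2 r"
    using assms by (rule hist_trunc(1))
  then show ?thesis by (simp add: code_output_def) (simp add: trunc_def)
qed

context code
begin

lemma bounded_code_trunc: "bounded_code (trunc N C) N"
proof
  show "valid_code (trunc N C)"
  proof -
    have "(\<lambda>m. if b then N else min N (f m)) \<in> measurable borel (count_space UNIV)"
      if "f \<in> measurable borel (count_space UNIV)" for b and f :: "real \<Rightarrow> nat"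
      using measurable_compose[OF that, of "min N" "count_space UNIV"] by (cases b) simp_all
    then show ?thesis using valid by (simp add: valid_code_def trunc_def)
  qed
qed (simp_all add: trunc_def)

definition bad :: "nat \<Rightarrow> nat \<Rightarrow> (('x1 \<times> 'x2) list \<times> real \<times> real) set" where
  "bad N k = {w. \<not> (\<forall>a\<in>set (hs k w). a < N)}"

lemma bad_sets [simp]: "bad N k \<in> sets M"
  unfolding bad_def by (rule event_sets[OF hist_measurable])

lemma bad_tendsto: "(\<lambda>N. measure M (bad N k)) \<longlonglongrightarrow> 0"
proof -
  have "(\<lambda>N. measure M (bad N k)) \<longlonglongrightarrow> measure M (\<Inter>N. bad N k)"
  proof (rule M.finite_Lim_measure_decseq)
    show "range (\<lambda>N. bad N k) \<subseteq> sets M" by auto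
    show "decseq (\<lambda>N. bad N k)"
      unfolding decseq_def bad_def by (intro allI impI Collect_mono) (meson less_le_trans)
  qed
  moreover have "w \<notin> (\<Inter>N. bad N k)" for w
  proof -
    have "\<forall>a\<in>set (hs k w). a < Suc (Max (insert 0 (set (hs k w))))"
      by (auto simp: less_Suc_eq_le)
    then have "w \<notin> bad (Suc (Max (insert 0 (set (hs k w))))) k" by (simp add: bad_def)
    then show ?thesis by blast
  qed
  then have "(\<Inter>N. bad N k) = {}" by blast
  ultimately show ?thesis by simp
qed

lemma msg_sets: "{w. msg C (Suc k) w = a} \<in> sets M"
proof -
  have "msg C (Suc k) w = hs (Suc k) w ! k" for w by (simp only: msg_def split_beta) simp
  then show ?thesis using event_sets[OF hist_measurable, of "\<lambda>h. h ! k = a" "Suc k"] by (simp only:)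
qed

abbreviation trunc_err :: "nat \<Rightarrow> nat \<Rightarrow> real" where
  "trunc_err N k \<equiv> measure M (bad N (Suc k)) / ln 2 + eta (measure M (bad N (Suc k)))"

text \<open>Truncation moves the mass of the bad event to the value N. Taking mass away from an atom
  below N raises its \<open>eta\<close> by at most that mass over ln 2 (\<open>eta_le_add\<close>),
  and the atom N contributes its own \<open>eta\<close>; these are the two terms of
  \<open>trunc_err\<close>.\<close>

lemma ent_trunc_le:
  "(\<Sum>a\<le>N. eta (measure M {w. msg (trunc N C) (Suc k) w = a}))
   \<le> (\<Sum>a<N. eta (measure M {w. msg C (Suc k) w = a})) + (trunc_err N k)"
proof -
  let ?B = "bad N (Suc k)" and ?E = "\<lambda>a. {w. msg C (Suc k) w = a}"
  have msg': "msg (trunc N C) (Suc k) w = (if w \<in> ?B then N else msg C (Suc k) w)" for w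
    using msg_trunc[of N C k "fst w" "fst (snd w)" "snd (snd w)"] by (simp add: bad_def)
  have msg_less: "msg C (Suc k) w < N" if "w \<notin> ?B" for w
  proof -
    have "msg C (Suc k) w = hs (Suc k) w ! k" by (simp only: msg_def split_beta) simp
    moreover have "hs (Suc k) w ! k \<in> set (hs (Suc k) w)" by (rule nth_mem) (simp only: length_hist lessI)
    ultimately show ?thesis using that unfolding bad_def by fastforce
  qed
  have N: "{w. msg (trunc N C) (Suc k) w = N} = ?B" using msg_less by (auto simp: msg')
  have a: "eta (measure M {w. msg (trunc N C) (Suc k) w = a}) \<le> eta (measure M (?E a)) + measure M (?E a \<inter> ?B) / ln 2"
    if "a < N" for a
  proof -
    have "{w. msg (trunc N C) (Suc k) w = a} = ?E a - ?B" using that by (auto simp: msg')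
    moreover have split: "measure M (?E a) = measure M (?E a - ?B) + measure M (?E a \<inter> ?B)"
    proof -
      have "measure M (?E a) = measure M ((?E a - ?B) \<union> (?E a \<inter> ?B))" by (simp add: Un_Diff_Int)
      also have "\<dots> = measure M (?E a - ?B) + measure M (?E a \<inter> ?B)"
        by (rule M.finite_measure_Union) (auto intro!: sets.Diff sets.Int msg_sets)
      finally show ?thesis .
    qed
    ultimately show ?thesis
      using eta_le_add[of "measure M (?E a - ?B)" "measure M (?E a \<inter> ?B)"] M.prob_le_1[of "?E a"] by simp
  qed
  have "(\<Sum>a<N. measure M (?E a \<inter> ?B)) = measure M (\<Union>a<N. ?E a \<inter> ?B)"
    by (rule M.finite_measure_finite_Union[symmetric])
      (auto simp: disjoint_family_on_def intro!: sets.Int msg_sets)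
  also have "\<dots> \<le> measure M ?B" by (rule M.finite_measure_mono) auto
  finally have sumB: "(\<Sum>a<N. measure M (?E a \<inter> ?B)) \<le> measure M ?B" .
  have "(\<Sum>a\<le>N. eta (measure M {w. msg (trunc N C) (Suc k) w = a}))
      = (\<Sum>a<N. eta (measure M {w. msg (trunc N C) (Suc k) w = a})) + eta (measure M ?B)"
    by (simp add: lessThan_Suc_atMost[symmetric] N)
  also have "\<dots> \<le> (\<Sum>a<N. eta (measure M (?E a)) + measure M (?E a \<inter> ?B) / ln 2) + eta (measure M ?B)"
    by (intro add_right_mono sum_mono) (simp add: a)
  also have "\<dots> = (\<Sum>a<N. eta (measure M (?E a))) + (\<Sum>a<N. measure M (?E a \<inter> ?B)) / ln 2 + eta (measure M ?B)"
    by (simp add: sum.distrib sum_divide_distrib)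
  also have "\<dots> \<le> (\<Sum>a<N. eta (measure M (?E a))) + measure M ?B / ln 2 + eta (measure M ?B)"
    using sumB by (simp add: divide_right_mono)
  finally show ?thesis by simp
qed

text \<open>Both codes live on the same randomness and agree outside the bad event, on which each of
  the two laws has at most the mass of that event.\<close>

lemma output_trunc_dist:
  "(\<Sum>t | length t = n. \<bar>measure M {w. code_output n r (trunc N C) w = t} - measure M {w. code_output n r C w = t}\<bar>)
    \<le> 2 * measure M (bad N r)"
proof -
  interpret T: bounded_code q n "trunc N C" r N by (rule bounded_code_trunc)
  let ?B = "bad N r" and ?F = "\<lambda>t. {w. code_output n r (trunc N C) w = t}" and ?E = "\<lambda>t. {w. code_output n r C w = t}"
  have [simp]: "?F t \<in> sets M" "?E t \<in> sets M" for t
    using T.event_sets[OF T.output_measurable[of r]] event_sets[OF output_measurable[of r]] by simp_all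
  have same: "code_output n r (trunc N C) w = code_output n r C w" if "w \<notin> ?B" for w
    using that output_trunc[of C "fst w" "fst (snd w)" "snd (snd w)" r N n] by (simp add: bad_def)
  have part: "measure M D = measure M (D - ?B) + measure M (D \<inter> ?B)" if "D \<in> sets M" for D
  proof -
    have "measure M D = measure M ((D - ?B) \<union> (D \<inter> ?B))" by (simp add: Un_Diff_Int)
    also have "\<dots> = measure M (D - ?B) + measure M (D \<inter> ?B)"
      by (rule M.finite_measure_Union) (use that in auto)
    finally show ?thesis .
  qed
  have pt: "\<bar>measure M (?F t) - measure M (?E t)\<bar> \<le> measure M (?F t \<inter> ?B) + measure M (?E t \<inter> ?B)" for t
  proof -
    have "?F t - ?B = ?E t - ?B" using same by auto
    then show ?thesis using part[of "?F t"] part[of "?E t"] measure_nonneg[of M "?F t \<inter> ?B"] measure_nonneg[of M "?E t \<inter> ?B"]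
      by (simp del: measure_nonneg)
  qed
  have le: "(\<Sum>t | length t = n. measure M (G t \<inter> ?B)) \<le> measure M ?B"
    if "\<And>t. G t \<in> sets M" "\<And>s t. s \<noteq> t \<Longrightarrow> G s \<inter> G t = {}" for G :: "('x1, 'x2, 'y1, 'y2) quad list \<Rightarrow> _"
  proof -
    have "(\<Sum>t | length t = n. measure M (G t \<inter> ?B)) = measure M (\<Union>t\<in>{t. length t = n}. G t \<inter> ?B)"
    proof (rule M.finite_measure_finite_Union[symmetric])
      show "(\<lambda>t. G t \<inter> ?B) ` {t. length t = n} \<subseteq> sets M"
        by (rule image_subsetI) (rule sets.Int[OF that(1) bad_sets])
      show "disjoint_family_on (\<lambda>t. G t \<inter> ?B) {t. length t = n}"
        using that(2) unfolding disjoint_family_on_def by blast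
    qed simp
    also have "\<dots> \<le> measure M ?B" by (rule M.finite_measure_mono) auto
    finally show ?thesis .
  qed
  have "(\<Sum>t | length t = n. \<bar>measure M (?F t) - measure M (?E t)\<bar>)
      \<le> (\<Sum>t | length t = n. measure M (?F t \<inter> ?B)) + (\<Sum>t | length t = n. measure M (?E t \<inter> ?B))"
    unfolding sum.distrib[symmetric] by (rule sum_mono) (rule pt)
  also have "\<dots> \<le> measure M ?B + measure M ?B" by (intro add_mono le) auto
  finally show ?thesis by simp
qed

lemma msg_entropy_ge: "ennreal (\<Sum>a<N. eta (measure M {w. msg C i w = a})) \<le> msg_entropy q n C i"
proof -
  have "ennreal (\<Sum>a<N. eta (measure M {w. msg C i w = a})) = (\<Sum>a<N. ennreal (eta (measure M {w. msg C i w = a})))"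
    by (rule sum_ennreal[symmetric]) (simp add: eta_nonneg)
  also have "\<dots> \<le> (\<Sum>a. ennreal (eta (measure M {w. msg C i w = a})))" by (rule sum_le_suminf) auto
  finally show ?thesis by (simp add: msg_entropy_def Let_def eta_def)
qed

text \<open>Only partial sums of the entropy series are compared with the rate, so no summability in
  the reals has to be shown.\<close>

lemma rate_ge:
  assumes "enn2ereal (\<Sum>i\<in>S. msg_entropy q n C i) \<le> ereal x" "finite S"
  shows "(\<Sum>i\<in>S. \<Sum>a<N. eta (measure M {w. msg C i w = a})) \<le> x"
proof -
  have "ennreal (\<Sum>i\<in>S. \<Sum>a<N. eta (measure M {w. msg C i w = a})) = (\<Sum>i\<in>S. ennreal (\<Sum>a<N. eta (measure M {w. msg C i w = a})))"
    by (rule sum_ennreal[symmetric]) (simp add: eta_nonneg sum_nonneg)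
  also have "\<dots> \<le> (\<Sum>i\<in>S. msg_entropy q n C i)" by (rule sum_mono) (rule msg_entropy_ge)
  finally have "enn2ereal (ennreal (\<Sum>i\<in>S. \<Sum>a<N. eta (measure M {w. msg C i w = a}))) \<le> ereal x"
    using assms(1) by (meson less_eq_ennreal.rep_eq order_trans)
  then show ?thesis by (simp add: enn2ereal_ennreal sum_nonneg eta_nonneg)
qed

lemma exists_truncation:
  assumes "0 < d"
  obtains N where "2 * measure M (bad N r) \<le> d"
    "(\<Sum>k<r. trunc_err N k) \<le> d"
proof -
  have eta0: "(\<lambda>N. eta (measure M (bad N k))) \<longlonglongrightarrow> 0" for k
  proof -
    have "(\<lambda>N. eta (measure M (bad N k))) \<longlonglongrightarrow> eta 0"
      by (rule continuous_on_tendsto_compose[OF continuous_on_eta bad_tendsto]) auto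
    then show ?thesis by (simp add: eta_def)
  qed
  have "(\<lambda>N. \<Sum>k<r. trunc_err N k) \<longlonglongrightarrow> (\<Sum>k<r. 0 / ln 2 + 0)"
    by (intro tendsto_sum tendsto_add tendsto_divide bad_tendsto eta0 tendsto_const) simp
  then have "\<forall>\<^sub>F N in sequentially. (\<Sum>k<r. trunc_err N k) < d"
    using assms by (intro order_tendstoD(2)) auto
  moreover have "\<forall>\<^sub>F N in sequentially. 2 * measure M (bad N r) < d"
    using tendsto_mult[OF tendsto_const[of 2] bad_tendsto[of r]] assms by (intro order_tendstoD(2)) auto
  ultimately have "\<forall>\<^sub>F N in sequentially. (\<Sum>k<r. trunc_err N k) < d
      \<and> 2 * measure M (bad N r) < d" by eventually_elim auto
  then obtain N where "(\<Sum>k<r. trunc_err N k) < d"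
    "2 * measure M (bad N r) < d" by (auto simp: eventually_sequentially)
  then show ?thesis by (intro that[of N]) auto
qed

end

section \<open>From admissible rates to the outer region\<close>

lemma continuity_error_tendsto: "(continuity_error K \<longlongrightarrow> 0) (at_right 0)"
proof -
  have "((\<lambda>e. e * c + e * log 2 (1 / e) + 2 * e / ln 2) \<longlongrightarrow> 0) (at_right 0)" for c :: real
    unfolding log_def by real_asymp
  then show ?thesis unfolding continuity_error_def[abs_def] .
qed


lemma out_mi_nonneg: "0 \<le> out_mi (pmf q)"
proof -
  interpret finite_mass UNIV "pmf q" by (rule finite_mass_pmf) simp
  have eq: "H (\<lambda>z. (Y1 z, Y2 z, XX z)) = H (\<lambda>z. z)" by (rule ent_cong) auto
  have eq': "(\<lambda>z. (Y1 z, XX z)) = Y1X" "(\<lambda>z. (Y2 z, XX z)) = Y2X"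
    by (auto simp: fun_eq_iff)
  show ?thesis using ent_submodular[of Y1 Y2 XX] unfolding out_mi_def eq eq' by linarith
qed

lemma continuity_error_nonneg: "0 < e \<Longrightarrow> e \<le> 1 \<Longrightarrow> 1 \<le> K \<Longrightarrow> 0 \<le> continuity_error K e"
  by (simp add: continuity_error_def)

lemma slices_of_admissible:
  fixes q :: "('x1::finite, 'x2::finite, 'y1::finite, 'y2::finite) quad pmf"
  assumes adm: "admissible q r R12 R21" and e: "0 < e" "e \<le> 1"
  obtains I :: "(nat \<times> nat list \<times> 'x1 list \<times> 'x2 list) set" and v
  where "finite I" "\<forall>i z. 0 \<le> v i z" "\<forall>i\<in>I. slice_markov (v i)"
    "(\<Sum>z\<in>UNIV. \<Sum>i\<in>I. v i z) = 1" "(\<Sum>z\<in>UNIV. \<bar>(\<Sum>i\<in>I. v i z) - pmf q z\<bar>) \<le> e"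
    "(\<Sum>i\<in>I. slice_mi (v i)) \<le> slice_mi (pmf q)"
    "slice_h1 (pmf q) - (\<Sum>i\<in>I. slice_h1 (v i)) \<le> R12 + e"
    "slice_h2 (pmf q) - (\<Sum>i\<in>I. slice_h2 (v i)) \<le> R21 + e"
    "slice_h1 (pmf q) - (\<Sum>i\<in>I. slice_h1 (v i)) + (slice_h2 (pmf q) - (\<Sum>i\<in>I. slice_h2 (v i))) + out_mi (pmf q)
       \<le> R12 + R21 + e + 3 * continuity_error CARD(('x1, 'x2, 'y1, 'y2) quad) e"
proof -
  \<comment> \<open>One half of e goes to the distance achieved by the code, the other half to its
    truncation.\<close>
  have e2: "0 < e / 2" using e by simp
  obtain n0 where n0: "\<forall>n\<ge>n0. \<exists>C :: ('x1, 'x2, 'y1, 'y2) coord_code.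
        valid_code C \<and>
        enn2ereal (\<Sum>i \<in> {i \<in> {1..r}. odd i}. msg_entropy q n C i) \<le> ereal (real n * R12) \<and>
        enn2ereal (\<Sum>i \<in> {i \<in> {1..r}. even i}. msg_entropy q n C i) \<le> ereal (real n * R21) \<and>
        code_l1_dist q n r C \<le> e / 2"
    using adm e2 unfolding admissible_def by blast
  \<comment> \<open>A single blocklength is enough; it has to be positive because everything is
    divided by n.\<close>
  define n where "n = max n0 1"
  have n: "0 < n" "n0 \<le> n" by (auto simp: n_def)
  from n0 n(2) obtain C :: "('x1, 'x2, 'y1, 'y2) coord_code" where C: "valid_code C"
      "enn2ereal (\<Sum>i \<in> {i \<in> {1..r}. odd i}. msg_entropy q n C i) \<le> ereal (real n * R12)"
      "enn2ereal (\<Sum>i \<in> {i \<in> {1..r}. even i}. msg_entropy q n C i) \<le> ereal (real n * R21)"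
      "code_l1_dist q n r C \<le> e / 2" by blast
  interpret code q n C by unfold_locales (rule C(1))
  obtain N where N: "2 * measure M (bad N r) \<le> e / 2"
    "(\<Sum>k<r. trunc_err N k) \<le> e / 2"
    using exists_truncation[OF e2] by blast
  interpret T: bounded_code q n "trunc N C" r N by (rule bounded_code_trunc)
  let ?err = "\<lambda>k. trunc_err N k"
  let ?h = "\<lambda>i. \<Sum>a<N. eta (measure M {w. msg C i w = a})"
  have H_le: "T.law.H (\<lambda>p. snd p ! k) \<le> ?h (Suc k) + ?err k" if "k < r" for k
    using T.ent_message[OF that] ent_trunc_le[of N k] by (simp only: code_space_trunc)
  have err_nn: "0 \<le> ?err k" for k by (simp add: eta_nonneg)
  have sum_le: "(\<Sum>k\<in>S. T.law.H (\<lambda>p. snd p ! k)) \<le> (\<Sum>k\<in>S. ?h (Suc k)) + (\<Sum>k\<in>S. ?err k)" if "S \<subseteq> {..<r}" for S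
    unfolding sum.distrib[symmetric] using that by (intro sum_mono H_le) auto
  have err_le: "(\<Sum>k\<in>S. ?err k) \<le> e / 2" if "S \<subseteq> {..<r}" for S
    using sum_mono2[OF _ that, of ?err] err_nn N(2) by fastforce
  \<comment> \<open>The truncation error is one half of e for the whole block and is absorbed in n
    times e.\<close>
  have "1 * e \<le> real n * e" using n e by (intro mult_right_mono) auto
  then have ne: "e / 2 \<le> real n * e" using e by linarith
  have odd: "(\<Sum>k\<in>{k\<in>{..<r}. even k}. ?h (Suc k)) \<le> real n * R12"
  proof -
    \<comment> \<open>Even rounds counted from zero are the odd messages counted from one, that is,
      those of node 1.\<close>
    have "(\<Sum>k\<in>{k\<in>{..<r}. even k}. ?h (Suc k)) = (\<Sum>i\<in>{i\<in>{1..r}. odd i}. ?h i)"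
      by (rule sum.reindex_bij_witness[of _ "\<lambda>i. i - 1" Suc]) auto
    also have "\<dots> \<le> real n * R12" by (rule rate_ge[OF C(2)]) simp
    finally show ?thesis .
  qed
  have even: "(\<Sum>k\<in>{k\<in>{..<r}. odd k}. ?h (Suc k)) \<le> real n * R21"
  proof -
    have "(\<Sum>k\<in>{k\<in>{..<r}. odd k}. ?h (Suc k)) = (\<Sum>i\<in>{i\<in>{1..r}. even i}. ?h i)"
      by (rule sum.reindex_bij_witness[of _ "\<lambda>i. i - 1" Suc]) (auto elim: oddE)
    also have "\<dots> \<le> real n * R21" by (rule rate_ge[OF C(3)]) simp
    finally show ?thesis .
  qed
  have all: "(\<Sum>k<r. ?h (Suc k)) \<le> real n * R12 + real n * R21"
  proof -
    have "(\<Sum>k<r. ?h (Suc k)) = (\<Sum>k\<in>{k\<in>{..<r}. even k} \<union> {k\<in>{..<r}. odd k}. ?h (Suc k))"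
      by (rule sum.cong) auto
    also have "\<dots> = (\<Sum>k\<in>{k\<in>{..<r}. even k}. ?h (Suc k)) + (\<Sum>k\<in>{k\<in>{..<r}. odd k}. ?h (Suc k))"
      by (rule sum.union_disjoint) auto
    finally show ?thesis using odd even by linarith
  qed
  have dist: "(\<Sum>t | length t = n. \<bar>marg T.\<Omega> T.J fst t - pmf (replicate_pmf n q) t\<bar>) \<le> e"
  proof -
    let ?F = "\<lambda>t. measure M {w. code_output n r (trunc N C) w = t}" and ?E = "\<lambda>t. measure M {w. code_output n r C w = t}"
    have "(\<Sum>t | length t = n. \<bar>?F t - pmf (replicate_pmf n q) t\<bar>)
        \<le> (\<Sum>t | length t = n. \<bar>?F t - ?E t\<bar>) + (\<Sum>t | length t = n. \<bar>?E t - pmf (replicate_pmf n q) t\<bar>)"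
      unfolding sum.distrib[symmetric] by (rule sum_mono) simp
    also have "\<dots> \<le> 2 * measure M (bad N r) + e / 2"
      using output_trunc_dist[of r N] C(4) by (simp add: code_l1_dist_def)
    finally show ?thesis using N(1) by (simp add: T.marg_output)
  qed
  note sl = T.law.single_letter_slices[OF n(1) e dist]
  let ?I = "Sigma {..<n} (\<lambda>i. T.law.U i ` T.\<Omega>)" and ?v = "\<lambda>(i, u). T.law.slice i u"
  have cancel: "x \<le> y" if "real n * x \<le> real n * y" for x y using that n(1) by simp
  have s: "(\<lambda>p. F (?v p)) = (\<lambda>(i, u). F (T.law.slice i u))" for F :: "_ \<Rightarrow> real" by (auto simp: fun_eq_iff)
  have sub: "{k\<in>{..<r}. P k} \<subseteq> {..<r}" for P by auto
  have sz: "(\<lambda>p. ?v p z) = (\<lambda>(i, u). T.law.slice i u z)" for z by (auto simp: fun_eq_iff)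
  show ?thesis
  proof (rule that[of ?I ?v]; (intro allI ballI)?)
    show "finite ?I" by (rule sl(1))
    show "0 \<le> ?v i z" for i z using sl(2) by (cases i) simp
    show "slice_markov (?v i)" if "i \<in> ?I" for i using sl(3) that by (cases i) auto
    show "(\<Sum>z\<in>UNIV. \<Sum>i\<in>?I. ?v i z) = 1" unfolding sz by (rule sl(4))
    show "(\<Sum>z\<in>UNIV. \<bar>(\<Sum>i\<in>?I. ?v i z) - pmf q z\<bar>) \<le> e" unfolding sz by (rule sl(5))
    show "(\<Sum>i\<in>?I. slice_mi (?v i)) \<le> slice_mi (pmf q)" unfolding s by (rule sl(6))
    show "slice_h1 (pmf q) - (\<Sum>i\<in>?I. slice_h1 (?v i)) \<le> R12 + e" unfolding s
    proof (rule cancel)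
      have "(\<Sum>k\<in>{k\<in>{..<r}. even k}. T.law.H (\<lambda>p. snd p ! k)) \<le> real n * R12 + e / 2"
        using sum_le[OF sub, of even] err_le[OF sub, of even] odd by linarith
      then show "real n * (slice_h1 (pmf q) - (\<Sum>(i, u)\<in>?I. slice_h1 (T.law.slice i u))) \<le> real n * (R12 + e)"
        using sl(7) ne unfolding distrib_left by linarith
    qed
    show "slice_h2 (pmf q) - (\<Sum>i\<in>?I. slice_h2 (?v i)) \<le> R21 + e" unfolding s
    proof (rule cancel)
      have "(\<Sum>k\<in>{k\<in>{..<r}. odd k}. T.law.H (\<lambda>p. snd p ! k)) \<le> real n * R21 + e / 2"
        using sum_le[OF sub, of odd] err_le[OF sub, of odd] even by linarith
      then show "real n * (slice_h2 (pmf q) - (\<Sum>(i, u)\<in>?I. slice_h2 (T.law.slice i u))) \<le> real n * (R21 + e)"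
        using sl(8) ne unfolding distrib_left by linarith
    qed
    show "slice_h1 (pmf q) - (\<Sum>i\<in>?I. slice_h1 (?v i)) + (slice_h2 (pmf q) - (\<Sum>i\<in>?I. slice_h2 (?v i))) + out_mi (pmf q)
       \<le> R12 + R21 + e + 3 * continuity_error CARD(('x1, 'x2, 'y1, 'y2) quad) e" unfolding s
    proof (rule cancel)
      have "(\<Sum>k<r. T.law.H (\<lambda>p. snd p ! k)) \<le> real n * R12 + real n * R21 + e / 2"
        using sum_le[OF order_refl] err_le[OF order_refl] all by linarith
      moreover have "real n * (R12 + R21 + e + 3 * continuity_error CARD(('x1, 'x2, 'y1, 'y2) quad) e)
        = real n * R12 + real n * R21 + real n * e + 3 * (real n * continuity_error CARD(('x1, 'x2, 'y1, 'y2) quad) e)"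
        by (simp only: distrib_left mult.left_commute)
      ultimately show "real n * (slice_h1 (pmf q) - (\<Sum>(i, u)\<in>?I. slice_h1 (T.law.slice i u))
          + (slice_h2 (pmf q) - (\<Sum>(i, u)\<in>?I. slice_h2 (T.law.slice i u))) + out_mi (pmf q))
        \<le> real n * (R12 + R21 + e + 3 * continuity_error CARD(('x1, 'x2, 'y1, 'y2) quad) e)"
        using sl(9) ne by linarith
    qed
  qed
qed

text \<open>The hypothesis of \<open>hull_of_support_bound\<close>, with all terms fixed by
  \<open>q\<close> and the rates moved to one side: I(X1;U|X2) is H(X1|X2) minus H(X1|X2 U), so a
  lower bound on the weighted slice entropies is an upper bound on the weighted rates.\<close>

lemma slice_system_of_admissible:
  fixes q :: "('x1::finite, 'x2::finite, 'y1::finite, 'y2::finite) quad pmf"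
  assumes adm: "admissible q r R12 R21" and l: "0 \<le> l1" "0 \<le> l2"
  shows "\<exists>g\<in>slice_systems q. l1 * slice_h1 (pmf q) + l2 * slice_h2 (pmf q) + min l1 l2 * out_mi (pmf q) - (l1 * R12 + l2 * R21)
    \<le> (\<Sum>u\<in>UNIV. l1 * slice_h1 (g u) + l2 * slice_h2 (g u))"
proof (rule slice_system_of_approximations)
  fix e :: real assume e: "0 < e"
  let ?K = "CARD(('x1, 'x2, 'y1, 'y2) quad)"
  \<comment> \<open>The code is asked for an accuracy d so small that both d itself and the weighted
    sum of all rate errors stay below e.\<close>
  have "((\<lambda>d. (l1 + l2) * (d + 3 * continuity_error ?K d)) \<longlongrightarrow> (l1 + l2) * (0 + 3 * 0)) (at_right 0)"
    by (intro tendsto_intros continuity_error_tendsto)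
  then have "\<forall>\<^sub>F d in at_right 0. (l1 + l2) * (d + 3 * continuity_error ?K d) < e"
    using e by (intro order_tendstoD(2)) auto
  moreover have "\<forall>\<^sub>F d in at_right 0. d \<in> {0<..<min e 1}" using e by (intro eventually_at_right_real) simp
  ultimately have "\<forall>\<^sub>F d in at_right 0. d \<in> {0<..<min e 1} \<and> (l1 + l2) * (d + 3 * continuity_error ?K d) < e"
    by eventually_elim (rule conjI)
  from eventually_happens'[OF trivial_limit_at_right_real this]
  obtain d where d': "d \<in> {0<..<min e 1} \<and> (l1 + l2) * (d + 3 * continuity_error ?K d) < e" by (elim exE)
  then have d: "0 < d" "d \<le> 1" "d \<le> e" "(l1 + l2) * (d + 3 * continuity_error ?K d) \<le> e" by simp_all
  obtain I :: "(nat \<times> nat list \<times> 'x1 list \<times> 'x2 list) set" and v where v: "finite I" "\<forall>i z. 0 \<le> v i z" "\<forall>i\<in>I. slice_markov (v i)"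
    "(\<Sum>z\<in>UNIV. \<Sum>i\<in>I. v i z) = 1" "(\<Sum>z\<in>UNIV. \<bar>(\<Sum>i\<in>I. v i z) - pmf q z\<bar>) \<le> d"
    "(\<Sum>i\<in>I. slice_mi (v i)) \<le> slice_mi (pmf q)"
    "slice_h1 (pmf q) - (\<Sum>i\<in>I. slice_h1 (v i)) \<le> R12 + d"
    "slice_h2 (pmf q) - (\<Sum>i\<in>I. slice_h2 (v i)) \<le> R21 + d"
    "slice_h1 (pmf q) - (\<Sum>i\<in>I. slice_h1 (v i)) + (slice_h2 (pmf q) - (\<Sum>i\<in>I. slice_h2 (v i))) + out_mi (pmf q)
       \<le> R12 + R21 + d + 3 * continuity_error ?K d"
    by (rule slices_of_admissible[OF adm d(1,2)])
  obtain g :: "('x1, 'x2, 'y1, 'y2) quad option \<Rightarrow> ('x1, 'x2, 'y1, 'y2) quad \<Rightarrow> real" where g: "\<forall>u z. 0 \<le> g u z" "\<forall>u. slice_markov (g u)"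
    "\<forall>z. (\<Sum>u\<in>UNIV. g u z) = (\<Sum>i\<in>I. v i z)" "(\<Sum>u\<in>UNIV. slice_mi (g u)) = (\<Sum>i\<in>I. slice_mi (v i))"
    "(\<Sum>i\<in>I. l1 * slice_h1 (v i) + l2 * slice_h2 (v i)) \<le> (\<Sum>u\<in>UNIV. l1 * slice_h1 (g u) + l2 * slice_h2 (g u))"
    by (rule cardinality_reduction[OF v(1) v(2)[rule_format] v(3)[rule_format]])
  define a where "a = slice_h1 (pmf q) - (\<Sum>i\<in>I. slice_h1 (v i))"
  define b where "b = slice_h2 (pmf q) - (\<Sum>i\<in>I. slice_h2 (v i))"
  define E where "E = d + 3 * continuity_error ?K d"
  have "0 < ?K" by (rule finite_UNIV_card_ge_0) simp
  then have "0 \<le> continuity_error ?K d" using d by (intro continuity_error_nonneg) linarith+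
  then have dE: "d \<le> E" by (simp add: E_def)
  have bounds: "a \<le> R12 + E" "b \<le> R21 + E" "a + b + out_mi (pmf q) \<le> R12 + R21 + E"
    using v(7-9) dE by (simp_all add: a_def b_def E_def)
  \<comment> \<open>The smaller weight multiplies the sum-rate bound and the remaining weight the
    single bound of the other rate; so the output term enters with min l1 l2, as the support
    function of the polyhedron requires.\<close>
  have "l1 * a + l2 * b + min l1 l2 * out_mi (pmf q) \<le> l1 * R12 + l2 * R21 + (l1 + l2) * E"
  proof (cases "l1 \<le> l2")
    case True
    have "(l2 - l1) * b + l1 * (a + b + out_mi (pmf q)) \<le> (l2 - l1) * (R21 + E) + l1 * (R12 + R21 + E)"
      by (rule add_mono[OF mult_left_mono mult_left_mono]) (use True l bounds in auto)
    moreover have "0 \<le> l1 * E" using l dE d by simp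
    ultimately show ?thesis using True by (simp add: algebra_simps min_def)
  next
    case False
    have "(l1 - l2) * a + l2 * (a + b + out_mi (pmf q)) \<le> (l1 - l2) * (R12 + E) + l2 * (R12 + R21 + E)"
      by (rule add_mono[OF mult_left_mono mult_left_mono]) (use False l bounds in auto)
    moreover have "0 \<le> l2 * E" using l dE d by simp
    ultimately show ?thesis using False by (simp add: algebra_simps min_def)
  qed
  moreover have "l1 * a + l2 * b = l1 * slice_h1 (pmf q) + l2 * slice_h2 (pmf q) - (\<Sum>i\<in>I. l1 * slice_h1 (v i) + l2 * slice_h2 (v i))"
    by (simp add: a_def b_def sum.distrib sum_distrib_left algebra_simps)
  ultimately have "l1 * slice_h1 (pmf q) + l2 * slice_h2 (pmf q) + min l1 l2 * out_mi (pmf q) - (l1 * R12 + l2 * R21)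
    - (\<Sum>u\<in>UNIV. l1 * slice_h1 (g u) + l2 * slice_h2 (g u)) \<le> e"
    using g(5) d(4) unfolding E_def by linarith
  then show "\<exists>g :: ('x1, 'x2, 'y1, 'y2) quad option \<Rightarrow> ('x1, 'x2, 'y1, 'y2) quad \<Rightarrow> real.
      (\<forall>u z. 0 \<le> g u z) \<and> (\<forall>u. slice_markov (g u)) \<and> (\<Sum>z\<in>UNIV. \<Sum>u\<in>UNIV. g u z) = 1 \<and>
      (\<Sum>z\<in>UNIV. \<bar>(\<Sum>u\<in>UNIV. g u z) - pmf q z\<bar>) \<le> e \<and> (\<Sum>u\<in>UNIV. slice_mi (g u)) \<le> slice_mi (pmf q) \<and>
      l1 * slice_h1 (pmf q) + l2 * slice_h2 (pmf q) + min l1 l2 * out_mi (pmf q) - (l1 * R12 + l2 * R21)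
        - (\<Sum>u\<in>UNIV. l1 * slice_h1 (g u) + l2 * slice_h2 (g u)) \<le> e"
    using g(1,2) v(4-6) d(3) by (intro exI[of _ g]) (simp add: g(3,4) del: split_paired_All)
qed

theorem theorem3:
  fixes q :: "('x1::finite \<times> 'x2::finite \<times> 'y1::finite \<times> 'y2::finite) pmf"
    and r :: nat and R12 R21 :: real
  assumes "admissible q r R12 R21"
  shows "(R12, R21) \<in> R3 q"
proof -
  let ?pt = "\<lambda>g :: ('x1, 'x2, 'y1, 'y2) quad option \<Rightarrow> ('x1, 'x2, 'y1, 'y2) quad \<Rightarrow> real.
    (slice_h1 (pmf q) - (\<Sum>u\<in>UNIV. slice_h1 (g u)), slice_h2 (pmf q) - (\<Sum>u\<in>UNIV. slice_h2 (g u)))"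
  have "(R12, R21) \<in> convex hull {(x, y). \<exists>(a, b)\<in>?pt ` slice_systems q. a \<le> x \<and> b \<le> y \<and> a + b + out_mi (pmf q) \<le> x + y}"
  proof (rule hull_of_support_bound[OF compact_slice_points out_mi_nonneg])
    fix l1 l2 :: real assume "0 \<le> l1" "0 \<le> l2"
    then obtain g where "g \<in> slice_systems q"
      "l1 * slice_h1 (pmf q) + l2 * slice_h2 (pmf q) + min l1 l2 * out_mi (pmf q) - (l1 * R12 + l2 * R21)
        \<le> (\<Sum>u\<in>UNIV. l1 * slice_h1 (g u) + l2 * slice_h2 (g u))"
      using slice_system_of_admissible[OF assms] by blast
    then show "\<exists>(a, b)\<in>?pt ` slice_systems q. l1 * a + l2 * b + min l1 l2 * out_mi (pmf q) \<le> l1 * R12 + l2 * R21"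
      by (intro bexI[of _ "?pt g"]) (auto simp: sum.distrib sum_distrib_left algebra_simps)
  qed
  also have "\<dots> \<subseteq> R3 q" unfolding R3_def
  proof (rule hull_mono, clarify)
    fix x y g assume g: "g \<in> slice_systems q" and xy: "slice_h1 (pmf q) - (\<Sum>u\<in>UNIV. slice_h1 (g u)) \<le> x"
      "slice_h2 (pmf q) - (\<Sum>u\<in>UNIV. slice_h2 (g u)) \<le> y"
      "slice_h1 (pmf q) - (\<Sum>u\<in>UNIV. slice_h1 (g u)) + (slice_h2 (pmf q) - (\<Sum>u\<in>UNIV. slice_h2 (g u))) + out_mi (pmf q) \<le> x + y"
    have g': "\<And>u z. 0 \<le> g u z" "\<And>u. slice_markov (g u)" "\<And>z. (\<Sum>u\<in>UNIV. g u z) = pmf q z"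
      "(\<Sum>u\<in>UNIV. slice_mi (g u)) \<le> slice_mi (pmf q)" using g unfolding slice_systems_def by blast+
    obtain p where p: "p \<in> T3 q"
      "cmi p (\<lambda>(u, x1, x2, y1, y2). x1) (\<lambda>(u, x1, x2, y1, y2). u) (\<lambda>(u, x1, x2, y1, y2). x2)
         = slice_h1 (pmf q) - (\<Sum>u\<in>UNIV. slice_h1 (g u))"
      "cmi p (\<lambda>(u, x1, x2, y1, y2). x2) (\<lambda>(u, x1, x2, y1, y2). u) (\<lambda>(u, x1, x2, y1, y2). x1)
         = slice_h2 (pmf q) - (\<Sum>u\<in>UNIV. slice_h2 (g u))"
      "cmi p (\<lambda>(u, x1, x2, y1, y2). y1) (\<lambda>(u, x1, x2, y1, y2). y2) (\<lambda>(u, x1, x2, y1, y2). (x1, x2))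
         = out_mi (pmf q)"
      by (rule T3_of_slice_system[OF g'])
    show "\<exists>p \<in> T3 q.
      let I1 = cmi p (\<lambda>(u, x1, x2, y1, y2). x1) (\<lambda>(u, x1, x2, y1, y2). u) (\<lambda>(u, x1, x2, y1, y2). x2);
          I2 = cmi p (\<lambda>(u, x1, x2, y1, y2). x2) (\<lambda>(u, x1, x2, y1, y2). u) (\<lambda>(u, x1, x2, y1, y2). x1);
          I3 = cmi p (\<lambda>(u, x1, x2, y1, y2). y1) (\<lambda>(u, x1, x2, y1, y2). y2)
                     (\<lambda>(u, x1, x2, y1, y2). (x1, x2))
      in x \<ge> I1 \<and> y \<ge> I2 \<and> x + y \<ge> I1 + I2 + I3"
      unfolding Let_def by (rule bexI[OF _ p(1)], unfold p(2-4), intro conjI xy)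
  qed
  finally show ?thesis .
qed

end
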